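(* Let $(M,\Omega)$ be a symplectic manifold of dimension $2$ and let $\nabla$ be a symplectic connection on $(M,\Omega)$. Then $\nabla$ is moment flat (that is, $\mathcal{K}(\nabla)=0$) if and only if the vector field $\rho^i=\Omega^{ip}\rho_p$ symplectically dual to the curvature one-form $\rho$ of $\nabla$ is symplectic, i.e. its flow preserves $\Omega$. In particular, if $\nabla$ is projectively flat, then $\nabla$ is moment flat.
   Context: Abstract index notation is used. Indices are raised and lowered by $X_i=X^p\Omega_{pi}$, $X^i=\Omega^{ip}X_p$, where $\Omega^{ip}\Omega_{pj}=-\delta_j{}^i$. A symplectic connection is a torsion-free affine connection $\nabla$ with $\nabla\Omega=0$. Curvature: $\nabla_i\nabla_jX^k-\nabla_j\nabla_iX^k=R_{ijp}{}^kX^p$, $R_{ij}=R_{pij}{}^p$, $R_{ijkl}=R_{ijk}{}^p\Omega_{pl}$. The curvature one-form is $\rho_i=2\nabla^pR_{ip}$. Define $\mathcal{K}(\nabla)=\nabla^i\nabla^jR_{ij}-\tfrac12R^{ij}R_{ij}+\tfrac14R^{ijkl}R_{ijkl}$ (in dimension $2$ the quadratic terms cancel and $\mathcal{K}(\nabla)=\tfrac12\nabla^i\rho_i$). Two torsion-free affine connections are projectively equivalent if they have the same unparametrized geodesics, equivalently their difference tensor is $2\gamma_{(i}\delta_{j)}{}^k$ for a one-form $\gamma$. On a surface, a torsion-free connection $\nabla$ is projectively flat if its projective Cotton tensor $C_{ijk}=-2\nabla_{[i}R_{j]k}-\tfrac23\nabla_kR_{[ij]}$ vanishes (equivalently, it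 is locally projectively equivalent to a flat torsion-free connection); for symplectic connections $R_{[ij]}=0$. *)

theory Defs
  imports "HOL-Analysis.Analysis"
begin

section \<open>Smooth surfaces\<close>

text \<open>\<open>Ck_on\<close> is meant for open sets only.\<close>

fun Ck_on :: "nat \<Rightarrow> ('a::real_normed_vector \<Rightarrow> 'b::real_normed_vector) \<Rightarrow> 'a set \<Rightarrow> bool" where
  "Ck_on 0 f S \<longleftrightarrow> continuous_on S f"
| "Ck_on (Suc k) f S \<longleftrightarrow>
     (\<forall>x\<in>S. f differentiable (at x)) \<and> (\<forall>v. Ck_on k (\<lambda>x. frechet_derivative f (at x) v) S)"

definition smooth_on :: "('a::real_normed_vector \<Rightarrow> 'b::real_normed_vector) \<Rightarrow> 'a set \<Rightarrow> bool" where
  "smooth_on f S \<longleftrightarrow> (\<forall>k. Ck_on k f S)"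

type_synonym 'a chart = "'a set \<times> ('a \<Rightarrow> real^2)"

abbreviation dom_chart :: "'a chart \<Rightarrow> 'a set" where "dom_chart \<kappa> \<equiv> fst \<kappa>"
abbreviation coord :: "'a chart \<Rightarrow> 'a \<Rightarrow> real^2" where "coord \<kappa> \<equiv> snd \<kappa>"
abbreviation ran_chart :: "'a chart \<Rightarrow> (real^2) set" where "ran_chart \<kappa> \<equiv> coord \<kappa> ` dom_chart \<kappa>"
abbreviation param :: "'a chart \<Rightarrow> real^2 \<Rightarrow> 'a" where "param \<kappa> \<equiv> inv_into (dom_chart \<kappa>) (coord \<kappa>)"

definition transition :: "'a chart \<Rightarrow> 'a chart \<Rightarrow> real^2 \<Rightarrow> real^2" where
  "transition \<kappa> \<mu> x = coord \<mu> (param \<kappa> x)"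

definition overlap :: "'a chart \<Rightarrow> 'a chart \<Rightarrow> (real^2) set" where
  "overlap \<kappa> \<mu> = coord \<kappa> ` (dom_chart \<kappa> \<inter> dom_chart \<mu>)"

text \<open>The surface is the whole type \<open>'a\<close>, which is Hausdorff and second countable;
  the atlas need not be maximal.\<close>

definition smooth_surface :: "('a::{t2_space,second_countable_topology}) chart set \<Rightarrow> bool" where
  "smooth_surface \<A> \<longleftrightarrow>
     (\<Union>\<kappa>\<in>\<A>. dom_chart \<kappa>) = UNIV \<and>
     (\<forall>\<kappa>\<in>\<A>. open (dom_chart \<kappa>) \<and> open (ran_chart \<kappa>) \<and>
        homeomorphism (dom_chart \<kappa>) (ran_chart \<kappa>) (coord \<kappa>) (param \<kappa>)) \<and>
     (\<forall>\<kappa>\<in>\<A>. \<forall>\<mu>\<in>\<A>. smooth_on (transition \<kappa> \<mu>) (overlap \<kappa> \<mu>))"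


section \<open>Tensor calculus in a coordinate patch\<close>

text \<open>Components are functions of the coordinates \<open>x :: real^2\<close>, followed by their indices in the
  left-to-right order of the index notation; a derivative index comes first. Connections are
  given by their Christoffel symbols: \<open>\<Gamma> x i j k\<close> is $\Gamma_{ij}{}^k$, with the
  convention $\nabla_i X^k = \partial_i X^k + \Gamma_{ip}{}^k X^p$.\<close>

type_synonym field1 = "real^2 \<Rightarrow> 2 \<Rightarrow> real"
type_synonym field2 = "real^2 \<Rightarrow> 2 \<Rightarrow> 2 \<Rightarrow> real"
type_synonym field3 = "real^2 \<Rightarrow> 2 \<Rightarrow> 2 \<Rightarrow> 2 \<Rightarrow> real"
type_synonym field4 = "real^2 \<Rightarrow> 2 \<Rightarrow> 2 \<Rightarrow> 2 \<Rightarrow> 2 \<Rightarrow> real"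

definition pd :: "2 \<Rightarrow> (real^2 \<Rightarrow> real) \<Rightarrow> real^2 \<Rightarrow> real" where
  "pd i f x = frechet_derivative f (at x) (axis i 1)"

text \<open>$\nabla_i X^k$\<close>

definition nabla_vec :: "field3 \<Rightarrow> field1 \<Rightarrow> field2" where
  "nabla_vec \<Gamma> X x i k = pd i (\<lambda>y. X y k) x + (\<Sum>p\<in>UNIV. \<Gamma> x i p k * X x p)"

text \<open>$\nabla_i T_j{}^k$\<close>

definition nabla_mixed :: "field3 \<Rightarrow> field2 \<Rightarrow> field3" where
  "nabla_mixed \<Gamma> T x i j k = pd i (\<lambda>y. T y j k) x
     - (\<Sum>p\<in>UNIV. \<Gamma> x i j p * T x p k) + (\<Sum>p\<in>UNIV. \<Gamma> x i p k * T x j p)"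

text \<open>$\nabla_i T_{jk}$\<close>

definition nabla2 :: "field3 \<Rightarrow> field2 \<Rightarrow> field3" where
  "nabla2 \<Gamma> T x i j k = pd i (\<lambda>y. T y j k) x
     - (\<Sum>p\<in>UNIV. \<Gamma> x i j p * T x p k) - (\<Sum>p\<in>UNIV. \<Gamma> x i k p * T x j p)"

text \<open>$\nabla_i T_{jkl}$\<close>

definition nabla3 :: "field3 \<Rightarrow> field3 \<Rightarrow> field4" where
  "nabla3 \<Gamma> T x i j k l = pd i (\<lambda>y. T y j k l) x
     - (\<Sum>p\<in>UNIV. \<Gamma> x i j p * T x p k l) - (\<Sum>p\<in>UNIV. \<Gamma> x i k p * T x j p l)
     - (\<Sum>p\<in>UNIV. \<Gamma> x i l p * T x j k p)"

text \<open>The defining identity $\nabla_i\nabla_j X^k - \nabla_j\nabla_i X^k = R_{ijp}{}^k X^p$, read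
  off on the coordinate vector field $X = \partial_p$. That it then holds for every \<open>X\<close> is
  \<open>ricci_identity\<close> below.\<close>

definition coord_field :: "2 \<Rightarrow> field1" where
  "coord_field p x k = (if k = p then 1 else 0)"

definition curv :: "field3 \<Rightarrow> field4" where
  "curv \<Gamma> x i j p k =
     nabla_mixed \<Gamma> (nabla_vec \<Gamma> (coord_field p)) x i j k
     - nabla_mixed \<Gamma> (nabla_vec \<Gamma> (coord_field p)) x j i k"

text \<open>$R_{ij} = R_{pij}{}^p$\<close>

definition ricci :: "field3 \<Rightarrow> field2" where
  "ricci \<Gamma> x i j = (\<Sum>p\<in>UNIV. curv \<Gamma> x p i j p)"

text \<open>$\Omega^{ij}$, normalised by $\Omega^{ip}\Omega_{pj} = -\delta_j{}^i$; hence the sign.\<close>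

definition Omega_up :: "field2 \<Rightarrow> field2" where
  "Omega_up \<Omega> x i j = - (matrix_inv (\<chi> a b. \<Omega> x a b)) $ i $ j"

text \<open>$R_{ijkl} = R_{ijk}{}^p\Omega_{pl}$\<close>

definition curv_low :: "field2 \<Rightarrow> field3 \<Rightarrow> field4" where
  "curv_low \<Omega> \<Gamma> x i j k l = (\<Sum>p\<in>UNIV. curv \<Gamma> x i j k p * \<Omega> x p l)"

definition ricci_up :: "field2 \<Rightarrow> field3 \<Rightarrow> field2" where
  "ricci_up \<Omega> \<Gamma> x i j =
     (\<Sum>p\<in>UNIV. \<Sum>q\<in>UNIV. Omega_up \<Omega> x i p * Omega_up \<Omega> x j q * ricci \<Gamma> x p q)"

definition curv_up :: "field2 \<Rightarrow> field3 \<Rightarrow> field4" where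
  "curv_up \<Omega> \<Gamma> x i j k l =
     (\<Sum>p\<in>UNIV. \<Sum>q\<in>UNIV. \<Sum>r\<in>UNIV. \<Sum>s\<in>UNIV.
        Omega_up \<Omega> x i p * Omega_up \<Omega> x j q * Omega_up \<Omega> x k r * Omega_up \<Omega> x l s
        * curv_low \<Omega> \<Gamma> x p q r s)"

text \<open>$\rho_i = 2\nabla^p R_{ip}$ with $\nabla^p = \Omega^{pq}\nabla_q$, and
  $\rho^i = \Omega^{ip}\rho_p$\<close>

definition rho :: "field2 \<Rightarrow> field3 \<Rightarrow> field1" where
  "rho \<Omega> \<Gamma> x i =
     2 * (\<Sum>p\<in>UNIV. \<Sum>q\<in>UNIV. Omega_up \<Omega> x p q * nabla2 \<Gamma> (ricci \<Gamma>) x q i p)"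

definition rho_up :: "field2 \<Rightarrow> field3 \<Rightarrow> field1" where
  "rho_up \<Omega> \<Gamma> x i = (\<Sum>p\<in>UNIV. Omega_up \<Omega> x i p * rho \<Omega> \<Gamma> x p)"

text \<open>$\mathcal{K}(\nabla) = \nabla^i\nabla^j R_{ij} - \frac12 R^{ij}R_{ij} + \frac14 R^{ijkl}R_{ijkl}$\<close>

definition moment :: "field2 \<Rightarrow> field3 \<Rightarrow> real^2 \<Rightarrow> real" where
  "moment \<Omega> \<Gamma> x =
     (\<Sum>i\<in>UNIV. \<Sum>j\<in>UNIV. \<Sum>p\<in>UNIV. \<Sum>q\<in>UNIV.
        Omega_up \<Omega> x i p * Omega_up \<Omega> x j q * nabla3 \<Gamma> (nabla2 \<Gamma> (ricci \<Gamma>)) x p q i j)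
     - 1/2 * (\<Sum>i\<in>UNIV. \<Sum>j\<in>UNIV. ricci_up \<Omega> \<Gamma> x i j * ricci \<Gamma> x i j)
     + 1/4 * (\<Sum>i\<in>UNIV. \<Sum>j\<in>UNIV. \<Sum>k\<in>UNIV. \<Sum>l\<in>UNIV.
                curv_up \<Omega> \<Gamma> x i j k l * curv_low \<Omega> \<Gamma> x i j k l)"

text \<open>$C_{ijk} = -2\nabla_{[i}R_{j]k} - \frac23\nabla_k R_{[ij]}$, where brackets include the
  factor $\frac12$\<close>

definition ricci_skew :: "field3 \<Rightarrow> field2" where
  "ricci_skew \<Gamma> x i j = (ricci \<Gamma> x i j - ricci \<Gamma> x j i) / 2"

definition cotton :: "field3 \<Rightarrow> field3" where
  "cotton \<Gamma> x i j k =
     - 2 * ((nabla2 \<Gamma> (ricci \<Gamma>) x i j k - nabla2 \<Gamma> (ricci \<Gamma>) x j i k) / 2)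
     - 2/3 * nabla2 \<Gamma> (ricci_skew \<Gamma>) x k i j"


section \<open>Symplectic forms and connections\<close>

text \<open>Global objects are families of components indexed by the charts of the atlas, subject to the
  classical transformation laws; \<open>jac \<tau> x a i\<close> is $\partial_i\tau^a$.\<close>

definition jac :: "(real^2 \<Rightarrow> real^2) \<Rightarrow> real^2 \<Rightarrow> 2 \<Rightarrow> 2 \<Rightarrow> real" where
  "jac \<tau> x a i = pd i (\<lambda>y. \<tau> y $ a) x"

definition symplectic_form ::
    "('a::{t2_space,second_countable_topology}) chart set \<Rightarrow> ('a chart \<Rightarrow> field2) \<Rightarrow> bool" where
  "symplectic_form \<A> \<Omega> \<longleftrightarrow>
     (\<forall>\<kappa>\<in>\<A>. \<forall>i j. smooth_on (\<lambda>x. \<Omega> \<kappa> x i j) (ran_chart \<kappa>)) \<and>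
     (\<forall>\<kappa>\<in>\<A>. \<forall>\<mu>\<in>\<A>. \<forall>x\<in>overlap \<kappa> \<mu>. \<forall>i j.
        \<Omega> \<kappa> x i j =
          (\<Sum>a\<in>UNIV. \<Sum>b\<in>UNIV. jac (transition \<kappa> \<mu>) x a i * jac (transition \<kappa> \<mu>) x b j
             * \<Omega> \<mu> (transition \<kappa> \<mu> x) a b)) \<and>
     (\<forall>\<kappa>\<in>\<A>. \<forall>x\<in>ran_chart \<kappa>.
        (\<forall>i j. \<Omega> \<kappa> x i j = - \<Omega> \<kappa> x j i) \<and>
        invertible (\<chi> i j. \<Omega> \<kappa> x i j) \<and>
        (\<forall>i j k. pd i (\<lambda>y. \<Omega> \<kappa> y j k) x + pd j (\<lambda>y. \<Omega> \<kappa> y k i) x + pd k (\<lambda>y. \<Omega> \<kappa> y i j) x = 0))"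

definition affine_connection ::
    "('a::{t2_space,second_countable_topology}) chart set \<Rightarrow> ('a chart \<Rightarrow> field3) \<Rightarrow> bool" where
  "affine_connection \<A> \<Gamma> \<longleftrightarrow>
     (\<forall>\<kappa>\<in>\<A>. \<forall>i j k. smooth_on (\<lambda>x. \<Gamma> \<kappa> x i j k) (ran_chart \<kappa>)) \<and>
     (\<forall>\<kappa>\<in>\<A>. \<forall>\<mu>\<in>\<A>. \<forall>x\<in>overlap \<kappa> \<mu>. \<forall>i j c.
        (\<Sum>k\<in>UNIV. \<Gamma> \<kappa> x i j k * jac (transition \<kappa> \<mu>) x c k) =
          pd i (\<lambda>y. jac (transition \<kappa> \<mu>) y c j) x
          + (\<Sum>a\<in>UNIV. \<Sum>b\<in>UNIV. \<Gamma> \<mu> (transition \<kappa> \<mu> x) a b c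
               * jac (transition \<kappa> \<mu>) x a i * jac (transition \<kappa> \<mu>) x b j))"

definition torsion_free ::
    "('a::{t2_space,second_countable_topology}) chart set \<Rightarrow> ('a chart \<Rightarrow> field3) \<Rightarrow> bool" where
  "torsion_free \<A> \<Gamma> \<longleftrightarrow> (\<forall>\<kappa>\<in>\<A>. \<forall>x\<in>ran_chart \<kappa>. \<forall>i j k. \<Gamma> \<kappa> x i j k = \<Gamma> \<kappa> x j i k)"

definition symplectic_connection ::
    "('a::{t2_space,second_countable_topology}) chart set
       \<Rightarrow> ('a chart \<Rightarrow> field2) \<Rightarrow> ('a chart \<Rightarrow> field3) \<Rightarrow> bool" where
  "symplectic_connection \<A> \<Omega> \<Gamma> \<longleftrightarrow>
     affine_connection \<A> \<Gamma> \<and> torsion_free \<A> \<Gamma> \<and>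
     (\<forall>\<kappa>\<in>\<A>. \<forall>x\<in>ran_chart \<kappa>. \<forall>i j k. nabla2 (\<Gamma> \<kappa>) (\<Omega> \<kappa>) x i j k = 0)"

definition moment_flat ::
    "('a::{t2_space,second_countable_topology}) chart set
       \<Rightarrow> ('a chart \<Rightarrow> field2) \<Rightarrow> ('a chart \<Rightarrow> field3) \<Rightarrow> bool" where
  "moment_flat \<A> \<Omega> \<Gamma> \<longleftrightarrow> (\<forall>\<kappa>\<in>\<A>. \<forall>x\<in>ran_chart \<kappa>. moment (\<Omega> \<kappa>) (\<Gamma> \<kappa>) x = 0)"

definition projectively_flat ::
    "('a::{t2_space,second_countable_topology}) chart set \<Rightarrow> ('a chart \<Rightarrow> field3) \<Rightarrow> bool" where
  "projectively_flat \<A> \<Gamma> \<longleftrightarrow> (\<forall>\<kappa>\<in>\<A>. \<forall>x\<in>ran_chart \<kappa>. \<forall>i j k. cotton (\<Gamma> \<kappa>) x i j k = 0)"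


section \<open>Flows\<close>

text \<open>Continuity of the curve is required separately: the derivatives below only see the
  values of the curve through \<open>coord \<kappa>\<close>, which is unspecified outside \<open>dom_chart \<kappa>\<close>.\<close>

definition integral_curve ::
    "('a::{t2_space,second_countable_topology}) chart set
       \<Rightarrow> ('a chart \<Rightarrow> field1) \<Rightarrow> real set \<Rightarrow> (real \<Rightarrow> 'a) \<Rightarrow> bool" where
  "integral_curve \<A> X J c \<longleftrightarrow>
     open J \<and> is_interval J \<and> continuous_on J c \<and>
     (\<forall>t\<in>J. \<forall>\<kappa>\<in>\<A>. c t \<in> dom_chart \<kappa> \<longrightarrow>
        ((\<lambda>s. coord \<kappa> (c s)) has_vector_derivative (\<chi> i. X \<kappa> (coord \<kappa> (c t)) i)) (at t))"

definition flows_to ::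
    "('a::{t2_space,second_countable_topology}) chart set
       \<Rightarrow> ('a chart \<Rightarrow> field1) \<Rightarrow> real \<Rightarrow> 'a \<Rightarrow> 'a \<Rightarrow> bool" where
  "flows_to \<A> X t p q \<longleftrightarrow>
     (\<exists>J c. integral_curve \<A> X J c \<and> 0 \<in> J \<and> t \<in> J \<and> c 0 = p \<and> c t = q)"

text \<open>The maximal flow domain, and the time-\<open>t\<close> map of the flow on it.\<close>

definition flow_domain ::
    "('a::{t2_space,second_countable_topology}) chart set
       \<Rightarrow> ('a chart \<Rightarrow> field1) \<Rightarrow> (real \<times> 'a) set" where
  "flow_domain \<A> X = {(t, p). \<exists>q. flows_to \<A> X t p q}"

definition flow ::
    "('a::{t2_space,second_countable_topology}) chart set
       \<Rightarrow> ('a chart \<Rightarrow> field1) \<Rightarrow> real \<Rightarrow> 'a \<Rightarrow> 'a" where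
  "flow \<A> X t p = (THE q. flows_to \<A> X t p q)"

text \<open>At every point \<open>p\<close> where the time-\<open>t\<close> map $\phi_t$ of its
  flow is defined, $\phi_t$ is differentiable and $(\phi_t^*\Omega)_p = \Omega_p$.\<close>

definition symplectic_vector_field ::
    "('a::{t2_space,second_countable_topology}) chart set
       \<Rightarrow> ('a chart \<Rightarrow> field2) \<Rightarrow> ('a chart \<Rightarrow> field1) \<Rightarrow> bool" where
  "symplectic_vector_field \<A> \<Omega> X \<longleftrightarrow>
     (\<forall>(t, p)\<in>flow_domain \<A> X. \<forall>\<kappa>\<in>\<A>. \<forall>\<mu>\<in>\<A>.
        p \<in> dom_chart \<kappa> \<longrightarrow> flow \<A> X t p \<in> dom_chart \<mu> \<longrightarrow>
        (\<exists>D. ((\<lambda>x. coord \<mu> (flow \<A> X t (param \<kappa> x))) has_derivative D) (at (coord \<kappa> p)) \<and>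
             (\<forall>i j. (\<Sum>a\<in>UNIV. \<Sum>b\<in>UNIV. D (axis i 1) $ a * D (axis j 1) $ b
                        * \<Omega> \<mu> (coord \<mu> (flow \<A> X t p)) a b)
                    = \<Omega> \<kappa> (coord \<kappa> p) i j)))"


section \<open>The conventions are consistent\<close>

lemma Omega_up_Omega:
  assumes "invertible (\<chi> a b. \<Omega> x a b)"
  shows "(\<Sum>p\<in>UNIV. Omega_up \<Omega> x i p * \<Omega> x p j) = (if i = j then - 1 else 0)"
proof -
  let ?A = "(\<chi> a b. \<Omega> x a b) :: real^2^2"
  have "matrix_inv ?A ** ?A = mat 1"
    using someI_ex[OF assms[unfolded invertible_def]] by (simp add: matrix_inv_def)
  then have "(matrix_inv ?A ** ?A) $ i $ j = mat 1 $ i $ j"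
    by simp
  then show ?thesis
    by (simp add: matrix_matrix_mult_def mat_def Omega_up_def sum_negf split: if_splits)
qed

lemma pd_const [simp]: "pd i (\<lambda>y. c) x = 0"
  by (simp add: pd_def)

lemma pd_mult:
  assumes "f differentiable (at x)" "g differentiable (at x)"
  shows "pd i (\<lambda>y. f y * g y) x = f x * pd i g x + pd i f x * g x"
proof -
  have "((\<lambda>y. f y * g y) has_derivative
      (\<lambda>h. f x * frechet_derivative g (at x) h + frechet_derivative f (at x) h * g x)) (at x)"
    using assms by (intro has_derivative_mult) (simp_all add: frechet_derivative_works)
  then show ?thesis
    unfolding pd_def by (simp flip: frechet_derivative_at)
qed

lemma pd_add:
  assumes "f differentiable (at x)" "g differentiable (at x)"
  shows "pd i (\<lambda>y. f y + g y) x = pd i f x + pd i g x"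
proof -
  have "((\<lambda>y. f y + g y) has_derivative
      (\<lambda>h. frechet_derivative f (at x) h + frechet_derivative g (at x) h)) (at x)"
    using assms by (intro has_derivative_add) (simp_all add: frechet_derivative_works)
  then show ?thesis
    unfolding pd_def by (simp flip: frechet_derivative_at)
qed

lemma curv_eq:
  assumes "\<And>i j k. \<Gamma> x i j k = \<Gamma> x j i k"
  shows "curv \<Gamma> x i j p k = pd i (\<lambda>y. \<Gamma> y j p k) x - pd j (\<lambda>y. \<Gamma> y i p k) x
    + (\<Sum>q\<in>UNIV. \<Gamma> x i q k * \<Gamma> x j p q) - (\<Sum>q\<in>UNIV. \<Gamma> x j q k * \<Gamma> x i p q)"
proof -
  have 1: "nabla_vec \<Gamma> (coord_field p) = (\<lambda>y i k. \<Gamma> y i p k)"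
    by (intro ext) (simp add: nabla_vec_def coord_field_def if_distrib cong: if_cong)
  have 2: "\<Gamma> x j i q = \<Gamma> x i j q" for q
    by (rule assms)
  show ?thesis
    unfolding curv_def 1 nabla_mixed_def 2 by simp
qed

lemma ricci_identity:
  assumes "\<And>i j k. \<Gamma> x i j k = \<Gamma> x j i k"
    and "\<And>i j k. (\<lambda>y. \<Gamma> y i j k) differentiable (at x)"
    and "\<And>k. (\<lambda>y. X y k) differentiable (at x)"
    and "\<And>j k. pd j (\<lambda>y. X y k) differentiable (at x)"
    and "\<And>i j k. pd i (pd j (\<lambda>y. X y k)) x = pd j (pd i (\<lambda>y. X y k)) x"
  shows "nabla_mixed \<Gamma> (nabla_vec \<Gamma> X) x i j k - nabla_mixed \<Gamma> (nabla_vec \<Gamma> X) x j i k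
    = (\<Sum>p\<in>UNIV. curv \<Gamma> x i j p k * X x p)"
proof -
  have pd_nabla: "pd i (\<lambda>y. nabla_vec \<Gamma> X y j k) x = pd i (pd j (\<lambda>y. X y k)) x
      + (\<Sum>p\<in>UNIV. \<Gamma> x j p k * pd i (\<lambda>y. X y p) x + pd i (\<lambda>y. \<Gamma> y j p k) x * X x p)" for i j
    unfolding nabla_vec_def sum_2 using assms(2-4) by (simp add: pd_add pd_mult)
  have sym: "\<Gamma> x j i q = \<Gamma> x i j q" for q
    by (rule assms(1))
  have curv: "curv \<Gamma> x i j p k = pd i (\<lambda>y. \<Gamma> y j p k) x - pd j (\<lambda>y. \<Gamma> y i p k) x
      + (\<Sum>q\<in>UNIV. \<Gamma> x i q k * \<Gamma> x j p q) - (\<Sum>q\<in>UNIV. \<Gamma> x j q k * \<Gamma> x i p q)" for p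
    using assms(1) by (rule curv_eq)
  have comm: "pd j (pd i (\<lambda>y. X y k)) x = pd i (pd j (\<lambda>y. X y k)) x"
    by (rule assms(5))
  show ?thesis
    unfolding curv nabla_mixed_def pd_nabla sym comm
    by (simp add: nabla_vec_def sum_2 algebra_simps)
qed

end

theory Submission
  imports Defs
begin

text \<open>On a surface \<open>\<Omega>\<close> has a single component \<open>\<omega> = \<Omega>\<^sub>1\<^sub>2\<close>, the Ricci tensor determines the
  curvature, $R_{ijkl} = \Omega_{ij}R_{lk}$, and the quadratic terms of the moment map cancel. What
  remains is half the divergence of \<open>\<rho>\<close>, which is a multiple of $\partial_i(\omega\rho^i)$. By Liouville's
  formula the latter is the rate at which the flow of $\rho^i$ changes \<open>\<Omega>\<close>. A symplectic connection has
  symmetric Ricci tensor, so \<open>\<rho>\<close> is a contraction of the Cotton tensor.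

  Reading Liouville's formula as a statement about the maximal flow requires that $\rho^i$
  transforms as a vector field, and that the flow is differentiable in the initial point. The latter is
  proved by a Gronwall estimate near each point, and is propagated along integral curves by connectedness.\<close>

section \<open>Smooth functions and partial derivatives\<close>

text \<open>No Darboux coordinates are chosen. The density \<open>\<omega>\<close> stays a
  nonvanishing function, and parallelism of \<Omega> enters through one equation: the logarithmic
  derivative of \<open>\<omega>\<close> is the trace of the connection. In a change of charts the
  Jacobian is never inverted; its determinant is nonzero because \<open>\<omega>\<close> is, and the
  laws for Ricci and rho are obtained by cancelling it.

  The obstacle is the global flow. It is a partial map defined by a unique description, so nothing
  can be said of it before integral curves are known to be unique, which uses the Hausdorff
  property; and a trajectory may cross many charts. Vanishing divergence makes the determinant of
  the linearised flow times \<open>\<omega>\<close> constant within one chart. Across charts the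
  determinants of the local flow and of the transition maps telescope. The time step and the
  neighbourhood that allow this depend only on the point reached, not on the time or the starting
  point, so steps can be taken forwards and backwards along the whole trajectory. The converse needs
  only the derivative at time zero.\<close>

lemma frechet_derivative_cong_open:
  assumes "open S" "x \<in> S" "\<And>y. y \<in> S \<Longrightarrow> f y = g y" "f differentiable (at x)"
  shows "g differentiable (at x)" "frechet_derivative g (at x) = frechet_derivative f (at x)"
proof -
  have "(f has_derivative frechet_derivative f (at x)) (at x)"
    using assms(4) frechet_derivative_works by blast
  then have "(g has_derivative frechet_derivative f (at x)) (at x)"
    using assms by (auto intro: has_derivative_transform_within_open)
  then show "g differentiable (at x)" "frechet_derivative g (at x) = frechet_derivative f (at x)"
    by (auto simp: differentiable_def dest: frechet_derivative_at)
qed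

text \<open>Fields such as \<open>curv\<close> and \<open>rho\<close> have a workable formula only
  inside the chart range; this transfers smoothness from the formula to the field.\<close>

lemma Ck_on_cong:
  assumes "open S" "\<And>x. x \<in> S \<Longrightarrow> f x = g x" "Ck_on k f S"
  shows "Ck_on k g S"
  using assms(2,3)
proof (induction k arbitrary: f g)
  case 0
  then show ?case using continuous_on_cong[of S S f g] by simp
next
  case (Suc k)
  have d: "g differentiable (at x)" "frechet_derivative g (at x) = frechet_derivative f (at x)"
    if "x \<in> S" for x
    using frechet_derivative_cong_open[OF assms(1) that, of f g] Suc.prems that by auto
  show ?case
    using d Suc.prems(2) by (auto intro: Suc.IH[of "\<lambda>x. frechet_derivative f (at x) v" for v])
qed

text \<open>The recursion mentions only derivatives of \<open>f\<close>, so monotonicity in the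
  order has to be derived; its base case is that differentiability implies continuity.\<close>

lemma Ck_on_SucD: "Ck_on (Suc k) f S \<Longrightarrow> Ck_on k f S"
proof (induction k arbitrary: f)
  case 0
  then show ?case
    by (auto intro!: continuous_at_imp_continuous_on differentiable_imp_continuous_within)
next
  case (Suc k)
  then show ?case by (metis Ck_on.simps(2))
qed

lemma Ck_on_const: "Ck_on k (\<lambda>x. c) S"
  by (induction k arbitrary: c) auto

text \<open>With \<open>Ck_on_SucE\<close> this trades \<open>frechet_derivative\<close> for any
  explicit derivative family, so that each closure property becomes an induction on the order driven
  by one differentiation rule.\<close>

lemma Ck_on_SucI:
  assumes "open S" "\<And>x. x \<in> S \<Longrightarrow> (f has_derivative f' x) (at x)" "\<And>v. Ck_on k (\<lambda>x. f' x v) S"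
  shows "Ck_on (Suc k) f S"
  unfolding Ck_on.simps
proof (intro conjI ballI allI)
  show "f differentiable (at x)" if "x \<in> S" for x
    using assms(2)[OF that] by (auto simp: differentiable_def)
  have "frechet_derivative f (at x) = f' x" if "x \<in> S" for x
    using frechet_derivative_at[OF assms(2)[OF that]] by simp
  then show "Ck_on k (\<lambda>x. frechet_derivative f (at x) v) S" for v
    by (intro Ck_on_cong[OF assms(1) _ assms(3)[of v]]) simp
qed

lemma Ck_on_SucE:
  assumes "Ck_on (Suc k) f S"
  obtains f' where "\<And>x. x \<in> S \<Longrightarrow> (f has_derivative f' x) (at x)" "\<And>v. Ck_on k (\<lambda>x. f' x v) S"
  using assms that[of "\<lambda>x. frechet_derivative f (at x)"] by (simp add: frechet_derivative_works)

lemma Ck_on_linear_image: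
  assumes "open S" "bounded_linear h" "Ck_on k f S"
  shows "Ck_on k (\<lambda>x. h (f x)) S"
  using assms(3)
proof (induction k arbitrary: f)
  case 0
  then show ?case using assms(2) by (simp add: bounded_linear.continuous_on)
next
  case (Suc k)
  from Suc.prems obtain f' where
    f': "\<And>x. x \<in> S \<Longrightarrow> (f has_derivative f' x) (at x)" "\<And>v. Ck_on k (\<lambda>x. f' x v) S"
    by (elim Ck_on_SucE) blast
  show ?case
    by (rule Ck_on_SucI[OF assms(1) bounded_linear.has_derivative[OF assms(2) f'(1)]])
      (auto intro: Suc.IH f'(2))
qed

lemma Ck_on_add:
  assumes "open S" "Ck_on k f S" "Ck_on k g S"
  shows "Ck_on k (\<lambda>x. f x + g x) S"
  using assms(2,3)
proof (induction k arbitrary: f g)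
  case 0
  then show ?case by (auto intro: continuous_on_add)
next
  case (Suc k)
  from Suc.prems(1) obtain f' where
    f': "\<And>x. x \<in> S \<Longrightarrow> (f has_derivative f' x) (at x)" "\<And>v. Ck_on k (\<lambda>x. f' x v) S"
    by (elim Ck_on_SucE) blast
  from Suc.prems(2) obtain g' where
    g': "\<And>x. x \<in> S \<Longrightarrow> (g has_derivative g' x) (at x)" "\<And>v. Ck_on k (\<lambda>x. g' x v) S"
    by (elim Ck_on_SucE) blast
  show ?case
    by (rule Ck_on_SucI[OF assms(1) has_derivative_add[OF f'(1) g'(1)]])
      (auto intro: Suc.IH f'(2) g'(2))
qed

lemma Ck_on_scaleR:
  fixes f :: "'a::real_normed_vector \<Rightarrow> real" and g :: "'a \<Rightarrow> 'b::real_normed_vector"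
  assumes "open S" "Ck_on k f S" "Ck_on k g S"
  shows "Ck_on k (\<lambda>x. f x *\<^sub>R g x) S"
  using assms(2,3)
proof (induction k arbitrary: f g)
  case 0
  then show ?case by (auto intro: continuous_on_scaleR)
next
  case (Suc k)
  from Suc.prems(1) obtain f' where
    f': "\<And>x. x \<in> S \<Longrightarrow> (f has_derivative f' x) (at x)" "\<And>v. Ck_on k (\<lambda>x. f' x v) S"
    by (elim Ck_on_SucE) blast
  from Suc.prems(2) obtain g' where
    g': "\<And>x. x \<in> S \<Longrightarrow> (g has_derivative g' x) (at x)" "\<And>v. Ck_on k (\<lambda>x. g' x v) S"
    by (elim Ck_on_SucE) blast
  \<comment> \<open>Each term of the Leibniz rule keeps one factor undifferentiated, hence the
    demotion by \<open>Ck_on_SucD\<close>.\<close>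
  show ?case
    by (rule Ck_on_SucI[OF assms(1) has_derivative_scaleR[OF f'(1) g'(1)]])
      (auto intro!: Ck_on_add Suc.IH f'(2) g'(2) assms(1) Suc.prems[THEN Ck_on_SucD])
qed

lemma Ck_on_inverse:
  fixes f :: "'a::real_normed_vector \<Rightarrow> real"
  assumes "open S" "Ck_on k f S" "\<And>x. x \<in> S \<Longrightarrow> f x \<noteq> 0"
  shows "Ck_on k (\<lambda>x. inverse (f x)) S"
  using assms(2)
proof (induction k)
  case 0
  then show ?case using assms(3) by (simp add: continuous_on_inverse)
next
  case (Suc k)
  from Suc.prems obtain f' where
    f': "\<And>x. x \<in> S \<Longrightarrow> (f has_derivative f' x) (at x)" "\<And>v. Ck_on k (\<lambda>x. f' x v) S"
    by (elim Ck_on_SucE) blast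
  have i: "Ck_on k (\<lambda>x. inverse (f x)) S"
    using Suc Ck_on_SucD by blast
  \<comment> \<open>The derivative of the reciprocal contains the reciprocal itself, at the lower
    order supplied by the induction hypothesis.\<close>
  have "Ck_on k (\<lambda>x. - ((inverse (f x) *\<^sub>R f' x v) *\<^sub>R inverse (f x))) S" for v
    by (intro Ck_on_linear_image[OF assms(1) bounded_linear_minus[OF bounded_linear_ident]]
          Ck_on_scaleR i assms(1) f'(2))
  then show ?case
    using f'(1) assms(3) by (intro Ck_on_SucI[OF assms(1) Deriv.has_derivative_inverse]) auto
qed

lemma smooth_on_cong:
  "open S \<Longrightarrow> (\<And>x. x \<in> S \<Longrightarrow> f x = g x) \<Longrightarrow> smooth_on f S \<Longrightarrow> smooth_on g S"
  unfolding smooth_on_def using Ck_on_cong by blast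

lemma smooth_on_const: "smooth_on (\<lambda>x. c) S"
  by (simp add: smooth_on_def Ck_on_const)

lemma smooth_on_add:
  "open S \<Longrightarrow> smooth_on f S \<Longrightarrow> smooth_on g S \<Longrightarrow> smooth_on (\<lambda>x. f x + g x) S"
  by (simp add: smooth_on_def Ck_on_add)

lemma smooth_on_mult:
  fixes f g :: "'a::real_normed_vector \<Rightarrow> real"
  shows "open S \<Longrightarrow> smooth_on f S \<Longrightarrow> smooth_on g S \<Longrightarrow> smooth_on (\<lambda>x. f x * g x) S"
  using Ck_on_scaleR[of S _ f g] by (simp add: smooth_on_def)

lemma smooth_on_uminus:
  "open S \<Longrightarrow> smooth_on f S \<Longrightarrow> smooth_on (\<lambda>x. - f x) S"
  using Ck_on_linear_image[of S uminus _ f, OF _ bounded_linear_minus[OF bounded_linear_ident]]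
  by (simp add: smooth_on_def)

lemma smooth_on_diff:
  "open S \<Longrightarrow> smooth_on f S \<Longrightarrow> smooth_on g S \<Longrightarrow> smooth_on (\<lambda>x. f x - g x) S"
  using smooth_on_add[of S f "\<lambda>x. - g x"] by (simp add: smooth_on_uminus)

lemma smooth_on_divide:
  fixes f g :: "'a::real_normed_vector \<Rightarrow> real"
  assumes "open S" "smooth_on f S" "smooth_on g S" "\<And>x. x \<in> S \<Longrightarrow> g x \<noteq> 0"
  shows "smooth_on (\<lambda>x. f x / g x) S"
  unfolding divide_inverse using assms Ck_on_inverse[of S _ g]
  by (intro smooth_on_mult) (auto simp: smooth_on_def)

lemma smooth_on_sum:
  assumes "open S" "finite I" "\<And>i. i \<in> I \<Longrightarrow> smooth_on (f i) S"
  shows "smooth_on (\<lambda>x. \<Sum>i\<in>I. f i x) S"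
  using assms(2,3) by (induction I rule: finite_induct) (auto intro: smooth_on_const smooth_on_add assms(1))

lemma smooth_on_nth:
  fixes f :: "'a::real_normed_vector \<Rightarrow> real^'n"
  shows "open S \<Longrightarrow> smooth_on f S \<Longrightarrow> smooth_on (\<lambda>x. f x $ i) S"
  using Ck_on_linear_image[of S "\<lambda>v. v $ i" _ f] bounded_linear_vec_nth
  by (auto simp: smooth_on_def)

text \<open>Expansion in the standard basis reduces this to scalar multiples of constants and finite
  sums.\<close>

lemma smooth_on_vec_lambda:
  fixes f :: "'a::real_normed_vector \<Rightarrow> 'n::finite \<Rightarrow> real"
  assumes "open S" "\<And>i. smooth_on (\<lambda>x. f x i) S"
  shows "smooth_on (\<lambda>x. \<chi> i. f x i) S"
proof -
  have "smooth_on (\<lambda>x. f x i *\<^sub>R (axis i 1 :: real^'n)) S" for i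
    unfolding smooth_on_def
    by (intro allI Ck_on_scaleR Ck_on_const assms(1) assms(2)[unfolded smooth_on_def, rule_format])
  then have "smooth_on (\<lambda>x. \<Sum>i\<in>UNIV. f x i *\<^sub>R (axis i 1 :: real^'n)) S"
    by (intro smooth_on_sum assms(1)) auto
  also have "(\<lambda>x. \<Sum>i\<in>UNIV. f x i *\<^sub>R (axis i 1 :: real^'n)) = (\<lambda>x. \<chi> i. f x i)"
    by (intro ext) (simp add: vec_eq_iff axis_def if_distrib cong: if_cong)
  finally show ?thesis .
qed

lemma smooth_on_imp_differentiable: "smooth_on f S \<Longrightarrow> x \<in> S \<Longrightarrow> f differentiable (at x)"
  unfolding smooth_on_def by (metis Ck_on.simps(2))

lemma smooth_on_imp_continuous_on: "smooth_on f S \<Longrightarrow> continuous_on S f"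
  unfolding smooth_on_def by (metis Ck_on.simps(1))

lemma smooth_on_derivative:
  "smooth_on f S \<Longrightarrow> smooth_on (\<lambda>x. frechet_derivative f (at x) v) S"
  unfolding smooth_on_def by (metis Ck_on.simps(2))

lemma smooth_on_pd: "smooth_on f S \<Longrightarrow> smooth_on (pd i f) S"
  unfolding pd_def[abs_def] by (rule smooth_on_derivative)

section \<open>Calculus of coordinate partial derivatives\<close>

lemma frechet_derivative_eq_sum_pd:
  assumes "f differentiable (at x)"
  shows "frechet_derivative f (at x) v = (\<Sum>i\<in>UNIV. v $ i * pd i f x)"
proof -
  have L: "linear (frechet_derivative f (at x))"
    using assms by (rule linear_frechet_derivative)
  have "v = (\<Sum>i\<in>UNIV. v $ i *\<^sub>R axis i 1)"
    by (simp add: basis_expansion scalar_mult_eq_scaleR[symmetric])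
  then have "frechet_derivative f (at x) v = frechet_derivative f (at x) (\<Sum>i\<in>UNIV. v $ i *\<^sub>R axis i 1)"
    by simp
  then show ?thesis
    by (simp add: linear_sum[OF L] linear_cmul[OF L] pd_def)
qed

lemma pd_cong:
  assumes "open S" "x \<in> S" "\<And>y. y \<in> S \<Longrightarrow> f y = g y" "f differentiable (at x)"
  shows "pd i g x = pd i f x"
  unfolding pd_def using frechet_derivative_cong_open[OF assms] by simp

lemma pd_zero:
  assumes "open S" "x \<in> S" "\<And>y. y \<in> S \<Longrightarrow> f y = 0"
  shows "pd i f x = 0"
  using pd_cong[of S x "\<lambda>_. 0" f i] assms by simp

lemma pd_diff:
  assumes "f differentiable (at x)" "g differentiable (at x)"
  shows "pd i (\<lambda>y. f y - g y) x = pd i f x - pd i g x"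
proof -
  have "((\<lambda>y. f y - g y) has_derivative
      (\<lambda>h. frechet_derivative f (at x) h - frechet_derivative g (at x) h)) (at x)"
    using assms by (intro has_derivative_diff) (simp_all add: frechet_derivative_works)
  then show ?thesis
    unfolding pd_def by (simp flip: frechet_derivative_at)
qed

lemma pd_uminus:
  assumes "f differentiable (at x)"
  shows "pd i (\<lambda>y. - f y) x = - pd i f x"
  using pd_diff[of "\<lambda>_. 0" x f i] assms by simp

lemma pd_divide:
  assumes "f differentiable (at x)" "g differentiable (at x)" "g x \<noteq> 0"
  shows "pd i (\<lambda>y. f y / g y) x = (pd i f x * g x - f x * pd i g x) / (g x * g x)"
proof -
  have "((\<lambda>y. f y / g y) has_derivative
      (\<lambda>h. (frechet_derivative f (at x) h * g x - f x * frechet_derivative g (at x) h) / (g x * g x))) (at x)"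
    using assms by (intro has_derivative_divide') (simp_all add: frechet_derivative_works)
  then show ?thesis
    unfolding pd_def by (simp flip: frechet_derivative_at)
qed

lemma pd_compose:
  fixes \<tau> :: "real^2 \<Rightarrow> real^2"
  assumes "g differentiable (at (\<tau> x))" "\<tau> differentiable (at x)"
  shows "(\<lambda>y. g (\<tau> y)) differentiable (at x)"
    and "pd i (\<lambda>y. g (\<tau> y)) x = (\<Sum>a\<in>UNIV. jac \<tau> x a i * pd a g (\<tau> x))"
proof -
  have D: "((\<lambda>y. g (\<tau> y)) has_derivative
      (\<lambda>h. frechet_derivative g (at (\<tau> x)) (frechet_derivative \<tau> (at x) h))) (at x)"
    using assms has_derivative_compose[of \<tau> _ x UNIV g] by (simp add: frechet_derivative_works)
  then show "(\<lambda>y. g (\<tau> y)) differentiable (at x)"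
    by (auto simp: differentiable_def)
  have "frechet_derivative \<tau> (at x) (axis i 1) $ a = jac \<tau> x a i" for a
  proof -
    have "((\<lambda>y. \<tau> y $ a) has_derivative (\<lambda>h. frechet_derivative \<tau> (at x) h $ a)) (at x)"
      using assms(2) bounded_linear.has_derivative[OF bounded_linear_vec_nth]
      by (simp add: frechet_derivative_works)
    then show ?thesis
      by (simp add: jac_def pd_def flip: frechet_derivative_at)
  qed
  moreover have "pd i (\<lambda>y. g (\<tau> y)) x
      = frechet_derivative g (at (\<tau> x)) (frechet_derivative \<tau> (at x) (axis i 1))"
    using D by (simp add: pd_def flip: frechet_derivative_at)
  ultimately show "pd i (\<lambda>y. g (\<tau> y)) x = (\<Sum>a\<in>UNIV. jac \<tau> x a i * pd a g (\<tau> x))"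
    using assms(1) by (simp add: frechet_derivative_eq_sum_pd)
qed


section \<open>Symmetry of second derivatives\<close>

text \<open>The mean value theorem is applied twice to the second difference over the parallelogram
  spanned by \<open>h *\<^sub>R u\<close> and \<open>h *\<^sub>R v\<close>: first along
  \<open>u\<close>, to the increment in direction \<open>v\<close>, then along \<open>v\<close>. The
  bound on \<open>h\<close> keeps the parallelogram inside the ball.\<close>

lemma second_difference_mvt:
  fixes f :: "'a::real_normed_vector \<Rightarrow> real"
  assumes "\<And>y. y \<in> ball x r \<Longrightarrow> (f has_derivative f' y) (at y)"
    and "\<And>y. y \<in> ball x r \<Longrightarrow> ((\<lambda>y. f' y u) has_derivative g' y) (at y)"
    and "0 < h" "h * (norm u + norm v) < r"
  shows "\<exists>\<xi>\<in>ball x r. f (x + h *\<^sub>R u + h *\<^sub>R v) - f (x + h *\<^sub>R u) - f (x + h *\<^sub>R v) + f x = h * h * g' \<xi> v"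
proof -
  have in_ball: "x + s *\<^sub>R u + t *\<^sub>R v \<in> ball x r" if "0 \<le> s" "s \<le> h" "0 \<le> t" "t \<le> h" for s t
  proof -
    have "norm (s *\<^sub>R u + t *\<^sub>R v) \<le> s * norm u + t * norm v"
      using that norm_triangle_ineq[of "s *\<^sub>R u" "t *\<^sub>R v"] by simp
    also have "\<dots> \<le> h * norm u + h * norm v"
      using that by (intro add_mono mult_right_mono) auto
    finally have "norm (x - (x + s *\<^sub>R u + t *\<^sub>R v)) < r"
      using assms(4) norm_minus_cancel[of "s *\<^sub>R u + t *\<^sub>R v"] by (simp add: distrib_left algebra_simps)
    then show ?thesis by (simp add: dist_norm)
  qed
  have lin: "f' y (c *\<^sub>R w) = c * f' y w" if "y \<in> ball x r" for y c w
    using linear_cmul[OF has_derivative_linear[OF assms(1)[OF that]]] by simp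
  have ling: "g' y (c *\<^sub>R w) = c * g' y w" if "y \<in> ball x r" for y c w
    using linear_cmul[OF has_derivative_linear[OF assms(2)[OF that]]] by simp
  \<comment> \<open>Writing \<open>0 *\<^sub>R v\<close> makes both terms instances of one curve, at
    the parameters \<open>t = h\<close> and \<open>t = 0\<close>.\<close>
  define \<phi> where "\<phi> s = f (x + s *\<^sub>R u + h *\<^sub>R v) - f (x + s *\<^sub>R u + 0 *\<^sub>R v)" for s
  have "DERIV \<phi> s :> f' (x + s *\<^sub>R u + h *\<^sub>R v) u - f' (x + s *\<^sub>R u + 0 *\<^sub>R v) u" if "0 \<le> s" "s \<le> h" for s
  proof -
    have "((\<lambda>s. f (x + s *\<^sub>R u + t *\<^sub>R v)) has_real_derivative f' (x + s *\<^sub>R u + t *\<^sub>R v) u) (at s)"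
      if "0 \<le> t" "t \<le> h" for t
    proof -
      have b: "x + s *\<^sub>R u + t *\<^sub>R v \<in> ball x r"
        using \<open>0 \<le> s\<close> \<open>s \<le> h\<close> that in_ball by blast
      have "((\<lambda>s. x + s *\<^sub>R u + t *\<^sub>R v) has_derivative (\<lambda>k. k *\<^sub>R u)) (at s)"
        by (auto intro!: derivative_eq_intros)
      from has_derivative_compose[OF this assms(1)[OF b]] show ?thesis
        by (simp add: has_field_derivative_def lin[OF b] mult_commute_abs)
    qed
    from this[of h] this[of 0] show ?thesis
      unfolding \<phi>_def using assms(3) by (intro DERIV_diff) auto
  qed
  from MVT2[OF assms(3) this] obtain s where s: "0 < s" "s < h"
    and \<phi>: "\<phi> h - \<phi> 0 = h * (f' (x + s *\<^sub>R u + h *\<^sub>R v) u - f' (x + s *\<^sub>R u + 0 *\<^sub>R v) u)"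
    by auto
  have "DERIV (\<lambda>t. f' (x + s *\<^sub>R u + t *\<^sub>R v) u) t :> g' (x + s *\<^sub>R u + t *\<^sub>R v) v" if "0 \<le> t" "t \<le> h" for t
  proof -
    have b: "x + s *\<^sub>R u + t *\<^sub>R v \<in> ball x r"
      using s that in_ball by simp
    have "((\<lambda>t. x + s *\<^sub>R u + t *\<^sub>R v) has_derivative (\<lambda>k. k *\<^sub>R v)) (at t)"
      by (auto intro!: derivative_eq_intros)
    from has_derivative_compose[OF this assms(2)[OF b]] show ?thesis
      by (simp add: has_field_derivative_def ling[OF b] mult_commute_abs)
  qed
  from MVT2[OF assms(3) this] obtain t where t: "0 < t" "t < h"
    and g: "f' (x + s *\<^sub>R u + h *\<^sub>R v) u - f' (x + s *\<^sub>R u + 0 *\<^sub>R v) u = h * g' (x + s *\<^sub>R u + t *\<^sub>R v) v"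
    by auto
  have "f (x + h *\<^sub>R u + h *\<^sub>R v) - f (x + h *\<^sub>R u) - f (x + h *\<^sub>R v) + f x = \<phi> h - \<phi> 0"
    by (simp add: \<phi>_def)
  also have "\<dots> = h * h * g' (x + s *\<^sub>R u + t *\<^sub>R v) v"
    unfolding \<phi> g by simp
  finally show ?thesis
    using in_ball[of s t] s t by force
qed

text \<open>The second difference is symmetric in \<open>u\<close> and \<open>v\<close>, so it
  produces equal values of the two mixed derivatives at two points near \<open>x\<close>; continuity
  at \<open>x\<close> then forbids a gap.\<close>

lemma second_derivative_symmetric:
  fixes f :: "'a::real_normed_vector \<Rightarrow> real"
  assumes "open S" "x \<in> S"
    and f': "\<And>y. y \<in> S \<Longrightarrow> (f has_derivative f' y) (at y)"
    and g': "\<And>y. y \<in> S \<Longrightarrow> ((\<lambda>y. f' y u) has_derivative g' y) (at y)"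
    and k': "\<And>y. y \<in> S \<Longrightarrow> ((\<lambda>y. f' y v) has_derivative k' y) (at y)"
    and cont: "isCont (\<lambda>y. g' y v) x" "isCont (\<lambda>y. k' y u) x"
  shows "g' x v = k' x u"
proof (rule ccontr)
  assume "g' x v \<noteq> k' x u"
  define e where "e = \<bar>g' x v - k' x u\<bar> / 2"
  have "e > 0" using \<open>g' x v \<noteq> k' x u\<close> by (simp add: e_def)
  have "\<forall>\<^sub>F y in nhds x. y \<in> S"
    using assms(1,2) by (simp add: eventually_nhds_in_open)
  moreover have "\<forall>\<^sub>F y in nhds x. dist (g' y v) (g' x v) < e" "\<forall>\<^sub>F y in nhds x. dist (k' y u) (k' x u) < e"
    using cont \<open>e > 0\<close> tendsto_at_iff_tendsto_nhds[of "\<lambda>y. g' y v" x] tendsto_at_iff_tendsto_nhds[of "\<lambda>y. k' y u" x]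
    by (auto simp: isCont_def intro: tendstoD)
  ultimately have "\<forall>\<^sub>F y in nhds x. y \<in> S \<and> dist (g' y v) (g' x v) < e \<and> dist (k' y u) (k' x u) < e"
    by eventually_elim auto
  then obtain r where "r > 0" and r: "\<And>y. y \<in> ball x r \<Longrightarrow> y \<in> S"
      "\<And>y. y \<in> ball x r \<Longrightarrow> dist (g' y v) (g' x v) < e" "\<And>y. y \<in> ball x r \<Longrightarrow> dist (k' y u) (k' x u) < e"
    by (auto simp: eventually_nhds_metric dist_commute)
  \<comment> \<open>The summand 1 keeps the denominator positive even when both directions
    vanish.\<close>
  define h where "h = r / (2 * (norm u + norm v + 1))"
  have n: "0 < 2 * (norm u + norm v + 1)"
    by (smt (verit) norm_ge_zero)
  have h: "0 < h" "h * (norm u + norm v) < r"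
  proof -
    show "0 < h" using n \<open>r > 0\<close> by (simp add: h_def)
    have "norm u + norm v < 2 * (norm u + norm v + 1)"
      by (smt (verit) norm_ge_zero)
    then show "h * (norm u + norm v) < r"
      using n \<open>r > 0\<close> by (simp add: h_def divide_simps mult.commute)
  qed
  obtain \<xi> where "\<xi> \<in> ball x r" and \<xi>: "f (x + h *\<^sub>R u + h *\<^sub>R v) - f (x + h *\<^sub>R u) - f (x + h *\<^sub>R v) + f x = h * h * g' \<xi> v"
    using second_difference_mvt[of x r f f' u g' h v] f' g' r h by blast
  obtain \<eta> where "\<eta> \<in> ball x r" and \<eta>: "f (x + h *\<^sub>R v + h *\<^sub>R u) - f (x + h *\<^sub>R v) - f (x + h *\<^sub>R u) + f x = h * h * k' \<eta> u"
    using second_difference_mvt[of x r f f' v k' h u] f' k' r h by (auto simp: add.commute)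
  have "h * h * g' \<xi> v = h * h * k' \<eta> u"
    using \<xi> \<eta> by (simp add: algebra_simps)
  then have "g' \<xi> v = k' \<eta> u" using h by simp
  moreover have "\<bar>g' \<xi> v - g' x v\<bar> < e" "\<bar>k' \<eta> u - k' x u\<bar> < e"
    using r \<open>\<xi> \<in> ball x r\<close> \<open>\<eta> \<in> ball x r\<close> by (auto simp: dist_real_def)
  ultimately show False by (simp add: e_def abs_if split: if_splits)
qed

lemma pd_commute:
  assumes "open S" "x \<in> S" "smooth_on f S"
  shows "pd i (pd j f) x = pd j (pd i f) x"
proof -
  have 1: "(f has_derivative frechet_derivative f (at y)) (at y)" if "y \<in> S" for y
    using smooth_on_imp_differentiable[OF assms(3) that] by (simp add: frechet_derivative_works)
  have 2: "(pd j f has_derivative frechet_derivative (pd j f) (at y)) (at y)" if "y \<in> S" for y j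
    using smooth_on_imp_differentiable[OF smooth_on_pd[OF assms(3)] that] by (simp add: frechet_derivative_works)
  have 3: "isCont (pd i (pd j f)) x" for i j
    using smooth_on_imp_continuous_on[OF smooth_on_pd[OF smooth_on_pd[OF assms(3)]]] assms(1,2)
    by (simp add: continuous_on_eq_continuous_at)
  show ?thesis
    using second_derivative_symmetric[OF assms(1,2) 1, of "axis j 1" "\<lambda>y. frechet_derivative (pd j f) (at y)"
        "axis i 1" "\<lambda>y. frechet_derivative (pd i f) (at y)"] 2 3
    by (simp add: pd_def[symmetric])
qed

section \<open>Ordinary differential equations\<close>

text \<open>The Picard operator integrates from \<open>-\<epsilon>\<close> instead of \<open>0\<close>, so that both signs of the time are
  treated at once; this costs the factor \<open>3\<close> in the contraction constant.\<close>

lemma picard_local_solution: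
  fixes g :: "real \<Rightarrow> 'a::banach \<Rightarrow> 'a"
  assumes "0 < \<epsilon>" "0 \<le> L" "3 * \<epsilon> * L < 1"
    and cont: "\<And>u. continuous_on {-\<epsilon>..\<epsilon>} u \<Longrightarrow> continuous_on {-\<epsilon>..\<epsilon>} (\<lambda>s. g s (u s))"
    and lip: "\<And>s u v. s \<in> {-\<epsilon>..\<epsilon>} \<Longrightarrow> norm (g s u - g s v) \<le> L * norm (u - v)"
  shows "\<exists>u. u 0 = x \<and> (\<forall>t\<in>{-\<epsilon><..<\<epsilon>}. (u has_vector_derivative g t (u t)) (at t))"
proof -
  \<comment> \<open>Clamping the time lets the operator act on bounded continuous functions of the
    whole line, a complete space. On the open interval the clamp is the identity, so the fixed point
    solves the equation there.\<close>
  define c where "c t = max (-\<epsilon>) (min \<epsilon> t)" for t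
  define I where "I u t = integral {-\<epsilon>..t} (\<lambda>s. g s (u s))" for u t
  define P where "P u = Bcontfun (\<lambda>t. x + I (apply_bcontfun u) (c t) - I (apply_bcontfun u) 0)" for u
  have c: "c t \<in> {-\<epsilon>..\<epsilon>}" for t using assms(1) by (auto simp: c_def)
  have gc: "continuous_on {-\<epsilon>..\<epsilon>} (\<lambda>s. g s (apply_bcontfun u s))" for u
    by (rule cont) simp
  have I: "continuous_on {-\<epsilon>..\<epsilon>} (I (apply_bcontfun u))" for u
    unfolding I_def[abs_def] by (intro indefinite_integral_continuous_1 integrable_continuous_real gc)
  have P: "apply_bcontfun (P u) t = x + I (apply_bcontfun u) (c t) - I (apply_bcontfun u) 0" for u t
  proof -
    let ?h = "\<lambda>t. x + I (apply_bcontfun u) t - I (apply_bcontfun u) 0"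
    have h: "continuous_on {-\<epsilon>..\<epsilon>} ?h" using I by (intro continuous_intros)
    have "continuous_on UNIV (\<lambda>t. ?h (c t))"
      by (rule continuous_on_compose2[OF h]) (use c in \<open>auto simp: c_def[abs_def] intro!: continuous_intros\<close>)
    moreover have "bounded (range (\<lambda>t. ?h (c t)))"
      by (rule bounded_subset[OF compact_imp_bounded[OF compact_continuous_image[OF h]]]) (use c in auto)
    ultimately have "(\<lambda>t. ?h (c t)) \<in> bcontfun" by (simp add: bcontfun_def)
    then show ?thesis by (simp add: P_def Bcontfun_inverse)
  qed
  have bound: "norm (I (apply_bcontfun u) t - I (apply_bcontfun v) t) \<le> L * dist u v * (t + \<epsilon>)"
    if "t \<in> {-\<epsilon>..\<epsilon>}" for u v t
  proof -
    have sub: "{-\<epsilon>..t} \<subseteq> {-\<epsilon>..\<epsilon>}" using that by auto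
    have "I (apply_bcontfun u) t - I (apply_bcontfun v) t
        = integral {-\<epsilon>..t} (\<lambda>s. g s (apply_bcontfun u s) - g s (apply_bcontfun v s))"
      unfolding I_def using continuous_on_subset[OF gc sub]
      by (intro integral_diff[symmetric] integrable_continuous_real)
    moreover have "norm \<dots> \<le> L * dist u v * (t - (-\<epsilon>))"
    proof (rule integral_bound)
      show "continuous_on {-\<epsilon>..t} (\<lambda>s. g s (apply_bcontfun u s) - g s (apply_bcontfun v s))"
        using continuous_on_subset[OF gc sub] by (intro continuous_intros)
      show "norm (g s (apply_bcontfun u s) - g s (apply_bcontfun v s)) \<le> L * dist u v" if "s \<in> {-\<epsilon>..t}" for s
        using lip[of s "apply_bcontfun u s" "apply_bcontfun v s"] sub that
          mult_left_mono[OF dist_bounded[of u s v] \<open>0 \<le> L\<close>] by (auto simp: dist_norm)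
    qed (use that in auto)
    ultimately show ?thesis by simp
  qed
  have "dist (P u) (P v) \<le> (3 * \<epsilon> * L) * dist u v" for u v
  proof (rule dist_bound)
    fix t
    let ?D = "\<lambda>t. I (apply_bcontfun u) t - I (apply_bcontfun v) t"
    have "dist (apply_bcontfun (P u) t) (apply_bcontfun (P v) t) = norm (?D (c t) - ?D 0)"
      by (simp add: P dist_norm algebra_simps)
    also have "\<dots> \<le> norm (?D (c t)) + norm (?D 0)" by (rule norm_triangle_ineq4)
    \<comment> \<open>The integral up to \<open>c t\<close> has length at most twice \<epsilon>, the
      one up to 0 has length \<epsilon>.\<close>
    also have "\<dots> \<le> L * dist u v * (\<epsilon> + \<epsilon>) + L * dist u v * (0 + \<epsilon>)"
    proof (rule add_mono)
      have "L * dist u v * (c t + \<epsilon>) \<le> L * dist u v * (\<epsilon> + \<epsilon>)"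
        using c[of t] \<open>0 \<le> L\<close> by (intro mult_left_mono) auto
      then show "norm (?D (c t)) \<le> L * dist u v * (\<epsilon> + \<epsilon>)"
        using bound[OF c] order_trans by blast
      show "norm (?D 0) \<le> L * dist u v * (0 + \<epsilon>)"
        using bound[of 0] \<open>0 < \<epsilon>\<close> by auto
    qed
    finally show "dist (apply_bcontfun (P u) t) (apply_bcontfun (P v) t) \<le> (3 * \<epsilon> * L) * dist u v"
      by (simp add: algebra_simps)
  qed
  then have "\<exists>!u. P u = u"
    using assms by (intro banach_fix_type[of "3 * \<epsilon> * L"]) auto
  then obtain U where "P U = U" by blast
  define u where "u = apply_bcontfun U"
  have u: "u t = x + I u (c t) - I u 0" for t
    using P[of U t] \<open>P U = U\<close> by (simp add: u_def)
  show ?thesis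
  proof (intro exI[of _ u] conjI ballI)
    show "u 0 = x" using assms(1) by (simp add: u[of 0] c_def)
    fix t assume t: "t \<in> {-\<epsilon><..<\<epsilon>}"
    have "(I u has_vector_derivative g t (u t)) (at t within {-\<epsilon>..\<epsilon>})"
        using integral_has_vector_derivative[OF gc[of U], of t] t by (simp add: I_def[abs_def] u_def)
    then have "(I u has_vector_derivative g t (u t)) (at t)"
      using t at_within_interior[of t "{-\<epsilon>..\<epsilon>}"] by simp
    then have "((\<lambda>t. x + I u t - I u 0) has_vector_derivative g t (u t)) (at t)"
      by (auto intro!: derivative_eq_intros)
    then show "(u has_vector_derivative g t (u t)) (at t)"
      by (rule has_vector_derivative_transform_within_open[OF _ _ t]) (auto simp: u[of s for s] c_def)
  qed
qed

section \<open>Gronwall and Lipschitz estimates\<close>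

text \<open>The squared norm is differentiable even where \<open>w\<close> vanishes. Adding the
  constant \<open>b\<^sup>2\<close> to it absorbs the inhomogeneous term, because twice
  \<open>norm (w t) * b\<close> is at most the sum of the two squares; the result times the decaying
  exponential is nonincreasing.\<close>

lemma gronwall_forward:
  fixes w :: "real \<Rightarrow> 'a::real_inner"
  assumes "0 \<le> L" "0 \<le> b" "0 \<le> T"
    and D: "\<And>t. t \<in> {0..T} \<Longrightarrow> (w has_vector_derivative w' t) (at t)"
    and le: "\<And>t. t \<in> {0..T} \<Longrightarrow> norm (w' t) \<le> L * norm (w t) + b"
  shows "(norm (w T))\<^sup>2 \<le> ((norm (w 0))\<^sup>2 + b\<^sup>2) * exp ((2 * L + 1) * T)"
proof -
  define z where "z t = (w t \<bullet> w t + b\<^sup>2) * exp (- ((2 * L + 1) * t))" for t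
  have "z T \<le> z 0"
  proof (rule DERIV_nonpos_imp_nonincreasing[OF \<open>0 \<le> T\<close>])
    fix t assume t: "0 \<le> t" "t \<le> T"
    have "((\<lambda>t. w t \<bullet> w t) has_derivative (\<lambda>h. w t \<bullet> (h *\<^sub>R w' t) + (h *\<^sub>R w' t) \<bullet> w t)) (at t)"
      using D t by (intro has_derivative_inner) (auto simp: has_vector_derivative_def)
    then have 1: "((\<lambda>t. w t \<bullet> w t) has_real_derivative 2 * (w t \<bullet> w' t)) (at t)"
      by (rule has_derivative_imp_has_field_derivative) (simp add: inner_commute algebra_simps)
    have 2: "(z has_real_derivative (2 * (w t \<bullet> w' t) - (2 * L + 1) * (w t \<bullet> w t + b\<^sup>2)) * exp (- ((2 * L + 1) * t))) (at t)"
      unfolding z_def by (rule derivative_eq_intros 1 refl)+ (simp add: algebra_simps)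
    have "2 * (w t \<bullet> w' t) \<le> 2 * (norm (w t) * norm (w' t))"
      using norm_cauchy_schwarz[of "w t" "w' t"] by simp
    also have "\<dots> \<le> 2 * (norm (w t) * (L * norm (w t) + b))"
      using le t by (intro mult_left_mono) auto
    also have "\<dots> = 2 * L * (norm (w t))\<^sup>2 + 2 * (norm (w t) * b)"
      by (simp add: power2_eq_square algebra_simps)
    \<comment> \<open>The surplus term in \<open>L * b\<^sup>2\<close> completes the multiple
      \<open>2 * L + 1\<close> of the shifted squared norm.\<close>
    also have "\<dots> \<le> 2 * L * (norm (w t))\<^sup>2 + ((norm (w t))\<^sup>2 + b\<^sup>2) + 2 * L * b\<^sup>2"
      using sum_squares_bound[of "norm (w t)" b] mult_nonneg_nonneg[OF \<open>0 \<le> L\<close> zero_le_power2[of b]] by (simp add: algebra_simps)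
    finally have "2 * (w t \<bullet> w' t) - (2 * L + 1) * (w t \<bullet> w t + b\<^sup>2) \<le> 0"
      by (simp add: power2_norm_eq_inner algebra_simps)
    then have "(2 * (w t \<bullet> w' t) - (2 * L + 1) * (w t \<bullet> w t + b\<^sup>2)) * exp (- ((2 * L + 1) * t)) \<le> 0"
      by (rule mult_nonpos_nonneg) simp
    then show "\<exists>y. (z has_real_derivative y) (at t) \<and> y \<le> 0"
      using 2 by blast
  qed
  then have "z T * exp ((2 * L + 1) * T) \<le> ((norm (w 0))\<^sup>2 + b\<^sup>2) * exp ((2 * L + 1) * T)"
    by (intro mult_right_mono) (auto simp: z_def power2_norm_eq_inner)
  moreover have "z T * exp ((2 * L + 1) * T) = (norm (w T))\<^sup>2 + b\<^sup>2"
    by (simp add: z_def power2_norm_eq_inner flip: exp_add)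
  ultimately show ?thesis by (smt (verit) zero_le_power2)
qed

text \<open>Reversing time reduces negative times to positive ones.\<close>

lemma gronwall:
  fixes w :: "real \<Rightarrow> 'a::real_inner"
  assumes "0 \<le> L" "0 \<le> b" "\<bar>t\<bar> < T"
    and D: "\<And>t. \<bar>t\<bar> < T \<Longrightarrow> (w has_vector_derivative w' t) (at t)"
    and le: "\<And>t. \<bar>t\<bar> < T \<Longrightarrow> norm (w' t) \<le> L * norm (w t) + b"
  shows "(norm (w t))\<^sup>2 \<le> ((norm (w 0))\<^sup>2 + b\<^sup>2) * exp ((2 * L + 1) * \<bar>t\<bar>)"
proof (cases "0 \<le> t")
  case True
  then show ?thesis
    using gronwall_forward[of L b t w w'] assms by auto
next
  case False
  have "((\<lambda>s. w (- s)) has_vector_derivative - w' (- s)) (at s)" if "\<bar>s\<bar> < T" for s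
    using vector_diff_chain_at[of uminus "-1" s w "w' (- s)"] D[of "- s"] that
    by (simp add: o_def has_vector_derivative_minus has_vector_derivative_id)
  then show ?thesis
    using gronwall_forward[of L b "- t" "\<lambda>s. w (- s)" "\<lambda>s. - w' (- s)"] assms False by auto
qed

text \<open>\<open>smooth_on\<close> gives continuity of the derivative one direction at a time;
  bounds on the finitely many basis vectors add up to an operator bound.\<close>

lemma C1_derivative_bounded:
  fixes g' :: "'a::euclidean_space \<Rightarrow> 'a \<Rightarrow> 'b::real_normed_vector"
  assumes "compact C" "\<And>x. x \<in> C \<Longrightarrow> linear (g' x)" "\<And>v. continuous_on C (\<lambda>x. g' x v)"
  shows "\<exists>L\<ge>0. \<forall>x\<in>C. \<forall>v. norm (g' x v) \<le> L * norm v"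
proof -
  have "\<exists>B. \<forall>x\<in>C. norm (g' x b) \<le> B" for b
    using compact_imp_bounded[OF compact_continuous_image[OF assms(3) assms(1), of b]]
    by (auto simp: bounded_iff)
  then obtain B where B: "\<And>b x. x \<in> C \<Longrightarrow> norm (g' x b) \<le> B b" by metis
  have "norm (g' x v) \<le> (\<Sum>b\<in>Basis. \<bar>B b\<bar>) * norm v" if "x \<in> C" for x v
  proof -
    note lin = assms(2)[OF that]
    have "g' x v = g' x (\<Sum>b\<in>Basis. (v \<bullet> b) *\<^sub>R b)" by (simp add: euclidean_representation)
    also have "\<dots> = (\<Sum>b\<in>Basis. (v \<bullet> b) *\<^sub>R g' x b)"
      by (simp add: linear_sum[OF lin] linear_cmul[OF lin])
    finally have "norm (g' x v) = norm (\<Sum>b\<in>Basis. (v \<bullet> b) *\<^sub>R g' x b)" by (rule arg_cong)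
    also have "\<dots> \<le> (\<Sum>b\<in>Basis. norm v * \<bar>B b\<bar>)"
    proof (rule sum_norm_le)
      fix b :: 'a assume "b \<in> Basis"
      then show "norm ((v \<bullet> b) *\<^sub>R g' x b) \<le> norm v * \<bar>B b\<bar>"
        using Basis_le_norm[of b v] B[OF that, of b] by (auto intro!: mult_mono)
    qed
    also have "\<dots> = (\<Sum>b\<in>Basis. \<bar>B b\<bar>) * norm v" by (simp add: sum_distrib_left mult.commute)
    finally show ?thesis .
  qed
  then show ?thesis by (intro exI[of _ "\<Sum>b\<in>Basis. \<bar>B b\<bar>"]) (auto intro: sum_nonneg)
qed

text \<open>On a convex set the mean value inequality turns the derivative bound into a Lipschitz
  bound with the same constant.\<close>

lemma C1_imp_lipschitz:
  fixes g :: "'a::euclidean_space \<Rightarrow> 'b::real_normed_vector"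
  assumes "compact C" "convex C" "\<And>x. x \<in> C \<Longrightarrow> (g has_derivative g' x) (at x)"
    "\<And>v. continuous_on C (\<lambda>x. g' x v)"
  shows "\<exists>L\<ge>0. (\<forall>x\<in>C. \<forall>v. norm (g' x v) \<le> L * norm v) \<and> (\<forall>x\<in>C. \<forall>y\<in>C. norm (g x - g y) \<le> L * norm (x - y))"
proof -
  have "\<exists>L\<ge>0. \<forall>x\<in>C. \<forall>v. norm (g' x v) \<le> L * norm v"
    by (rule C1_derivative_bounded[OF assms(1) _ assms(4)]) (rule has_derivative_linear[OF assms(3)])
  then obtain L where "L \<ge> 0" and L: "\<And>x v. x \<in> C \<Longrightarrow> norm (g' x v) \<le> L * norm v"
    by blast
  have "norm (g x - g y) \<le> L * norm (x - y)" if "x \<in> C" "y \<in> C" for x y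
    using assms(3) L that by (intro differentiable_bound[OF assms(2)]) (auto intro: has_derivative_at_withinI onorm_le)
  then show ?thesis using \<open>L \<ge> 0\<close> L by blast
qed

section \<open>Local flows and uniqueness of solutions\<close>

text \<open>Precomposing \<open>f\<close> with the nearest point projection onto the closed ball
  makes it globally Lipschitz and bounded, as the Picard theorem requires. For short times a
  trajectory from the half ball stays where the projection is the identity, so it solves the
  original equation.\<close>

lemma lipschitz_flow:
  fixes f :: "'a::euclidean_space \<Rightarrow> 'a"
  assumes "0 < R" "0 \<le> L"
    and L: "\<And>x y. x \<in> cball x0 R \<Longrightarrow> y \<in> cball x0 R \<Longrightarrow> norm (f x - f y) \<le> L * norm (x - y)"
  obtains \<epsilon> \<phi> where "0 < \<epsilon>" "\<epsilon> \<le> 1" "3 * \<epsilon> * L < 1"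
    "\<And>x. \<phi> 0 x = x"
    "\<And>t x. \<bar>t\<bar> < \<epsilon> \<Longrightarrow> x \<in> ball x0 (R / 2) \<Longrightarrow> \<phi> t x \<in> ball x0 R"
    "\<And>t x. \<bar>t\<bar> < \<epsilon> \<Longrightarrow> x \<in> ball x0 (R / 2) \<Longrightarrow>
        ((\<lambda>s. \<phi> s x) has_vector_derivative f (\<phi> t x)) (at t)"
proof -
  define C where "C = cball x0 R"
  have C: "convex C" "closed C" "C \<noteq> {}" "compact C" using assms(1) by (auto simp: C_def)
  define p where "p = closest_point C"
  have p: "p x \<in> C" for x unfolding p_def by (rule closest_point_in_set) (use C in auto)
  have p_id: "p x = x" if "x \<in> C" for x unfolding p_def using that by (rule closest_point_self)
  have p_lip: "norm (p x - p y) \<le> norm (x - y)" for x y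
    using closest_point_lipschitz[OF C(1-3), of x y] by (simp add: p_def dist_norm)
  have fp: "norm (f (p u) - f (p v)) \<le> L * norm (u - v)" for u v
  proof -
    have "norm (f (p u) - f (p v)) \<le> L * norm (p u - p v)"
      using L p by (simp add: C_def)
    also have "\<dots> \<le> L * norm (u - v)" using p_lip \<open>0 \<le> L\<close> by (rule mult_left_mono)
    finally show ?thesis .
  qed
  have "L-lipschitz_on UNIV (\<lambda>x. f (p x))"
    using fp \<open>0 \<le> L\<close> by (intro lipschitz_onI) (auto simp: dist_norm)
  then have fp_cont: "continuous_on UNIV (\<lambda>x. f (p x))"
    by (rule lipschitz_on_continuous_on)
  define M where "M = norm (f x0) + L * R"
  have M: "norm (f (p x)) \<le> M" for x
  proof -
    have "norm (f (p x) - f x0) \<le> L * norm (p x - x0)"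
      using L p[of x] assms(1) by (simp add: C_def)
    also have "\<dots> \<le> L * R"
      using p[of x] \<open>0 \<le> L\<close> by (intro mult_left_mono) (auto simp: C_def dist_norm norm_minus_commute)
    finally show ?thesis using norm_triangle_sub[of "f (p x)" "f x0"] by (simp add: M_def)
  qed
  then have "0 \<le> M" using norm_ge_zero order_trans by blast
  \<comment> \<open>The second bound gives the contraction condition; the third keeps the distance
    travelled, at most \<open>\<epsilon> * M\<close>, below \<open>R / 2\<close>; the bound 1 makes
    the later exponentials independent of time.\<close>
  define \<epsilon> where "\<epsilon> = min 1 (min (1 / (6 * (L + 1))) (R / (2 * (M + 1))))"
  have \<epsilon>: "0 < \<epsilon>" "\<epsilon> \<le> 1" "3 * \<epsilon> * L < 1" "\<epsilon> * M < R / 2"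
  proof -
    show "0 < \<epsilon>" using \<open>0 \<le> L\<close> \<open>0 \<le> M\<close> \<open>0 < R\<close> by (simp add: \<epsilon>_def)
    have "\<epsilon> \<le> 1 / (6 * (L + 1))" by (simp add: \<epsilon>_def)
    then have "\<epsilon> * (6 * (L + 1)) \<le> 1" using \<open>0 \<le> L\<close> by (simp add: field_simps)
    moreover have "0 \<le> \<epsilon> * L" using \<open>0 < \<epsilon>\<close> \<open>0 \<le> L\<close> by simp
    ultimately show "3 * \<epsilon> * L < 1" using \<open>0 < \<epsilon>\<close> by (simp add: algebra_simps)
    have "\<epsilon> \<le> R / (2 * (M + 1))" by (simp add: \<epsilon>_def)
    then have "\<epsilon> * (2 * (M + 1)) \<le> R" using \<open>0 \<le> M\<close> by (simp add: field_simps)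
    then show "\<epsilon> * M < R / 2" using \<open>0 < \<epsilon>\<close> by (simp add: algebra_simps)
  qed (simp add: \<epsilon>_def)
  have "\<forall>x. \<exists>u. u 0 = x \<and> (\<forall>t\<in>{-\<epsilon><..<\<epsilon>}. (u has_vector_derivative f (p (u t))) (at t))"
    by (rule allI, rule picard_local_solution[OF \<epsilon>(1) \<open>0 \<le> L\<close> \<epsilon>(3)])
      (auto intro: fp continuous_on_compose2[OF fp_cont])
  from choice[OF this] obtain u where
    u: "\<forall>x. u x 0 = x \<and> (\<forall>t\<in>{-\<epsilon><..<\<epsilon>}. (u x has_vector_derivative f (p (u x t))) (at t))" ..
  have u0: "u x 0 = x" for x
    using u by blast
  have u': "(u x has_vector_derivative f (p (u x t))) (at t)" if "t \<in> {-\<epsilon><..<\<epsilon>}" for x t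
    using u that by blast
  have in_ball: "u x t \<in> ball x0 R" if "\<bar>t\<bar> < \<epsilon>" "x \<in> ball x0 (R / 2)" for x t
  proof -
    have "norm (u x t - u x 0) \<le> M * norm (t - 0)"
    proof (rule differentiable_bound[where S = "{-\<epsilon><..<\<epsilon>}" and f' = "\<lambda>s h. h *\<^sub>R f (p (u x s))"])
      show "(u x has_derivative (\<lambda>h. h *\<^sub>R f (p (u x s)))) (at s within {-\<epsilon><..<\<epsilon>})"
        if "s \<in> {-\<epsilon><..<\<epsilon>}" for s
        using u'[OF that] by (auto simp: has_vector_derivative_def dest: has_derivative_at_withinI)
      show "onorm (\<lambda>h. h *\<^sub>R f (p (u x s))) \<le> M" for s
      proof (rule onorm_le)
        show "norm (h *\<^sub>R f (p (u x s))) \<le> M * norm h" for h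
          using mult_left_mono[OF M[of "u x s"] abs_ge_zero[of h]] by (simp add: mult.commute)
      qed
    qed (use that in auto)
    also have "M * norm (t - 0) \<le> \<epsilon> * M"
      using that \<open>0 \<le> M\<close> by (simp add: mult.commute mult_left_mono)
    finally have "dist (u x t) x < R / 2" using \<epsilon>(4) by (simp add: u0 dist_norm)
    then show ?thesis
      using that(2) dist_triangle_less_add[of x0 x "R/2" "u x t" "R/2"] by (simp add: dist_commute)
  qed
  show ?thesis
  proof (rule that[of \<epsilon> "\<lambda>t x. u x t"])
    fix t x assume tx: "\<bar>t\<bar> < \<epsilon>" "x \<in> ball x0 (R / 2)"
    have "p (u x t) = u x t"
      using in_ball[OF tx] by (intro p_id) (auto simp: C_def)
    then show "((\<lambda>s. u x s) has_vector_derivative f (u x t)) (at t)"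
      using u'[of t x] tx by (simp add: abs_less_iff)
  qed (use \<epsilon> u0 in_ball in auto)
qed

text \<open>The candidate derivative \<open>Y\<close> is built first, by solving the linearised
  equation along each trajectory. It is the derivative because the remainder
  \<open>\<phi> t y - \<phi> t x - Y t x (y - x)\<close> starts at zero and satisfies a Gronwall
  inequality whose inhomogeneous term is quadratic in \<open>y - x\<close>.\<close>

lemma local_flow:
  fixes f :: "'a::euclidean_space \<Rightarrow> 'a"
  assumes "open S" "x0 \<in> S" "smooth_on f S"
  obtains \<epsilon> r \<phi> Y where "0 < \<epsilon>" "0 < r" "ball x0 r \<subseteq> S"
    "\<And>x. \<phi> 0 x = x"
    "\<And>t x. \<bar>t\<bar> < \<epsilon> \<Longrightarrow> x \<in> ball x0 r \<Longrightarrow> \<phi> t x \<in> S"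
    "\<And>t x. \<bar>t\<bar> < \<epsilon> \<Longrightarrow> x \<in> ball x0 r \<Longrightarrow> ((\<lambda>s. \<phi> s x) has_vector_derivative f (\<phi> t x)) (at t)"
    "\<And>t x. \<bar>t\<bar> < \<epsilon> \<Longrightarrow> x \<in> ball x0 r \<Longrightarrow> (\<phi> t has_derivative Y t x) (at x)"
    "\<And>t x h. \<bar>t\<bar> < \<epsilon> \<Longrightarrow> x \<in> ball x0 r \<Longrightarrow>
       ((\<lambda>s. Y s x h) has_vector_derivative frechet_derivative f (at (\<phi> t x)) (Y t x h)) (at t)"
    "\<And>x h. x \<in> ball x0 r \<Longrightarrow> Y 0 x h = h"
proof -
  obtain R where "0 < R" and R: "cball x0 R \<subseteq> S"
    using assms(1,2) open_contains_cball by blast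
  define C where "C = cball x0 R"
  have C: "compact C" "convex C" "C \<subseteq> S" using R by (auto simp: C_def)
  define f' where "f' x = frechet_derivative f (at x)" for x
  have f': "(f has_derivative f' x) (at x)" if "x \<in> S" for x
    using smooth_on_imp_differentiable[OF assms(3) that] by (simp add: f'_def frechet_derivative_works)
  have f'_smooth: "smooth_on (\<lambda>x. f' x v) S" for v
    unfolding f'_def by (rule smooth_on_derivative[OF assms(3)])
  have f'_cont: "continuous_on S (\<lambda>x. f' x v)" for v
    by (rule smooth_on_imp_continuous_on[OF f'_smooth])
  have f'_lin: "linear (f' x)" if "x \<in> S" for x
    using f'[OF that] by (rule has_derivative_linear)
  obtain L where "L \<ge> 0" and L': "\<And>x v. x \<in> C \<Longrightarrow> norm (f' x v) \<le> L * norm v"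
    and L: "\<And>x y. x \<in> C \<Longrightarrow> y \<in> C \<Longrightarrow> norm (f x - f y) \<le> L * norm (x - y)"
    using C1_imp_lipschitz[OF C(1,2), of f f'] f' C(3) continuous_on_subset[OF f'_cont C(3)] by (meson subsetD)
  \<comment> \<open>A Lipschitz constant for the derivative, again one basis direction at a time;
    the constants are summed in \<open>K\<close>.\<close>
  have "\<exists>K\<ge>0. \<forall>x\<in>C. \<forall>y\<in>C. norm (f' x b - f' y b) \<le> K * norm (x - y)" for b
    using C1_imp_lipschitz[OF C(1,2), of "\<lambda>x. f' x b" "\<lambda>x. frechet_derivative (\<lambda>x. f' x b) (at x)"]
      smooth_on_imp_differentiable[OF f'_smooth[of b]] C(3)
      continuous_on_subset[OF smooth_on_imp_continuous_on[OF smooth_on_derivative[OF f'_smooth[of b]]] C(3)]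
    by (meson frechet_derivative_works subsetD)
  then obtain KB where KB: "\<And>b. KB b \<ge> 0"
    "\<And>x y b. x \<in> C \<Longrightarrow> y \<in> C \<Longrightarrow> norm (f' x b - f' y b) \<le> KB b * norm (x - y)" by metis
  define K where "K = (\<Sum>b\<in>Basis. KB b)"
  have "0 \<le> K" unfolding K_def by (intro sum_nonneg KB(1))
  have expand: "f' x v = (\<Sum>b\<in>Basis. (v \<bullet> b) *\<^sub>R f' x b)" if "x \<in> S" for x v
  proof -
    note lin = f'_lin[OF that]
    have "f' x v = f' x (\<Sum>b\<in>Basis. (v \<bullet> b) *\<^sub>R b)" by (simp add: euclidean_representation)
    also have "\<dots> = (\<Sum>b\<in>Basis. (v \<bullet> b) *\<^sub>R f' x b)"
      by (simp add: linear_sum[OF lin] linear_cmul[OF lin])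
    finally show ?thesis .
  qed
  have K: "norm (f' x v - f' y v) \<le> K * norm (x - y) * norm v" if "x \<in> C" "y \<in> C" for x y v
  proof -
    have "f' x v - f' y v = (\<Sum>b\<in>Basis. (v \<bullet> b) *\<^sub>R (f' x b - f' y b))"
      using expand[OF subsetD[OF C(3) that(1)], of v] expand[OF subsetD[OF C(3) that(2)], of v]
      by (simp add: sum_subtractf scaleR_diff_right)
    also have "norm \<dots> \<le> (\<Sum>b\<in>Basis. norm v * (KB b * norm (x - y)))"
    proof (rule sum_norm_le)
      fix b :: 'a assume "b \<in> Basis"
      then show "norm ((v \<bullet> b) *\<^sub>R (f' x b - f' y b)) \<le> norm v * (KB b * norm (x - y))"
        using Basis_le_norm[of b v] KB(2)[OF that, of b] by (auto intro!: mult_mono)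
    qed
    also have "\<dots> = K * norm (x - y) * norm v"
      by (simp add: K_def sum_distrib_left sum_distrib_right mult_ac)
    finally show ?thesis .
  qed
  \<comment> \<open>Along the segment the derivative varies by at most
    \<open>K * norm (y - x)\<close>, whence a quadratic remainder.\<close>
  have taylor: "norm (f y - f x - f' x (y - x)) \<le> K * (norm (y - x))\<^sup>2" if "x \<in> C" "y \<in> C" for x y
  proof -
    have "norm (f y - f x - f' x (y - x)) \<le> norm (y - x) * (K * norm (y - x))"
    proof (rule differentiable_bound_linearization[where f' = f' and S = "closed_segment x y"])
      have seg: "closed_segment x y \<subseteq> C" using that C(2) by (simp add: closed_segment_subset)
      show "x + t *\<^sub>R (y - x) \<in> closed_segment x y" if "t \<in> {0..1}" for t
        using that by (auto simp: in_segment algebra_simps intro!: exI[of _ t])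
      show "(f has_derivative f' z) (at z within closed_segment x y)" if "z \<in> closed_segment x y" for z
        using has_derivative_at_withinI[OF f'] seg C(3) that by blast
      show "onorm (f' z - f' x) \<le> K * norm (y - x)" if z: "z \<in> closed_segment x y" for z
      proof (rule onorm_le, unfold fun_diff_def)
        fix v
        have "norm (f' z v - f' x v) \<le> K * norm (z - x) * norm v"
          using K[of z x v] z seg \<open>x \<in> C\<close> by auto
        also have "\<dots> \<le> K * norm (y - x) * norm v"
          using segment_bound(1)[OF z] \<open>0 \<le> K\<close> by (intro mult_right_mono mult_left_mono) (auto simp: norm_minus_commute)
        finally show "norm (f' z v - f' x v) \<le> K * norm (y - x) * norm v" .
      qed
    qed auto
    then show ?thesis by (simp add: power2_eq_square mult_ac)
  qed
  obtain \<epsilon>0 \<phi> where \<epsilon>0: "0 < \<epsilon>0" "\<epsilon>0 \<le> 1" "3 * \<epsilon>0 * L < 1"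
    and \<phi>0: "\<And>x. \<phi> 0 x = x"
    and \<phi>_ball: "\<And>t x. \<bar>t\<bar> < \<epsilon>0 \<Longrightarrow> x \<in> ball x0 (R / 2) \<Longrightarrow> \<phi> t x \<in> ball x0 R"
    and \<phi>': "\<And>t x. \<bar>t\<bar> < \<epsilon>0 \<Longrightarrow> x \<in> ball x0 (R / 2) \<Longrightarrow>
        ((\<lambda>s. \<phi> s x) has_vector_derivative f (\<phi> t x)) (at t)"
    using lipschitz_flow[OF \<open>0 < R\<close> \<open>0 \<le> L\<close>, of x0 f] L unfolding C_def by blast
  have \<phi>_C: "\<phi> t x \<in> C" if "\<bar>t\<bar> < \<epsilon>0" "x \<in> ball x0 (R / 2)" for t x
    using \<phi>_ball[OF that] by (simp add: C_def)
  \<comment> \<open>Halving gives the closed interval on which the Picard theorem needs the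
    trajectory to be defined and continuous.\<close>
  define \<epsilon> where "\<epsilon> = \<epsilon>0 / 2"
  define r where "r = R / 2"
  have \<epsilon>: "0 < \<epsilon>" "\<epsilon> < \<epsilon>0" "\<epsilon> \<le> 1" using \<epsilon>0 by (auto simp: \<epsilon>_def)
  have \<epsilon>L: "3 * \<epsilon> * L < 1"
    using \<epsilon>0(3) mult_nonneg_nonneg[of \<epsilon>0 L] \<epsilon>0(1) \<open>0 \<le> L\<close> by (simp add: \<epsilon>_def)
  have "\<exists>u. u 0 = b \<and> (\<forall>t\<in>{-\<epsilon><..<\<epsilon>}. (u has_vector_derivative f' (\<phi> t x) (u t)) (at t))"
    if x: "x \<in> ball x0 r" for x b
  proof (rule picard_local_solution[OF \<epsilon>(1) \<open>0 \<le> L\<close> \<epsilon>L])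
    have mem: "\<phi> s x \<in> C" if "s \<in> {-\<epsilon>..\<epsilon>}" for s
      using \<phi>_C[of s x] that x \<epsilon> by (auto simp: r_def)
    have "continuous_on {-\<epsilon>..\<epsilon>} (\<lambda>s. \<phi> s x)"
      using has_vector_derivative_continuous[OF \<phi>'[of _ x]] x \<epsilon>
      by (intro continuous_at_imp_continuous_on ballI) (auto simp: r_def)
    then have c: "continuous_on {-\<epsilon>..\<epsilon>} (\<lambda>s. f' (\<phi> s x) b)" for b
      using mem C(3) by (intro continuous_on_compose2[OF f'_cont[of b]]) auto
    show "continuous_on {-\<epsilon>..\<epsilon>} (\<lambda>s. f' (\<phi> s x) (u s))" if u: "continuous_on {-\<epsilon>..\<epsilon>} u" for u
    proof -
      have "continuous_on {-\<epsilon>..\<epsilon>} (\<lambda>s. \<Sum>b\<in>Basis. (u s \<bullet> b) *\<^sub>R f' (\<phi> s x) b)"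
        by (intro continuous_intros u c)
      then show ?thesis
        by (rule continuous_on_eq) (rule expand[symmetric], use mem C(3) in blast)
    qed
    show "norm (f' (\<phi> s x) u - f' (\<phi> s x) v) \<le> L * norm (u - v)" if "s \<in> {-\<epsilon>..\<epsilon>}" for s u v
      using L'[OF mem[OF that], of "u - v"] linear_diff[OF f'_lin, of "\<phi> s x" u v] mem[OF that] C(3) by auto
  qed
  then have "\<forall>z\<in>ball x0 r \<times> UNIV. \<exists>u. u 0 = snd z \<and>
      (\<forall>t\<in>{-\<epsilon><..<\<epsilon>}. (u has_vector_derivative f' (\<phi> t (fst z)) (u t)) (at t))"
    by simp
  from bchoice[OF this] obtain W where W: "\<forall>z\<in>ball x0 r \<times> UNIV. W z 0 = snd z \<and>
      (\<forall>t\<in>{-\<epsilon><..<\<epsilon>}. (W z has_vector_derivative f' (\<phi> t (fst z)) (W z t)) (at t))" ..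
  define V where "V x b = W (x, b)" for x b
  have V0: "\<And>x b. x \<in> ball x0 r \<Longrightarrow> V x b 0 = b"
    and V': "\<And>x b t. x \<in> ball x0 r \<Longrightarrow> t \<in> {-\<epsilon><..<\<epsilon>} \<Longrightarrow>
       (V x b has_vector_derivative f' (\<phi> t x) (V x b t)) (at t)"
    using W by (simp_all add: V_def)
  \<comment> \<open>Only the solutions starting at basis vectors enter, so linearity in
    \<open>h\<close> holds by construction.\<close>
  define Y where "Y t x h = (\<Sum>b\<in>Basis. (h \<bullet> b) *\<^sub>R V x b t)" for t x h
  have Y0: "Y 0 x h = h" if "x \<in> ball x0 r" for x h
    using that by (simp add: Y_def V0 euclidean_representation)
  have Y': "((\<lambda>s. Y s x h) has_vector_derivative f' (\<phi> t x) (Y t x h)) (at t)"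
    if "\<bar>t\<bar> < \<epsilon>" "x \<in> ball x0 r" for t x h
  proof -
    have "\<phi> t x \<in> S" using \<phi>_C[of t x] that \<epsilon> C(3) by (auto simp: r_def)
    note lin = f'_lin[OF this]
    have "((\<lambda>s. Y s x h) has_vector_derivative (\<Sum>b\<in>Basis. (h \<bullet> b) *\<^sub>R f' (\<phi> t x) (V x b t))) (at t)"
      unfolding Y_def using V'[of x t] that
      by (intro has_vector_derivative_sum bounded_linear.has_vector_derivative[OF bounded_linear_scaleR_right])
        (auto simp: abs_less_iff)
    then show ?thesis by (simp add: Y_def linear_sum[OF lin] linear_cmul[OF lin])
  qed
  have Y_bl: "bounded_linear (Y t x)" for t x
    unfolding Y_def
    by (intro bounded_linear_sum bounded_linear_scaleR_const bounded_linear_inner_left)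
  \<comment> \<open>Since \<open>\<epsilon> \<le> 1\<close>, this bounds every exponential that the
    two Gronwall estimates produce.\<close>
  define N where "N = exp (2 * L + 1)"
  have N: "1 \<le> N" "exp ((2 * L + 1) * \<bar>t\<bar>) \<le> N" if "\<bar>t\<bar> < \<epsilon>" for t
    using \<open>0 \<le> L\<close> \<epsilon>(3) that mult_left_mono[of "\<bar>t\<bar>" 1 "2 * L + 1"] by (auto simp: N_def)
  \<comment> \<open>Lipschitz dependence on the initial point: Gronwall without inhomogeneous
    term.\<close>
  have dep: "(norm (\<phi> t y - \<phi> t x))\<^sup>2 \<le> N * (norm (y - x))\<^sup>2"
    if t: "\<bar>t\<bar> < \<epsilon>" and xy: "x \<in> ball x0 r" "y \<in> ball x0 r" for t x y
  proof -
    have "(norm (\<phi> t y - \<phi> t x))\<^sup>2 \<le> ((norm (\<phi> 0 y - \<phi> 0 x))\<^sup>2 + 0\<^sup>2) * exp ((2 * L + 1) * \<bar>t\<bar>)"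
    proof (rule gronwall[OF \<open>0 \<le> L\<close> order_refl t])
      fix s assume "\<bar>s\<bar> < \<epsilon>"
      then have s: "\<bar>s\<bar> < \<epsilon>0" using \<epsilon> by simp
      show "((\<lambda>s. \<phi> s y - \<phi> s x) has_vector_derivative f (\<phi> s y) - f (\<phi> s x)) (at s)"
        using xy s by (intro has_vector_derivative_diff \<phi>') (auto simp: r_def)
      show "norm (f (\<phi> s y) - f (\<phi> s x)) \<le> L * norm (\<phi> s y - \<phi> s x) + 0"
        using L \<phi>_C[OF s] xy by (simp add: r_def)
    qed
    also have "\<dots> \<le> (norm (y - x))\<^sup>2 * N"
      using N(2)[OF t] by (simp add: \<phi>0 mult_left_mono)
    finally show ?thesis by (simp add: mult.commute)
  qed
  have rem: "norm (\<phi> t y - \<phi> t x - Y t x (y - x)) \<le> K * N\<^sup>2 * (norm (y - x))\<^sup>2"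
    if t: "\<bar>t\<bar> < \<epsilon>" and xy: "x \<in> ball x0 r" "y \<in> ball x0 r" for t x y
  proof -
    \<comment> \<open>The Taylor error of \<open>f\<close> between the two trajectories, with their
      distance bounded by \<open>dep\<close>.\<close>
    define b where "b = K * (N * (norm (y - x))\<^sup>2)"
    have "0 \<le> b" using \<open>0 \<le> K\<close> N(1)[OF t] by (simp add: b_def)
    let ?w = "\<lambda>s. \<phi> s y - \<phi> s x - Y s x (y - x)"
    have "(norm (?w t))\<^sup>2 \<le> ((norm (?w 0))\<^sup>2 + b\<^sup>2) * exp ((2 * L + 1) * \<bar>t\<bar>)"
    proof (rule gronwall[OF \<open>0 \<le> L\<close> \<open>0 \<le> b\<close> t])
      fix s assume s': "\<bar>s\<bar> < \<epsilon>"
      then have s: "\<bar>s\<bar> < \<epsilon>0" using \<epsilon> by simp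
      show "(?w has_vector_derivative f (\<phi> s y) - f (\<phi> s x) - f' (\<phi> s x) (Y s x (y - x))) (at s)"
        using xy s s' by (intro has_vector_derivative_diff \<phi>' Y') (auto simp: r_def)
      have mem: "\<phi> s x \<in> C" "\<phi> s y \<in> C" using \<phi>_C[OF s] xy by (auto simp: r_def)
      note lin = f'_lin[OF subsetD[OF C(3) mem(1)]]
      have "f (\<phi> s y) - f (\<phi> s x) - f' (\<phi> s x) (Y s x (y - x))
          = f' (\<phi> s x) (?w s) + (f (\<phi> s y) - f (\<phi> s x) - f' (\<phi> s x) (\<phi> s y - \<phi> s x))"
        by (simp add: linear_diff[OF lin])
      moreover have "norm (f' (\<phi> s x) (?w s)) \<le> L * norm (?w s)" using L'[OF mem(1)] .
      moreover have "norm (f (\<phi> s y) - f (\<phi> s x) - f' (\<phi> s x) (\<phi> s y - \<phi> s x)) \<le> b"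
      proof -
        have "K * (norm (\<phi> s y - \<phi> s x))\<^sup>2 \<le> b"
          unfolding b_def using dep[OF s' xy] \<open>0 \<le> K\<close> by (intro mult_left_mono)
        then show ?thesis using taylor[OF mem] by linarith
      qed
      ultimately show "norm (f (\<phi> s y) - f (\<phi> s x) - f' (\<phi> s x) (Y s x (y - x))) \<le> L * norm (?w s) + b"
        by (smt (verit) norm_triangle_ineq)
    qed
    also have "\<dots> = b\<^sup>2 * exp ((2 * L + 1) * \<bar>t\<bar>)" using Y0[OF xy(1)] by (simp add: \<phi>0)
    \<comment> \<open>Replacing \<open>N\<close> by its larger square makes the right side a perfect
      square, so that the root can be taken.\<close>
    also have "\<dots> \<le> b\<^sup>2 * N\<^sup>2"
      using N[OF t] self_le_power[of N 2] by (intro mult_left_mono) auto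
    finally have "(norm (?w t))\<^sup>2 \<le> (b * N)\<^sup>2" by (simp add: power_mult_distrib)
    then have "norm (?w t) \<le> b * N"
      by (rule power2_le_imp_le) (use \<open>0 \<le> b\<close> N(1)[OF t] in auto)
    then show ?thesis by (simp add: b_def power2_eq_square mult_ac)
  qed
  have deriv: "(\<phi> t has_derivative Y t x) (at x)" if t: "\<bar>t\<bar> < \<epsilon>" and x: "x \<in> ball x0 r" for t x
  proof -
    obtain d where "0 < d" and d: "ball x d \<subseteq> ball x0 r"
      using x open_ball open_contains_ball by blast
    show ?thesis
    proof (rule has_derivativeI_sandwich[OF \<open>0 < d\<close> Y_bl])
      fix y assume "y \<noteq> x" "dist y x < d"
      then have "y \<in> ball x0 r" using d by (auto simp: dist_commute)
      then show "norm (\<phi> t y - \<phi> t x - Y t x (y - x)) / norm (y - x) \<le> K * N\<^sup>2 * norm (y - x)"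
        using rem[OF t x, of y] \<open>y \<noteq> x\<close> by (simp add: divide_simps power2_eq_square mult_ac)
    next
      show "((\<lambda>y. K * N\<^sup>2 * norm (y - x)) \<longlongrightarrow> 0) (at x within UNIV)"
        by (rule tendsto_eq_intros refl | simp)+
    qed
  qed
  show ?thesis
  proof (rule that[of \<epsilon> r \<phi> Y])
    show "0 < r" using \<open>0 < R\<close> by (simp add: r_def)
    show "ball x0 r \<subseteq> S" using R \<open>0 < R\<close> by (auto simp: r_def)
    show "\<phi> t x \<in> S" if "\<bar>t\<bar> < \<epsilon>" "x \<in> ball x0 r" for t x
      using \<phi>_C[of t x] that \<epsilon> C(3) by (auto simp: r_def)
    show "((\<lambda>s. \<phi> s x) has_vector_derivative f (\<phi> t x)) (at t)" if "\<bar>t\<bar> < \<epsilon>" "x \<in> ball x0 r" for t x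
      using \<phi>'[of t x] that \<epsilon> by (auto simp: r_def)
    show "((\<lambda>s. Y s x h) has_vector_derivative frechet_derivative f (at (\<phi> t x)) (Y t x h)) (at t)"
      if "\<bar>t\<bar> < \<epsilon>" "x \<in> ball x0 r" for t x h
      using Y'[OF that] by (simp add: f'_def)
  qed (use \<epsilon> \<phi>0 deriv Y0 in auto)
qed

text \<open>By continuity both solutions stay for a while in a compact ball inside \<open>S\<close>,
  where \<open>f\<close> is Lipschitz; Gronwall with zero initial difference does the rest.
  \<open>curve_unique\<close> makes this global.\<close>

lemma ode_unique_local:
  fixes f :: "'a::euclidean_space \<Rightarrow> 'a"
  assumes "open S" "smooth_on f S" "u t0 = v t0" "u t0 \<in> S" "0 < d"
    and u: "\<And>t. \<bar>t - t0\<bar> < d \<Longrightarrow> (u has_vector_derivative f (u t)) (at t)"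
    and v: "\<And>t. \<bar>t - t0\<bar> < d \<Longrightarrow> (v has_vector_derivative f (v t)) (at t)"
  shows "\<forall>\<^sub>F t in nhds t0. u t = v t"
proof -
  obtain R where "0 < R" and R: "cball (u t0) R \<subseteq> S"
    using assms(1,4) open_contains_cball by blast
  define C where "C = cball (u t0) R"
  have C: "compact C" "convex C" "C \<subseteq> S" using R by (auto simp: C_def)
  have D: "(f has_derivative frechet_derivative f (at x)) (at x)" if "x \<in> C" for x
    using smooth_on_imp_differentiable[OF assms(2)] C(3) that by (auto simp: frechet_derivative_works)
  obtain L where "L \<ge> 0" and L: "\<And>x y. x \<in> C \<Longrightarrow> y \<in> C \<Longrightarrow> norm (f x - f y) \<le> L * norm (x - y)"
    using C1_imp_lipschitz[OF C(1,2) D continuous_on_subset[OF smooth_on_imp_continuous_on[OF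
      smooth_on_derivative[OF assms(2)]] C(3)]] by blast
  have "isCont u t0" "isCont v t0"
    using has_vector_derivative_continuous[OF u[of t0]] has_vector_derivative_continuous[OF v[of t0]] \<open>0 < d\<close> by auto
  then have "\<forall>\<^sub>F t in nhds t0. u t \<in> ball (u t0) R" "\<forall>\<^sub>F t in nhds t0. v t \<in> ball (u t0) R"
    using \<open>0 < R\<close> tendsto_at_iff_tendsto_nhds[of u t0] tendsto_at_iff_tendsto_nhds[of v t0]
      topological_tendstoD[of u "u t0" "nhds t0" "ball (u t0) R"]
      topological_tendstoD[of v "v t0" "nhds t0" "ball (u t0) R"]
    by (auto simp: isCont_def assms(3))
  moreover have "\<forall>\<^sub>F t in nhds t0. \<bar>t - t0\<bar> < d"
    using eventually_nhds_in_open[OF open_ball, of t0 t0 d] \<open>0 < d\<close>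
    by (simp add: dist_real_def abs_minus_commute)
  ultimately have "\<forall>\<^sub>F t in nhds t0. u t \<in> C \<and> v t \<in> C \<and> \<bar>t - t0\<bar> < d"
    by eventually_elim (auto simp: C_def)
  then obtain \<delta> where "0 < \<delta>" and \<delta>: "\<And>t. \<bar>t - t0\<bar> < \<delta> \<Longrightarrow> u t \<in> C \<and> v t \<in> C \<and> \<bar>t - t0\<bar> < d"
    by (auto simp: eventually_nhds_metric dist_real_def)
  have shift: "((\<lambda>s. g (t0 + s)) has_vector_derivative g') (at s)"
    if "(g has_vector_derivative g') (at (t0 + s))" for g :: "real \<Rightarrow> 'a" and g' s
    using vector_diff_chain_at[of "\<lambda>s. t0 + s" 1 s g g'] that
      has_vector_derivative_add[OF has_vector_derivative_const[of t0] has_vector_derivative_id]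
    by (simp add: o_def)
  have "u t = v t" if t: "\<bar>t - t0\<bar> < \<delta>" for t
  proof -
    let ?w = "\<lambda>s. u (t0 + s) - v (t0 + s)"
    have "(norm (?w (t - t0)))\<^sup>2 \<le> ((norm (?w 0))\<^sup>2 + 0\<^sup>2) * exp ((2 * L + 1) * \<bar>t - t0\<bar>)"
    proof (rule gronwall[OF \<open>0 \<le> L\<close> order_refl t])
      fix s assume s: "\<bar>s\<bar> < \<delta>"
      show "(?w has_vector_derivative f (u (t0 + s)) - f (v (t0 + s))) (at s)"
        using \<delta>[of "t0 + s"] s by (intro has_vector_derivative_diff shift u v) auto
      show "norm (f (u (t0 + s)) - f (v (t0 + s))) \<le> L * norm (?w s) + 0"
        using \<delta>[of "t0 + s"] s L by simp
    qed
    then show ?thesis using assms(3) by simp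
  qed
  then show ?thesis
    unfolding eventually_nhds_metric dist_real_def using \<open>0 < \<delta>\<close> by blast
qed

section \<open>The local geometry of a symplectic connection\<close>

lemma nabla2_zero:
  assumes "open S" "x \<in> S" "\<And>y i j. y \<in> S \<Longrightarrow> T y i j = 0"
  shows "nabla2 \<Gamma> T x k i j = 0"
  using assms pd_zero[OF assms(1,2), of "\<lambda>y. T y i j"] by (simp add: nabla2_def)

text \<open>A single chart with range \<open>S\<close>. All statements inside are identities between
  component functions on an open set of the plane.\<close>

locale symplectic_patch =
  fixes S :: "(real^2) set" and \<Omega> :: field2 and \<Gamma> :: field3
  assumes open_S: "open S"
    and smooth_Omega: "smooth_on (\<lambda>x. \<Omega> x i j) S"
    and smooth_Gamma: "smooth_on (\<lambda>x. \<Gamma> x i j k) S"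
    and skew: "x \<in> S \<Longrightarrow> \<Omega> x i j = - \<Omega> x j i"
    and nondegenerate: "x \<in> S \<Longrightarrow> invertible (\<chi> i j. \<Omega> x i j)"
    and Gamma_sym: "x \<in> S \<Longrightarrow> \<Gamma> x i j k = \<Gamma> x j i k"
    and parallel: "x \<in> S \<Longrightarrow> nabla2 \<Gamma> \<Omega> x i j k = 0"
begin

abbreviation "\<omega> x \<equiv> \<Omega> x 1 2"
abbreviation "T \<equiv> nabla2 \<Gamma> (ricci \<Gamma>)"
abbreviation "\<rho> \<equiv> rho \<Omega> \<Gamma>"
abbreviation "X \<equiv> rho_up \<Omega> \<Gamma>"

lemma Omega_components:
  assumes "x \<in> S"
  shows "\<Omega> x 1 1 = 0" "\<Omega> x 2 2 = 0" "\<Omega> x 2 1 = - \<omega> x"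
  using skew[OF assms, of 1 1] skew[OF assms, of 2 2] skew[OF assms, of 2 1] by auto

lemma omega_nonzero:
  assumes "x \<in> S" shows "\<omega> x \<noteq> 0"
  using nondegenerate[OF assms] Omega_components[OF assms]
  by (auto simp: invertible_det_nz det_2)

lemma Omega_up_components:
  assumes "x \<in> S"
  shows "Omega_up \<Omega> x 1 1 = 0" "Omega_up \<Omega> x 2 2 = 0"
    "Omega_up \<Omega> x 1 2 = 1 / \<omega> x" "Omega_up \<Omega> x 2 1 = - (1 / \<omega> x)"
  using Omega_up_Omega[of \<Omega> x, OF nondegenerate[OF assms], of 1 1]
    Omega_up_Omega[of \<Omega> x, OF nondegenerate[OF assms], of 1 2]
    Omega_up_Omega[of \<Omega> x, OF nondegenerate[OF assms], of 2 1]
    Omega_up_Omega[of \<Omega> x, OF nondegenerate[OF assms], of 2 2]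
    omega_nonzero[OF assms]
  by (simp_all add: sum_2 Omega_components[OF assms] field_simps)

lemma smooth_omega: "smooth_on \<omega> S"
  by (rule smooth_Omega)

lemma differentiable_omega: "x \<in> S \<Longrightarrow> \<omega> differentiable (at x)"
  by (rule smooth_on_imp_differentiable[OF smooth_omega])

text \<open>In dimension two a parallel \<Omega> amounts to this one equation. It yields both the
  symmetry of the Ricci tensor and the fact that raising an index commutes with
  differentiation.\<close>

lemma pd_omega:
  assumes "x \<in> S"
  shows "pd i \<omega> x = (\<Gamma> x i 1 1 + \<Gamma> x i 2 2) * \<omega> x"
  using parallel[OF assms, of i 1 2] Omega_components[OF assms]
  by (simp add: nabla2_def sum_2 algebra_simps)

section \<open>Curvature, the one-form rho and the moment map in a chart\<close>

lemma curv_eq':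
  assumes "x \<in> S"
  shows "curv \<Gamma> x i j p k = pd i (\<lambda>y. \<Gamma> y j p k) x - pd j (\<lambda>y. \<Gamma> y i p k) x
    + (\<Sum>q\<in>UNIV. \<Gamma> x i q k * \<Gamma> x j p q) - (\<Sum>q\<in>UNIV. \<Gamma> x j q k * \<Gamma> x i p q)"
  by (rule curv_eq) (rule Gamma_sym[OF assms])

lemma smooth_curv: "smooth_on (\<lambda>x. curv \<Gamma> x i j p k) S"
proof (rule smooth_on_cong[OF open_S])
  show "smooth_on (\<lambda>x. pd i (\<lambda>y. \<Gamma> y j p k) x - pd j (\<lambda>y. \<Gamma> y i p k) x
    + (\<Sum>q\<in>UNIV. \<Gamma> x i q k * \<Gamma> x j p q) - (\<Sum>q\<in>UNIV. \<Gamma> x j q k * \<Gamma> x i p q)) S"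
    by (intro smooth_on_diff smooth_on_add smooth_on_sum smooth_on_mult smooth_on_pd smooth_Gamma open_S finite)
qed (simp add: curv_eq')

lemma smooth_ricci: "smooth_on (\<lambda>x. ricci \<Gamma> x i j) S"
  unfolding ricci_def by (intro smooth_on_sum smooth_curv open_S finite)

lemma smooth_T: "smooth_on (\<lambda>x. T x i j k) S"
  unfolding nabla2_def
  by (intro smooth_on_diff smooth_on_sum smooth_on_mult smooth_on_pd smooth_Gamma smooth_ricci open_S finite)

lemmas differentiable_Gamma = smooth_on_imp_differentiable[OF smooth_Gamma]
lemmas differentiable_ricci = smooth_on_imp_differentiable[OF smooth_ricci]
lemmas differentiable_T = smooth_on_imp_differentiable[OF smooth_T]

lemma rho_eq:
  assumes "x \<in> S"
  shows "\<rho> x i = 2 * ((T x 2 i 1 - T x 1 i 2) / \<omega> x)"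
  using omega_nonzero[OF assms]
  by (simp add: rho_def sum_2 Omega_up_components[OF assms] field_simps)

lemma rho_up_eq:
  assumes "x \<in> S"
  shows "X x 1 = \<rho> x 2 / \<omega> x" "X x 2 = - (\<rho> x 1 / \<omega> x)"
  by (simp_all add: rho_up_def sum_2 Omega_up_components[OF assms])

lemma smooth_rho: "smooth_on (\<lambda>x. \<rho> x i) S"
proof (rule smooth_on_cong[OF open_S])
  show "smooth_on (\<lambda>x. 2 * ((T x 2 i 1 - T x 1 i 2) / \<omega> x)) S"
    by (intro smooth_on_mult smooth_on_divide smooth_on_diff smooth_on_const smooth_T smooth_omega
        omega_nonzero open_S)
qed (simp add: rho_eq)

lemma smooth_rho_up: "smooth_on (\<lambda>x. X x i) S"
proof -
  have q: "smooth_on (\<lambda>x. \<rho> x i / \<omega> x) S" for i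
    by (intro smooth_on_divide smooth_rho smooth_omega omega_nonzero open_S)
  have "smooth_on (\<lambda>x. X x 1) S"
    by (rule smooth_on_cong[OF open_S _ q[of 2]]) (simp add: rho_up_eq)
  moreover have "smooth_on (\<lambda>x. X x 2) S"
    by (rule smooth_on_cong[OF open_S _ smooth_on_uminus[OF open_S q[of 1]]]) (simp add: rho_up_eq)
  ultimately show ?thesis
    using exhaust_2[of i] by metis
qed

text \<open>Differentiating the denominator contributes the trace of the connection, by
  \<open>pd_omega\<close>; these terms match the Christoffel terms of the second covariant
  derivative in \<open>moment_eq\<close>.\<close>

lemma pd_rho:
  assumes "x \<in> S"
  shows "pd p (\<lambda>y. \<rho> y i) x = 2 * ((pd p (\<lambda>y. T y 2 i 1) x - pd p (\<lambda>y. T y 1 i 2) x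
      - (\<Gamma> x p 1 1 + \<Gamma> x p 2 2) * (T x 2 i 1 - T x 1 i 2)) / \<omega> x)"
proof -
  let ?D = "\<lambda>y. T y 2 i 1 - T y 1 i 2"
  have D: "?D differentiable (at x)"
    by (intro differentiable_diff differentiable_T assms)
  have q: "(\<lambda>y. ?D y / \<omega> y) differentiable (at x)"
    by (intro differentiable_divide D differentiable_omega assms omega_nonzero)
  have "pd p (\<lambda>y. \<rho> y i) x = pd p (\<lambda>y. 2 * (?D y / \<omega> y)) x"
    by (rule pd_cong[OF open_S assms _ differentiable_mult[OF differentiable_const q]]) (simp add: rho_eq)
  also have "\<dots> = 2 * pd p (\<lambda>y. ?D y / \<omega> y) x"
    by (subst pd_mult) (auto intro!: q)
  also have "pd p (\<lambda>y. ?D y / \<omega> y) x = (pd p ?D x * \<omega> x - ?D x * pd p \<omega> x) / (\<omega> x * \<omega> x)"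
    by (rule pd_divide[OF D differentiable_omega[OF assms] omega_nonzero[OF assms]])
  also have "pd p ?D x = pd p (\<lambda>y. T y 2 i 1) x - pd p (\<lambda>y. T y 1 i 2) x"
    by (rule pd_diff[OF differentiable_T[OF assms] differentiable_T[OF assms]])
  finally have e: "pd p (\<lambda>y. \<rho> y i) x
      = 2 * (((pd p (\<lambda>y. T y 2 i 1) x - pd p (\<lambda>y. T y 1 i 2) x) * \<omega> x - ?D x * pd p \<omega> x) / (\<omega> x * \<omega> x))" .
  show ?thesis
    unfolding e pd_omega[OF assms] using omega_nonzero[OF assms] by (simp add: field_simps)
qed

text \<open>\<open>curv\<close> is antisymmetric in its first two indices by construction, so only
  the pair 1, 2 survives, and each Ricci contraction has a single nonzero summand.\<close>

lemma curv_components: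
  "curv \<Gamma> x 1 1 j k = 0" "curv \<Gamma> x 2 2 j k = 0" "curv \<Gamma> x 2 1 j k = - curv \<Gamma> x 1 2 j k"
  "curv \<Gamma> x 1 2 j 1 = ricci \<Gamma> x 2 j" "curv \<Gamma> x 1 2 j 2 = - ricci \<Gamma> x 1 j"
  by (simp_all add: ricci_def sum_2 curv_def)

text \<open>The formula for the lowered curvature splits the contraction into that of \<Omega> with
  itself, which is 2, and that of the Ricci tensor; a quarter of 2 is the coefficient one
  half.\<close>

lemma quadratic_terms_cancel:
  assumes "x \<in> S"
  shows "1/4 * (\<Sum>i\<in>UNIV. \<Sum>j\<in>UNIV. \<Sum>k\<in>UNIV. \<Sum>l\<in>UNIV. curv_up \<Omega> \<Gamma> x i j k l * curv_low \<Omega> \<Gamma> x i j k l)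
       = 1/2 * (\<Sum>i\<in>UNIV. \<Sum>j\<in>UNIV. ricci_up \<Omega> \<Gamma> x i j * ricci \<Gamma> x i j)"
proof -
  have low: "curv_low \<Omega> \<Gamma> x 1 1 k l = 0" "curv_low \<Omega> \<Gamma> x 2 2 k l = 0"
    "curv_low \<Omega> \<Gamma> x 1 2 k 1 = \<omega> x * ricci \<Gamma> x 1 k" "curv_low \<Omega> \<Gamma> x 1 2 k 2 = \<omega> x * ricci \<Gamma> x 2 k"
    "curv_low \<Omega> \<Gamma> x 2 1 k l = - curv_low \<Omega> \<Gamma> x 1 2 k l" for k l
    by (simp_all add: curv_low_def sum_2 curv_components Omega_components[OF assms])
  show ?thesis
    using omega_nonzero[OF assms]
    by (simp add: curv_up_def ricci_up_def sum_2 Omega_up_components[OF assms] low field_simps)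
qed

text \<open>The inner contraction in the second-order term is half of rho, and torsion-freeness
  removes the connection from its antisymmetrised derivative. In forms: d rho = -2 K
  \<Omega>.\<close>

lemma moment_eq:
  assumes "x \<in> S"
  shows "moment \<Omega> \<Gamma> x = (pd 2 (\<lambda>y. \<rho> y 1) x - pd 1 (\<lambda>y. \<rho> y 2) x) / (2 * \<omega> x)"
proof -
  have sym: "\<Gamma> x 2 1 k = \<Gamma> x 1 2 k" for k by (rule Gamma_sym[OF assms])
  show ?thesis
    unfolding moment_def quadratic_terms_cancel[OF assms] pd_rho[OF assms]
    using omega_nonzero[OF assms]
    by (simp add: nabla3_def sum_2 Omega_up_components[OF assms] sym field_simps)
qed

text \<open>Contracting the dual field with \<Omega> gives rho back, so \<open>\<omega> * X\<close>
  has components \<open>\<rho>\<close> 2 and minus \<open>\<rho>\<close> 1 and the divergence is the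
  curl in \<open>moment_eq\<close>.\<close>

lemma divergence_rho_up:
  assumes "x \<in> S"
  shows "(\<Sum>i\<in>UNIV. pd i (\<lambda>y. \<omega> y * X y i) x) = - 2 * \<omega> x * moment \<Omega> \<Gamma> x"
proof -
  have d: "(\<lambda>y. \<rho> y i) differentiable (at x)" for i
    by (rule smooth_on_imp_differentiable[OF smooth_rho assms])
  have "pd 1 (\<lambda>y. \<omega> y * X y 1) x = pd 1 (\<lambda>y. \<rho> y 2) x"
    by (rule pd_cong[OF open_S assms _ d]) (simp add: rho_up_eq omega_nonzero)
  moreover have "pd 2 (\<lambda>y. \<omega> y * X y 2) x = pd 2 (\<lambda>y. - \<rho> y 1) x"
    by (rule pd_cong[OF open_S assms]) (auto simp: rho_up_eq omega_nonzero d)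
  moreover have "\<dots> = - pd 2 (\<lambda>y. \<rho> y 1) x"
    by (rule pd_uminus[OF d])
  ultimately show ?thesis
    using omega_nonzero[OF assms] by (simp add: sum_2 moment_eq[OF assms] field_simps)
qed

text \<open>The trace of the connection is a logarithmic derivative, hence has no curl; that curl is
  the trace of the curvature on its last two indices, which is the skew part of the Ricci tensor up
  to a factor.\<close>

lemma ricci_sym:
  assumes "x \<in> S"
  shows "ricci \<Gamma> x i j = ricci \<Gamma> x j i"
proof -
  let ?g = "\<lambda>i y. \<Gamma> y i 1 1 + \<Gamma> y i 2 2"
  have pg: "pd j (?g i) x = pd j (\<lambda>y. \<Gamma> y i 1 1) x + pd j (\<lambda>y. \<Gamma> y i 2 2) x" for i j
    by (rule pd_add[OF differentiable_Gamma[OF assms] differentiable_Gamma[OF assms]])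
  have "pd j (pd i \<omega>) x = ?g i x * pd j \<omega> x + pd j (?g i) x * \<omega> x" for i j
  proof -
    have g: "?g i differentiable (at x)"
      by (intro differentiable_add differentiable_Gamma assms)
    have "pd j (pd i \<omega>) x = pd j (\<lambda>y. ?g i y * \<omega> y) x"
      by (rule pd_cong[OF open_S assms])
        (auto simp: pd_omega intro!: differentiable_mult g differentiable_omega assms)
    also have "\<dots> = ?g i x * pd j \<omega> x + pd j (?g i) x * \<omega> x"
      by (rule pd_mult[OF g differentiable_omega[OF assms]])
    finally show ?thesis .
  qed
  \<comment> \<open>Equality of the mixed derivatives of \<open>\<omega>\<close>; the products of
    the two traces agree in both orders and cancel.\<close>
  from this[of 1 2] this[of 2 1] have "pd 1 (?g 2) x * \<omega> x = pd 2 (?g 1) x * \<omega> x"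
    using pd_commute[OF open_S assms smooth_omega, of 1 2] by (auto simp: pd_omega[OF assms])
  then have "pd 1 (?g 2) x = pd 2 (?g 1) x"
    using omega_nonzero[OF assms] by simp
  \<comment> \<open>The quadratic terms of the curvature form a commutator, whose trace
    vanishes.\<close>
  then have "curv \<Gamma> x 1 2 1 1 + curv \<Gamma> x 1 2 2 2 = 0"
    by (simp add: curv_eq'[OF assms] sum_2 pg)
  then have "ricci \<Gamma> x 2 1 = ricci \<Gamma> x 1 2" by (simp add: curv_components)
  then show ?thesis using exhaust_2[of i] exhaust_2[of j] by auto
qed

text \<open>For symmetric Ricci tensor \<open>\<rho> x i\<close> equals
  \<open>2 * cotton \<Gamma> x 1 2 i / \<omega> x\<close>. It vanishes on the whole open chart
  range, so its derivatives vanish as well.\<close>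

lemma cotton_zero_imp_moment_zero:
  assumes "\<And>x i j k. x \<in> S \<Longrightarrow> cotton \<Gamma> x i j k = 0" "x \<in> S"
  shows "moment \<Omega> \<Gamma> x = 0"
proof -
  have \<rho>: "\<rho> y i = 0" if y: "y \<in> S" for y i
  proof -
    have "nabla2 \<Gamma> (ricci_skew \<Gamma>) y i 1 2 = 0"
      using ricci_sym by (intro nabla2_zero[OF open_S y]) (simp add: ricci_skew_def)
    \<comment> \<open>This turns the contraction in \<open>rho_eq\<close>, which skips the middle
      index, into the antisymmetrisation in the Cotton tensor.\<close>
    moreover have "T y k i j = T y k j i" for k i j
    proof -
      have "pd k (\<lambda>z. ricci \<Gamma> z i j) y = pd k (\<lambda>z. ricci \<Gamma> z j i) y"
        by (rule pd_cong[OF open_S y _ differentiable_ricci[OF y]]) (rule ricci_sym)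
      moreover have "ricci \<Gamma> y a b = ricci \<Gamma> y b a" for a b by (rule ricci_sym[OF y])
      ultimately show ?thesis
        unfolding nabla2_def by (simp add: mult.commute)
    qed
    ultimately show ?thesis
      using assms(1)[OF y, of 1 2 i] by (simp add: cotton_def rho_eq[OF y])
  qed
  have "pd p (\<lambda>y. \<rho> y i) x = 0" for p i
    by (rule pd_zero[OF open_S assms(2) \<rho>])
  then show ?thesis by (simp add: moment_eq[OF assms(2)])
qed

end

section \<open>Tensoriality of the curvature one-form\<close>

text \<open>\<open>U\<close> is the overlap of two charts and \<open>\<tau>\<close> the transition
  map. All laws are stated with the Jacobian alone, without its inverse.\<close>

locale patch_change =
  P: symplectic_patch S \<Omega> \<Gamma> + Q: symplectic_patch S' \<Omega>' \<Gamma>'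
  for S \<Omega> \<Gamma> S' \<Omega>' \<Gamma>' +
  fixes U :: "(real^2) set" and \<tau> :: "real^2 \<Rightarrow> real^2"
  assumes open_U: "open U" and U_S: "U \<subseteq> S" and tau_U: "\<tau> ` U \<subseteq> S'"
    and smooth_tau: "smooth_on \<tau> U"
    and Omega_law: "x \<in> U \<Longrightarrow> \<Omega> x i j = (\<Sum>a\<in>UNIV. \<Sum>b\<in>UNIV. jac \<tau> x a i * jac \<tau> x b j * \<Omega>' (\<tau> x) a b)"
    and Gamma_law: "x \<in> U \<Longrightarrow> (\<Sum>k\<in>UNIV. \<Gamma> x i j k * jac \<tau> x c k) =
          pd i (\<lambda>y. jac \<tau> y c j) x
          + (\<Sum>a\<in>UNIV. \<Sum>b\<in>UNIV. \<Gamma>' (\<tau> x) a b c * jac \<tau> x a i * jac \<tau> x b j)"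
begin

abbreviation "J \<equiv> jac \<tau>"
abbreviation "\<Delta> x \<equiv> J x 1 1 * J x 2 2 - J x 2 1 * J x 1 2"

lemma in_S: "x \<in> U \<Longrightarrow> x \<in> S" and tau_in: "x \<in> U \<Longrightarrow> \<tau> x \<in> S'"
  using U_S tau_U by auto

lemma smooth_J: "smooth_on (\<lambda>x. J x a i) U"
  unfolding jac_def by (intro smooth_on_pd smooth_on_nth smooth_tau open_U)

lemma tau_differentiable: "x \<in> U \<Longrightarrow> \<tau> differentiable (at x)"
  by (rule smooth_on_imp_differentiable[OF smooth_tau])

lemma J_differentiable: "x \<in> U \<Longrightarrow> (\<lambda>x. J x a i) differentiable (at x)"
  by (rule smooth_on_imp_differentiable[OF smooth_J])

lemma pd_J_differentiable: "x \<in> U \<Longrightarrow> pd k (\<lambda>x. J x a i) differentiable (at x)"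
  by (rule smooth_on_imp_differentiable[OF smooth_on_pd[OF smooth_J]])

lemma pd_pd_J_sym: "x \<in> U \<Longrightarrow> pd k (pd i (\<lambda>y. J y a j)) x = pd i (pd k (\<lambda>y. J y a j)) x"
  by (rule pd_commute[OF open_U _ smooth_J])

lemma omega_law: "x \<in> U \<Longrightarrow> \<Omega> x 1 2 = \<Delta> x * \<Omega>' (\<tau> x) 1 2"
  using Omega_law[of x 1 2] Q.Omega_components[OF tau_in, of x] by (simp add: sum_2 algebra_simps)

text \<open>The source density is this determinant times the target density and does not vanish.
  \<open>ricci_law\<close>, \<open>rho_law\<close> and \<open>rho_up_law\<close> cancel the
  determinant.\<close>

lemma Delta_nonzero: "x \<in> U \<Longrightarrow> \<Delta> x \<noteq> 0"
  using omega_law[of x] P.omega_nonzero[OF in_S, of x] by auto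

text \<open>The connection law solved for the second derivatives of \<open>\<tau>\<close>; it
  eliminates them from the laws for \<open>curv\<close> and \<open>nabla2\<close>.\<close>

lemma pd_J:
  "x \<in> U \<Longrightarrow> pd i (\<lambda>y. J y c j) x = (\<Sum>k\<in>UNIV. \<Gamma> x i j k * J x c k)
     - (\<Sum>a\<in>UNIV. \<Sum>b\<in>UNIV. \<Gamma>' (\<tau> x) a b c * J x a i * J x b j)"
  using Gamma_law[of x i j c] by simp

text \<open>The connection law differentiated once more. The third derivatives of
  \<open>\<tau>\<close> stay isolated in one term, ready to cancel on antisymmetrising.\<close>

lemma pd_Gamma_law:
  assumes "x \<in> U"
  shows "(\<Sum>k\<in>UNIV. pd l (\<lambda>y. \<Gamma> y i j k) x * J x c k) + (\<Sum>k\<in>UNIV. \<Gamma> x i j k * pd l (\<lambda>y. J y c k) x)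
    = pd l (pd i (\<lambda>y. J y c j)) x
    + (\<Sum>a\<in>UNIV. \<Sum>b\<in>UNIV. (\<Sum>d\<in>UNIV. J x d l * pd d (\<lambda>y. \<Gamma>' y a b c) (\<tau> x)) * J x a i * J x b j
        + \<Gamma>' (\<tau> x) a b c * pd l (\<lambda>y. J y a i) x * J x b j
        + \<Gamma>' (\<tau> x) a b c * J x a i * pd l (\<lambda>y. J y b j) x)"
proof -
  note dG = P.differentiable_Gamma[OF in_S[OF assms]]
  note dJ = J_differentiable[OF assms]
  note G' = pd_compose[OF Q.differentiable_Gamma[OF tau_in[OF assms]] tau_differentiable[OF assms]]
  have d: "(\<lambda>y. \<Gamma> y i j k * J y c k) differentiable (at x)"
    "(\<lambda>y. \<Gamma>' (\<tau> y) a b c * J y a i) differentiable (at x)"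
    "(\<lambda>y. \<Gamma>' (\<tau> y) a b c * J y a i * J y b j) differentiable (at x)" for k a b
    by (intro differentiable_mult dG dJ G'(1))+
  have "pd l (\<lambda>y. \<Sum>k\<in>UNIV. \<Gamma> y i j k * J y c k) x
     = pd l (\<lambda>y. pd i (\<lambda>y. J y c j) y + (\<Sum>a\<in>UNIV. \<Sum>b\<in>UNIV. \<Gamma>' (\<tau> y) a b c * J y a i * J y b j)) x"
    by (rule pd_cong[OF open_U assms])
      (auto simp: Gamma_law intro!: differentiable_add differentiable_sum d pd_J_differentiable assms)
  then show ?thesis
    by (simp add: sum_2 pd_add pd_mult d dG dJ G' pd_J_differentiable[OF assms] algebra_simps)
qed

text \<open>In the difference of the two orders the third derivatives of \<open>\<tau>\<close>
  cancel by symmetry, the second ones through \<open>pd_J\<close>. Antisymmetrising two Jacobian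
  factors leaves their determinant.\<close>

lemma curv_law:
  assumes x: "x \<in> U"
  shows "(\<Sum>k\<in>UNIV. curv \<Gamma> x 1 2 p k * J x c k) = \<Delta> x * (\<Sum>d\<in>UNIV. J x d p * curv \<Gamma>' (\<tau> x) 1 2 d c)"
proof -
  note G = pd_Gamma_law[OF x, of 1 2 p c] pd_Gamma_law[OF x, of 2 1 p c]
  have e: "pd 2 (pd 1 (\<lambda>y. J y c p)) x = pd 1 (pd 2 (\<lambda>y. J y c p)) x"
    by (rule pd_pd_J_sym[OF x])
  have s: "\<Gamma> x 2 1 k = \<Gamma> x 1 2 k" "\<Gamma>' (\<tau> x) 2 1 k = \<Gamma>' (\<tau> x) 1 2 k" for k
    using P.Gamma_sym[OF in_S[OF x]] Q.Gamma_sym[OF tau_in[OF x]] by auto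
  show ?thesis
    using G unfolding e P.curv_eq'[OF in_S[OF x]] Q.curv_eq'[OF tau_in[OF x]] sum_2 pd_J[OF x] s
    by (simp add: algebra_simps)
qed

text \<open>For fixed \<open>j\<close> the two components of \<open>curv_law\<close> form a linear
  system for the two Ricci components, with determinant \<open>\<Delta> x\<close>.\<close>

lemma ricci_law:
  assumes x: "x \<in> U"
  shows "ricci \<Gamma> x i j = (\<Sum>a\<in>UNIV. \<Sum>b\<in>UNIV. J x a i * J x b j * ricci \<Gamma>' (\<tau> x) a b)"
proof -
  let ?R = "\<lambda>a. \<Sum>d\<in>UNIV. J x d j * ricci \<Gamma>' (\<tau> x) a d"
  have 1: "ricci \<Gamma> x 2 j * J x 1 1 - ricci \<Gamma> x 1 j * J x 1 2 = \<Delta> x * ?R 2"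
    using curv_law[OF x, of j 1] by (simp add: sum_2 P.curv_components Q.curv_components)
  have 2: "ricci \<Gamma> x 2 j * J x 2 1 - ricci \<Gamma> x 1 j * J x 2 2 = - (\<Delta> x * ?R 1)"
    using curv_law[OF x, of j 2] by (simp add: sum_2 P.curv_components Q.curv_components algebra_simps)
  \<comment> \<open>Cramer's rule, one case for each unknown.\<close>
  have "\<Delta> x * ricci \<Gamma> x i j = \<Delta> x * (\<Sum>a\<in>UNIV. J x a i * ?R a)" if "i = 1 \<or> i = 2"
    using that
  proof
    assume i: "i = 1"
    have "\<Delta> x * ricci \<Gamma> x 1 j = J x 2 1 * (ricci \<Gamma> x 2 j * J x 1 1 - ricci \<Gamma> x 1 j * J x 1 2)
        - J x 1 1 * (ricci \<Gamma> x 2 j * J x 2 1 - ricci \<Gamma> x 1 j * J x 2 2)"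
      by (simp add: algebra_simps)
    also have "\<dots> = \<Delta> x * (\<Sum>a\<in>UNIV. J x a 1 * ?R a)"
      unfolding 1 2 sum_2 by (simp add: algebra_simps)
    finally show ?thesis unfolding i .
  next
    assume i: "i = 2"
    have "\<Delta> x * ricci \<Gamma> x 2 j = J x 2 2 * (ricci \<Gamma> x 2 j * J x 1 1 - ricci \<Gamma> x 1 j * J x 1 2)
        - J x 1 2 * (ricci \<Gamma> x 2 j * J x 2 1 - ricci \<Gamma> x 1 j * J x 2 2)"
      by (simp add: algebra_simps)
    also have "\<dots> = \<Delta> x * (\<Sum>a\<in>UNIV. J x a 2 * ?R a)"
      unfolding 1 2 sum_2 by (simp add: algebra_simps)
    finally show ?thesis unfolding i .
  qed
  then have "\<Delta> x * ricci \<Gamma> x i j = \<Delta> x * (\<Sum>a\<in>UNIV. J x a i * ?R a)"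
    using exhaust_2 by blast
  then have "ricci \<Gamma> x i j = (\<Sum>a\<in>UNIV. J x a i * ?R a)"
    by (rule mult_left_cancel[OF Delta_nonzero[OF x], THEN iffD1])
  then show ?thesis by (simp add: sum_2 algebra_simps)
qed

text \<open>Differentiating the tensor law produces second derivatives of \<open>\<tau>\<close>,
  which \<open>pd_J\<close> turns into exactly the difference of the two connections' Christoffel
  terms.\<close>

lemma nabla2_law:
  assumes law: "\<And>y i j. y \<in> U \<Longrightarrow> t y i j = (\<Sum>a\<in>UNIV. \<Sum>b\<in>UNIV. J y a i * J y b j * t' (\<tau> y) a b)"
    and t': "\<And>a b. (\<lambda>y. t' y a b) differentiable (at (\<tau> x))" and x: "x \<in> U"
  shows "nabla2 \<Gamma> t x k i j = (\<Sum>c\<in>UNIV. \<Sum>a\<in>UNIV. \<Sum>b\<in>UNIV.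
    J x c k * J x a i * J x b j * nabla2 \<Gamma>' t' (\<tau> x) c a b)"
proof -
  note dJ = J_differentiable[OF x]
  note T' = pd_compose[OF t' tau_differentiable[OF x]]
  have d: "(\<lambda>y. J y a i * J y b j) differentiable (at x)"
    "(\<lambda>y. J y a i * J y b j * t' (\<tau> y) a b) differentiable (at x)" for a b
    by (intro differentiable_mult dJ T'(1))+
  have "pd k (\<lambda>y. t y i j) x = pd k (\<lambda>y. \<Sum>a\<in>UNIV. \<Sum>b\<in>UNIV. J y a i * J y b j * t' (\<tau> y) a b) x"
    by (rule pd_cong[OF open_U x]) (auto simp: law intro!: differentiable_sum d)
  also have "\<dots> = (\<Sum>a\<in>UNIV. \<Sum>b\<in>UNIV. J x a i * J x b j * (\<Sum>c\<in>UNIV. J x c k * pd c (\<lambda>y. t' y a b) (\<tau> x))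
       + (J x a i * pd k (\<lambda>y. J y b j) x + pd k (\<lambda>y. J y a i) x * J x b j) * t' (\<tau> x) a b)"
    by (simp add: sum_2 pd_add pd_mult d dJ T')
  finally have e: "pd k (\<lambda>y. t y i j) x = \<dots>" .
  show ?thesis
    unfolding nabla2_def e law[OF x] pd_J[OF x] sum_2 by (simp add: algebra_simps)
qed

text \<open>The antisymmetrised numerator in \<open>rho_eq\<close> and the density in its
  denominator acquire the same Jacobian determinant.\<close>

lemma rho_law:
  assumes x: "x \<in> U"
  shows "P.\<rho> x i = (\<Sum>a\<in>UNIV. J x a i * Q.\<rho> (\<tau> x) a)"
proof -
  have N: "P.T x k i j = (\<Sum>c\<in>UNIV. \<Sum>a\<in>UNIV. \<Sum>b\<in>UNIV. J x c k * J x a i * J x b j * Q.T (\<tau> x) c a b)" for k i j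
    by (rule nabla2_law[OF ricci_law Q.differentiable_ricci[OF tau_in[OF x]] x])
  have e: "P.T x 2 i 1 - P.T x 1 i 2
      = \<Delta> x * (\<Sum>a\<in>UNIV. J x a i * (Q.T (\<tau> x) 2 a 1 - Q.T (\<tau> x) 1 a 2))"
    unfolding N sum_2 by (simp add: algebra_simps)
  show ?thesis
    unfolding P.rho_eq[OF in_S[OF x]] e Q.rho_eq[OF tau_in[OF x]] omega_law[OF x]
      mult_divide_mult_cancel_left[OF Delta_nonzero[OF x]]
    by (simp add: sum_2 add_divide_distrib diff_divide_distrib algebra_simps)
qed

text \<open>The dual field holds the components of rho crosswise, so the transposed Jacobian in
  \<open>rho_law\<close> appears as a cofactor matrix; multiplied by the Jacobian it gives the
  determinant, which the density cancels.\<close>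

lemma rho_up_law:
  assumes x: "x \<in> U"
  shows "Q.X (\<tau> x) a = (\<Sum>i\<in>UNIV. J x a i * P.X x i)"
proof -
  note eq = P.rho_up_eq[OF in_S[OF x]] Q.rho_up_eq[OF tau_in[OF x]] rho_law[OF x] omega_law[OF x] sum_2
  have "\<Delta> x \<noteq> 0" "\<Omega>' (\<tau> x) 1 2 \<noteq> 0" using Delta_nonzero[OF x] Q.omega_nonzero[OF tau_in[OF x]] .
  then have "Q.X (\<tau> x) 1 = (\<Sum>i\<in>UNIV. J x 1 i * P.X x i)" "Q.X (\<tau> x) 2 = (\<Sum>i\<in>UNIV. J x 2 i * P.X x i)"
    unfolding eq by (simp_all add: divide_simps) (simp_all add: algebra_simps)
  then show ?thesis using exhaust_2[of a] by metis
qed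

end

section \<open>Flows and area densities on a surface\<close>

text \<open>The determinant of a linear map given as a function, which is the form in which
  derivatives arrive.\<close>

definition det2 :: "(real^2 \<Rightarrow> real^2) \<Rightarrow> real" where
  "det2 D = D (axis 1 1) $ 1 * D (axis 2 1) $ 2 - D (axis 1 1) $ 2 * D (axis 2 1) $ 1"

lemma linear_nth_2:
  fixes D :: "real^2 \<Rightarrow> real^2"
  assumes "linear D"
  shows "D v $ k = v $ 1 * D (axis 1 1) $ k + v $ 2 * D (axis 2 1) $ k"
proof -
  have "v = v $ 1 *\<^sub>R axis 1 1 + v $ 2 *\<^sub>R axis 2 1"
    by (simp add: vec_eq_iff forall_2 axis_def)
  then have "D v = D (v $ 1 *\<^sub>R axis 1 1 + v $ 2 *\<^sub>R axis 2 1)" by simp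
  then show ?thesis by (simp add: linear_add[OF assms] linear_cmul[OF assms])
qed

lemma det2_compose:
  assumes "linear D" "linear E"
  shows "det2 (\<lambda>v. E (D v)) = det2 E * det2 D"
  unfolding det2_def linear_nth_2[OF assms(2), of "D v" for v]
  by (simp add: algebra_simps)

text \<open>The pull-back of a skew form is skew, so in dimension two the tensor equation is carried
  by one component.\<close>

lemma pullback_skew_iff:
  fixes \<omega> \<omega>' :: "2 \<Rightarrow> 2 \<Rightarrow> real"
  assumes "\<And>i j. \<omega> i j = - \<omega> j i" "\<And>i j. \<omega>' i j = - \<omega>' j i"
  shows "(\<forall>i j. (\<Sum>a\<in>UNIV. \<Sum>b\<in>UNIV. D (axis i 1) $ a * D (axis j 1) $ b * \<omega>' a b) = \<omega> i j)
    \<longleftrightarrow> det2 D * \<omega>' 1 2 = \<omega> 1 2"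
proof -
  have "\<omega> 1 1 = 0" "\<omega> 2 2 = 0" "\<omega> 2 1 = - \<omega> 1 2" "\<omega>' 1 1 = 0" "\<omega>' 2 2 = 0" "\<omega>' 2 1 = - \<omega>' 1 2"
    using assms(1)[of 1 1] assms(1)[of 2 2] assms(1)[of 2 1] assms(2)[of 1 1] assms(2)[of 2 2] assms(2)[of 2 1]
    by auto
  then show ?thesis
    unfolding forall_2 sum_2 det2_def by (auto simp: algebra_simps)
qed

lemma frechet_derivative_nth:
  fixes f :: "real^2 \<Rightarrow> real^2"
  assumes "f differentiable (at x)"
  shows "frechet_derivative f (at x) v $ a = (\<Sum>i\<in>UNIV. v $ i * jac f x a i)"
proof -
  have D: "((\<lambda>y. f y $ a) has_derivative (\<lambda>h. frechet_derivative f (at x) h $ a)) (at x)"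
    using assms bounded_linear.has_derivative[OF bounded_linear_vec_nth]
    by (simp add: frechet_derivative_works)
  then have "(\<lambda>y. f y $ a) differentiable (at x)" by (auto simp: differentiable_def)
  from frechet_derivative_eq_sum_pd[OF this] show ?thesis
    using frechet_derivative_at[OF D] by (simp add: jac_def fun_eq_iff)
qed

text \<open>Jacobi's formula differentiates the determinant into the trace of the Jacobian of
  \<open>f\<close> times itself; adding the derivative of \<open>\<omega>\<close> along the curve
  completes the divergence of the weighted field.\<close>

lemma liouville_formula:
  fixes f :: "real^2 \<Rightarrow> real^2"
  assumes u: "(u has_vector_derivative f (u t)) (at t)"
    and y: "\<And>h. ((\<lambda>s. Y s h) has_vector_derivative frechet_derivative f (at (u t)) (Y t h)) (at t)"
    and f: "f differentiable (at (u t))" and \<omega>: "\<omega> differentiable (at (u t))"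
  shows "((\<lambda>s. det2 (Y s) * \<omega> (u s)) has_real_derivative
    det2 (Y t) * (\<Sum>i\<in>UNIV. pd i (\<lambda>x. \<omega> x * f x $ i) (u t))) (at t)"
proof -
  let ?J = "jac f (u t)"
  have Y: "((\<lambda>s. Y s h $ a) has_real_derivative (\<Sum>i\<in>UNIV. Y t h $ i * ?J a i)) (at t)" for h a
  proof -
    have "((\<lambda>s. Y s h $ a) has_vector_derivative frechet_derivative f (at (u t)) (Y t h) $ a) (at t)"
      by (rule bounded_linear.has_vector_derivative[OF bounded_linear_vec_nth y])
    then show ?thesis
      by (simp add: has_real_derivative_iff_has_vector_derivative frechet_derivative_nth[OF f])
  qed
  have \<omega>': "((\<lambda>s. \<omega> (u s)) has_real_derivative (\<Sum>i\<in>UNIV. f (u t) $ i * pd i \<omega> (u t))) (at t)"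
  proof -
    have "((\<lambda>s. \<omega> (u s)) has_derivative (\<lambda>h. frechet_derivative \<omega> (at (u t)) (h *\<^sub>R f (u t)))) (at t)"
      using has_derivative_compose[OF u[unfolded has_vector_derivative_def]] \<omega>
      by (simp add: frechet_derivative_works)
    then show ?thesis
      by (rule has_derivative_imp_has_field_derivative)
        (simp add: frechet_derivative_eq_sum_pd[OF \<omega>] sum_distrib_left sum_distrib_right mult_ac)
  qed
  have fa: "(\<lambda>x. f x $ i) differentiable (at (u t))" for i
    using f differentiable_componentwise_within[of f "u t" UNIV] by (auto simp: Basis_vec_def inner_axis)
  have "pd i (\<lambda>x. \<omega> x * f x $ i) (u t) = \<omega> (u t) * ?J i i + pd i \<omega> (u t) * f (u t) $ i" for i
    by (simp add: pd_mult[OF \<omega> fa] jac_def)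
  then show ?thesis
    unfolding det2_def sum_2
    by (auto intro!: derivative_eq_intros Y \<omega>' simp: sum_2 algebra_simps)
qed

section \<open>Charts and transition maps\<close>

locale surface =
  fixes \<A> :: "('a::{t2_space,second_countable_topology}) chart set"
  assumes surface: "smooth_surface \<A>"
begin

lemma chart_at: obtains \<kappa> where "\<kappa> \<in> \<A>" "p \<in> dom_chart \<kappa>"
  using surface unfolding smooth_surface_def by blast

lemma chart:
  assumes "\<kappa> \<in> \<A>"
  shows open_dom: "open (dom_chart \<kappa>)" and open_ran: "open (ran_chart \<kappa>)"
    and homeo: "homeomorphism (dom_chart \<kappa>) (ran_chart \<kappa>) (coord \<kappa>) (param \<kappa>)"
  using surface assms unfolding smooth_surface_def by auto

lemma param_coord: "\<kappa> \<in> \<A> \<Longrightarrow> p \<in> dom_chart \<kappa> \<Longrightarrow> param \<kappa> (coord \<kappa> p) = p"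
  using homeo by (auto simp: homeomorphism_def)

lemma coord_param: "x \<in> ran_chart \<kappa> \<Longrightarrow> coord \<kappa> (param \<kappa> x) = x"
  by (rule f_inv_into_f)

lemma param_in: "x \<in> ran_chart \<kappa> \<Longrightarrow> param \<kappa> x \<in> dom_chart \<kappa>"
  by (rule inv_into_into)

lemma isCont_coord: "\<kappa> \<in> \<A> \<Longrightarrow> p \<in> dom_chart \<kappa> \<Longrightarrow> isCont (coord \<kappa>) p"
  using homeo[of \<kappa>] open_dom[of \<kappa>] by (simp add: homeomorphism_def continuous_on_eq_continuous_at)

lemma isCont_param: "\<kappa> \<in> \<A> \<Longrightarrow> x \<in> ran_chart \<kappa> \<Longrightarrow> isCont (param \<kappa>) x"
  using homeo[of \<kappa>] open_ran[of \<kappa>] by (auto simp: homeomorphism_def continuous_on_eq_continuous_at)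

lemma overlap_iff:
  assumes "\<kappa> \<in> \<A>"
  shows "x \<in> overlap \<kappa> \<mu> \<longleftrightarrow> x \<in> ran_chart \<kappa> \<and> param \<kappa> x \<in> dom_chart \<mu>"
proof
  assume "x \<in> overlap \<kappa> \<mu>"
  then obtain p where "p \<in> dom_chart \<kappa>" "p \<in> dom_chart \<mu>" "x = coord \<kappa> p"
    by (auto simp: overlap_def)
  then show "x \<in> ran_chart \<kappa> \<and> param \<kappa> x \<in> dom_chart \<mu>"
    using param_coord[OF assms] by simp
next
  assume "x \<in> ran_chart \<kappa> \<and> param \<kappa> x \<in> dom_chart \<mu>"
  then show "x \<in> overlap \<kappa> \<mu>"
    unfolding overlap_def using param_in[of x \<kappa>] coord_param[of x \<kappa>] by (intro image_eqI[of _ _ "param \<kappa> x"]) auto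
qed

lemma open_overlap: "\<kappa> \<in> \<A> \<Longrightarrow> \<mu> \<in> \<A> \<Longrightarrow> open (overlap \<kappa> \<mu>)"
  using homeomorphism_imp_open_map[OF homeo[of \<kappa>], of "dom_chart \<kappa> \<inter> dom_chart \<mu>"]
    open_dom[of \<mu>] open_ran[of \<kappa>]
  by (auto simp: overlap_def openin_open_Int openin_open_eq)

lemma transition_in: "x \<in> overlap \<kappa> \<mu> \<Longrightarrow> \<kappa> \<in> \<A> \<Longrightarrow> transition \<kappa> \<mu> x \<in> ran_chart \<mu>"
  by (simp add: overlap_iff transition_def)

lemma smooth_transition: "\<kappa> \<in> \<A> \<Longrightarrow> \<mu> \<in> \<A> \<Longrightarrow> smooth_on (transition \<kappa> \<mu>) (overlap \<kappa> \<mu>)"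
  using surface by (simp add: smooth_surface_def)

lemma transition_has_derivative:
  assumes "\<kappa> \<in> \<A>" "\<mu> \<in> \<A>" "x \<in> overlap \<kappa> \<mu>"
  shows "(transition \<kappa> \<mu> has_derivative frechet_derivative (transition \<kappa> \<mu>) (at x)) (at x)"
  using smooth_on_imp_differentiable[OF smooth_transition[OF assms(1,2)] assms(3)]
  by (simp add: frechet_derivative_works)

end

lemma has_derivative_cong_nhds:
  assumes "(f has_derivative D) (at x)" "\<forall>\<^sub>F y in nhds x. f y = g y"
  shows "(g has_derivative D) (at x)"
  using assms(2) has_derivative_transform_within_open[OF assms(1)] by (auto simp: eventually_nhds)

section \<open>Integral curves and the flow of a vector field\<close>

locale vector_field = surface \<A> for \<A> :: "('a::{t2_space,second_countable_topology}) chart set" +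
  fixes X :: "'a chart \<Rightarrow> field1"
  assumes smooth_X: "\<kappa> \<in> \<A> \<Longrightarrow> smooth_on (\<lambda>x. X \<kappa> x i) (ran_chart \<kappa>)"
    and X_law: "\<kappa> \<in> \<A> \<Longrightarrow> \<mu> \<in> \<A> \<Longrightarrow> x \<in> overlap \<kappa> \<mu> \<Longrightarrow>
      X \<mu> (transition \<kappa> \<mu> x) a = (\<Sum>i\<in>UNIV. jac (transition \<kappa> \<mu>) x a i * X \<kappa> x i)"
begin

definition field_vec :: "'a chart \<Rightarrow> real^2 \<Rightarrow> real^2" where "field_vec \<kappa> x = (\<chi> i. X \<kappa> x i)"

lemma smooth_F: "\<kappa> \<in> \<A> \<Longrightarrow> smooth_on (field_vec \<kappa>) (ran_chart \<kappa>)"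
  unfolding field_vec_def[abs_def] by (intro smooth_on_vec_lambda smooth_X open_ran)

abbreviation "curve \<equiv> integral_curve \<A> X"

lemma curve_isCont: "curve J c \<Longrightarrow> t \<in> J \<Longrightarrow> isCont c t"
  using continuous_on_eq_continuous_at[of J c] by (auto simp: integral_curve_def)

lemma curve_tendsto: "curve J c \<Longrightarrow> t \<in> J \<Longrightarrow> (c \<longlongrightarrow> c t) (nhds t)"
  using curve_isCont[of J c t] tendsto_at_iff_tendsto_nhds[of c t] by (simp add: isCont_def)

text \<open>An integral curve is tested in every chart that it meets, so a solution in one chart
  must be carried to the others by the chain rule and \<open>X_law\<close>.\<close>

lemma curve_from_chart:
  assumes \<kappa>: "\<kappa> \<in> \<A>" and J: "open J" "is_interval J"
    and u: "\<And>t. t \<in> J \<Longrightarrow> u t \<in> ran_chart \<kappa>"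
      "\<And>t. t \<in> J \<Longrightarrow> (u has_vector_derivative field_vec \<kappa> (u t)) (at t)"
  shows "curve J (\<lambda>t. param \<kappa> (u t))"
  unfolding integral_curve_def
proof (intro conjI J ballI impI)
  have "isCont (\<lambda>t. param \<kappa> (u t)) t" if "t \<in> J" for t
    using isCont_o2[OF has_vector_derivative_continuous[OF u(2)[OF that]] isCont_param[OF \<kappa> u(1)[OF that]]] .
  then show "continuous_on J (\<lambda>t. param \<kappa> (u t))"
    by (simp add: continuous_at_imp_continuous_on)
next
  fix t \<mu> assume t: "t \<in> J" and \<mu>: "\<mu> \<in> \<A>" "param \<kappa> (u t) \<in> dom_chart \<mu>"
  let ?\<tau> = "transition \<kappa> \<mu>"
  have o: "u t \<in> overlap \<kappa> \<mu>" using u(1)[OF t] \<mu> overlap_iff[OF \<kappa>] by blast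
  have d: "?\<tau> differentiable (at (u t))"
    using transition_has_derivative[OF \<kappa> \<mu>(1) o] by (auto simp: differentiable_def)
  note D = transition_has_derivative[OF \<kappa> \<mu>(1) o]
  have "((\<lambda>s. ?\<tau> (u s)) has_derivative (\<lambda>h. frechet_derivative ?\<tau> (at (u t)) (h *\<^sub>R field_vec \<kappa> (u t)))) (at t)"
    by (rule has_derivative_compose[OF u(2)[OF t, unfolded has_vector_derivative_def] D])
  then have "((\<lambda>s. ?\<tau> (u s)) has_vector_derivative frechet_derivative ?\<tau> (at (u t)) (field_vec \<kappa> (u t))) (at t)"
    unfolding has_vector_derivative_def
    by (simp add: linear_cmul[OF has_derivative_linear[OF D]])
  moreover have "frechet_derivative ?\<tau> (at (u t)) (field_vec \<kappa> (u t)) = (\<chi> i. X \<mu> (?\<tau> (u t)) i)"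
    by (simp add: vec_eq_iff frechet_derivative_nth[OF d] X_law[OF \<kappa> \<mu>(1) o] field_vec_def mult.commute)
  ultimately show "((\<lambda>s. coord \<mu> (param \<kappa> (u s))) has_vector_derivative
      (\<chi> i. X \<mu> (coord \<mu> (param \<kappa> (u t))) i)) (at t)"
    by (simp add: transition_def)
qed

text \<open>Being an integral curve is local in time; this allows gluing in
  \<open>flows_trans\<close>.\<close>

lemma curve_local:
  assumes "open J" "is_interval J"
    and loc: "\<And>t. t \<in> J \<Longrightarrow> \<exists>J' c'. curve J' c' \<and> t \<in> J' \<and> (\<forall>\<^sub>F s in nhds t. c s = c' s)"
  shows "curve J c"
  unfolding integral_curve_def
proof (intro conjI assms(1,2) ballI impI)
  have "isCont c t" if t: "t \<in> J" for t
  proof -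
    obtain J' c' where c': "curve J' c'" "t \<in> J'" and e: "\<forall>\<^sub>F s in nhds t. c s = c' s"
      using loc[OF t] by blast
    have "isCont c' t" using c' by (rule curve_isCont)
    then show ?thesis using isCont_cong[OF e] by simp
  qed
  then show "continuous_on J c" by (simp add: continuous_at_imp_continuous_on)
next
  fix t \<kappa> assume t: "t \<in> J" and \<kappa>: "\<kappa> \<in> \<A>" "c t \<in> dom_chart \<kappa>"
  obtain J' c' where c': "curve J' c'" "t \<in> J'" and e: "\<forall>\<^sub>F s in nhds t. c s = c' s"
    using loc[OF t] by blast
  have ct: "c t = c' t" using eventually_nhds_x_imp_x[OF e] .
  have "((\<lambda>s. coord \<kappa> (c' s)) has_vector_derivative (\<chi> i. X \<kappa> (coord \<kappa> (c t)) i)) (at t)"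
    using c' \<kappa> ct by (simp add: integral_curve_def)
  moreover have "\<forall>\<^sub>F s in nhds t. coord \<kappa> (c' s) = coord \<kappa> (c s)"
    using e by eventually_elim simp
  ultimately show "((\<lambda>s. coord \<kappa> (c s)) has_vector_derivative (\<chi> i. X \<kappa> (coord \<kappa> (c t)) i)) (at t)"
    unfolding has_vector_derivative_def by (rule has_derivative_cong_nhds)
qed

lemma curve_shift:
  assumes "curve J c"
  shows "curve ((\<lambda>t. t + s) ` J) (\<lambda>t. c (t - s))"
  unfolding integral_curve_def
proof (intro conjI ballI impI)
  have "open ((+) s ` J)" "is_interval ((+) s ` J)" "continuous_on J c"
    using assms by (auto simp: integral_curve_def intro: open_translation)
  moreover have "(+) s ` J = (\<lambda>t. t + s) ` J" by (auto simp: add.commute)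
  ultimately show "open ((\<lambda>t. t + s) ` J)" "is_interval ((\<lambda>t. t + s) ` J)"
    "continuous_on ((\<lambda>t. t + s) ` J) (\<lambda>t. c (t - s))"
    by (auto intro!: continuous_on_compose2[of J c] continuous_intros)
next
  fix t \<kappa> assume t: "t \<in> (\<lambda>t. t + s) ` J" and \<kappa>: "\<kappa> \<in> \<A>" "c (t - s) \<in> dom_chart \<kappa>"
  have g: "((\<lambda>r. coord \<kappa> (c r)) has_vector_derivative (\<chi> i. X \<kappa> (coord \<kappa> (c (t - s))) i)) (at (t - s))"
    using assms t \<kappa> by (auto simp: integral_curve_def)
  have "((\<lambda>t. t - s) has_vector_derivative 1) (at t)"
    using has_vector_derivative_diff[OF has_vector_derivative_id has_vector_derivative_const[of s]] by simp
  from vector_diff_chain_at[OF this g]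
  show "((\<lambda>r. coord \<kappa> (c (r - s))) has_vector_derivative (\<chi> i. X \<kappa> (coord \<kappa> (c (t - s))) i)) (at t)"
    by (simp add: o_def)
qed

lemma curves_agree_near:
  assumes c1: "curve J1 c1" "t \<in> J1" and c2: "curve J2 c2" "t \<in> J2" and eq: "c1 t = c2 t"
  shows "\<forall>\<^sub>F s in nhds t. c1 s = c2 s"
proof -
  obtain \<kappa> where \<kappa>: "\<kappa> \<in> \<A>" "c1 t \<in> dom_chart \<kappa>" by (rule chart_at)
  have "\<forall>\<^sub>F s in nhds t. c1 s \<in> dom_chart \<kappa>" "\<forall>\<^sub>F s in nhds t. c2 s \<in> dom_chart \<kappa>"
    using \<kappa> eq topological_tendstoD[OF curve_tendsto[OF c1] open_dom[OF \<kappa>(1)]]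
      topological_tendstoD[OF curve_tendsto[OF c2] open_dom[OF \<kappa>(1)]] by auto
  moreover have "\<forall>\<^sub>F s in nhds t. s \<in> J1" "\<forall>\<^sub>F s in nhds t. s \<in> J2"
    using c1 c2 by (auto simp: integral_curve_def intro!: eventually_nhds_in_open)
  ultimately have ev: "\<forall>\<^sub>F s in nhds t. c1 s \<in> dom_chart \<kappa> \<and> c2 s \<in> dom_chart \<kappa> \<and> s \<in> J1 \<and> s \<in> J2"
    by eventually_elim simp
  then obtain d where "0 < d" and d: "\<And>s. \<bar>s - t\<bar> < d \<Longrightarrow>
      c1 s \<in> dom_chart \<kappa> \<and> c2 s \<in> dom_chart \<kappa> \<and> s \<in> J1 \<and> s \<in> J2"
    by (auto simp: eventually_nhds_metric dist_real_def)
  have "\<forall>\<^sub>F s in nhds t. coord \<kappa> (c1 s) = coord \<kappa> (c2 s)"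
  proof (rule ode_unique_local[OF open_ran smooth_F _ _ \<open>0 < d\<close>])
    fix s assume "\<bar>s - t\<bar> < d"
    then show "((\<lambda>s. coord \<kappa> (c1 s)) has_vector_derivative field_vec \<kappa> (coord \<kappa> (c1 s))) (at s)"
      "((\<lambda>s. coord \<kappa> (c2 s)) has_vector_derivative field_vec \<kappa> (coord \<kappa> (c2 s))) (at s)"
      using c1 c2 d \<kappa> by (auto simp: field_vec_def integral_curve_def)
  qed (use \<kappa> eq in auto)
  with ev show ?thesis
    by eventually_elim (metis \<kappa>(1) param_coord)
qed

text \<open>The times of agreement form an open set by local uniqueness and a closed one because the
  surface is Hausdorff, and the common interval is connected.\<close>

lemma curve_unique:
  assumes c1: "curve J1 c1" and c2: "curve J2 c2"
    and t0: "t0 \<in> J1 \<inter> J2" "c1 t0 = c2 t0" and t: "t \<in> J1 \<inter> J2"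
  shows "c1 t = c2 t"
proof -
  let ?J = "J1 \<inter> J2"
  have conn: "connected ?J"
    using c1 c2 by (auto simp: integral_curve_def is_interval_connected_1[symmetric] intro: is_interval_Int)
  have oJ: "open ?J" using c1 c2 by (auto simp: integral_curve_def)
  show ?thesis
  proof (rule connected_induction_simple[OF conn t0(1) t, of "\<lambda>s. c1 s = c2 s"])
    fix a assume a: "a \<in> ?J"
    show "\<exists>T. openin (top_of_set ?J) T \<and> a \<in> T \<and> (\<forall>x\<in>T. \<forall>y\<in>T. c1 x = c2 x \<longrightarrow> c1 y = c2 y)"
    proof -
      \<comment> \<open>Agreement does not change near any time: either it spreads, or disjoint
        neighbourhoods keep the curves apart.\<close>
      have "\<exists>T. open T \<and> a \<in> T \<and> ((\<forall>x\<in>T. c1 x = c2 x) \<or> (\<forall>x\<in>T. c1 x \<noteq> c2 x))"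
      proof (cases "c1 a = c2 a")
        case True
        then show ?thesis
          using curves_agree_near[OF c1 _ c2, of a] a by (auto simp: eventually_nhds)
      next
        case False
        then obtain U V where UV: "open U" "open V" "c1 a \<in> U" "c2 a \<in> V" "U \<inter> V = {}"
          by (metis hausdorff)
        have "\<forall>\<^sub>F s in nhds a. c1 s \<in> U" "\<forall>\<^sub>F s in nhds a. c2 s \<in> V"
          using UV a topological_tendstoD[OF curve_tendsto[OF c1, of a], of U]
            topological_tendstoD[OF curve_tendsto[OF c2, of a], of V] by auto
        then have "\<forall>\<^sub>F s in nhds a. c1 s \<noteq> c2 s"
          by eventually_elim (use UV in auto)
        then show ?thesis by (auto simp: eventually_nhds)
      qed
      then obtain T where "open T" "a \<in> T" "(\<forall>x\<in>T. c1 x = c2 x) \<or> (\<forall>x\<in>T. c1 x \<noteq> c2 x)" by blast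
      then show ?thesis
        using a oJ by (intro exI[of _ "T \<inter> ?J"]) (auto simp: openin_open)
    qed
  qed (use t0 in auto)
qed

abbreviation "flows \<equiv> flows_to \<A> X"

lemma flows_unique: "flows t p q \<Longrightarrow> flows t p r \<Longrightarrow> q = r"
  unfolding flows_to_def by (elim exE conjE) (use curve_unique[of _ _ _ _ 0 t] in force)

lemma flow_eq: "flows t p q \<Longrightarrow> flow \<A> X t p = q"
  unfolding flow_def using flows_unique by blast

text \<open>The second curve, shifted by \<open>s\<close>, meets the first at time \<open>s\<close>.
  By uniqueness they agree on the common interval, so the glued curve is well behaved at the
  seam.\<close>

lemma flows_trans:
  assumes "flows s p q" "flows h q r"
  shows "flows (s + h) p r"
proof -
  obtain J1 c1 where c1: "curve J1 c1" "0 \<in> J1" "s \<in> J1" "c1 0 = p" "c1 s = q"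
    using assms(1) by (auto simp: flows_to_def)
  obtain J0 c0 where c0: "curve J0 c0" "0 \<in> J0" "h \<in> J0" "c0 0 = q" "c0 h = r"
    using assms(2) by (auto simp: flows_to_def)
  define J2 where "J2 = (\<lambda>t. t + s) ` J0"
  define c2 where "c2 t = c0 (t - s)" for t
  have c2: "curve J2 c2" unfolding J2_def c2_def[abs_def] by (rule curve_shift[OF c0(1)])
  have mem: "s \<in> J2" "s + h \<in> J2" using c0 by (auto simp: J2_def image_iff)
  have agree: "c1 t = c2 t" if "t \<in> J1 \<inter> J2" for t
    using curve_unique[OF c1(1) c2, of s t] that mem c1 c0 by (auto simp: c2_def)
  define c where "c t = (if t \<in> J1 then c1 t else c2 t)" for t
  have oJ: "open J1" "open J2" and iJ: "is_interval J1" "is_interval J2"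
    using c1 c2 by (auto simp: integral_curve_def)
  have "curve (J1 \<union> J2) c"
  proof (rule curve_local)
    show "open (J1 \<union> J2)" using oJ by auto
    show "is_interval (J1 \<union> J2)"
      using iJ mem c1(3) connected_Un[of J1 J2] by (auto simp: is_interval_connected_1)
    show "\<exists>J' c'. curve J' c' \<and> t \<in> J' \<and> (\<forall>\<^sub>F r in nhds t. c r = c' r)" if "t \<in> J1 \<union> J2" for t
    proof (cases "t \<in> J1")
      case True
      have "\<forall>\<^sub>F r in nhds t. c r = c1 r"
        using eventually_nhds_in_open[OF oJ(1) True] by eventually_elim (simp add: c_def)
      then show ?thesis using c1(1) True by blast
    next
      case False
      then have "t \<in> J2" using that by simp
      have "\<forall>\<^sub>F r in nhds t. c r = c2 r"
        using eventually_nhds_in_open[OF oJ(2) \<open>t \<in> J2\<close>] by eventually_elim (auto simp: c_def agree)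
      then show ?thesis using c2 \<open>t \<in> J2\<close> by blast
    qed
  qed
  moreover have "c 0 = p" using c1 by (simp add: c_def)
  moreover have "c (s + h) = r"
    using agree[of "s + h"] mem c0 by (auto simp: c_def c2_def)
  ultimately show ?thesis
    unfolding flows_to_def using c1(2) mem by blast
qed

text \<open>The last clause identifies the local flow in coordinates with the flow on the surface,
  which is otherwise only described through maximal integral curves.\<close>

lemma flow_box:
  assumes \<kappa>: "\<kappa> \<in> \<A>" and x0: "x0 \<in> ran_chart \<kappa>"
  obtains \<epsilon> r \<phi> Y where "0 < \<epsilon>" "0 < r" "ball x0 r \<subseteq> ran_chart \<kappa>"
    "\<And>x. \<phi> 0 x = x"
    "\<And>t x. \<bar>t\<bar> < \<epsilon> \<Longrightarrow> x \<in> ball x0 r \<Longrightarrow> \<phi> t x \<in> ran_chart \<kappa>"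
    "\<And>t x. \<bar>t\<bar> < \<epsilon> \<Longrightarrow> x \<in> ball x0 r \<Longrightarrow> ((\<lambda>s. \<phi> s x) has_vector_derivative field_vec \<kappa> (\<phi> t x)) (at t)"
    "\<And>t x. \<bar>t\<bar> < \<epsilon> \<Longrightarrow> x \<in> ball x0 r \<Longrightarrow> (\<phi> t has_derivative Y t x) (at x)"
    "\<And>t x h. \<bar>t\<bar> < \<epsilon> \<Longrightarrow> x \<in> ball x0 r \<Longrightarrow>
       ((\<lambda>s. Y s x h) has_vector_derivative frechet_derivative (field_vec \<kappa>) (at (\<phi> t x)) (Y t x h)) (at t)"
    "\<And>x h. x \<in> ball x0 r \<Longrightarrow> Y 0 x h = h"
    "\<And>t x. \<bar>t\<bar> < \<epsilon> \<Longrightarrow> x \<in> ball x0 r \<Longrightarrow> flows t (param \<kappa> x) (param \<kappa> (\<phi> t x))"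
proof -
  obtain \<epsilon> r \<phi> Y where box: "0 < \<epsilon>" "0 < r" "ball x0 r \<subseteq> ran_chart \<kappa>"
    "\<And>x. \<phi> 0 x = x"
    "\<And>t x. \<bar>t\<bar> < \<epsilon> \<Longrightarrow> x \<in> ball x0 r \<Longrightarrow> \<phi> t x \<in> ran_chart \<kappa>"
    "\<And>t x. \<bar>t\<bar> < \<epsilon> \<Longrightarrow> x \<in> ball x0 r \<Longrightarrow> ((\<lambda>s. \<phi> s x) has_vector_derivative field_vec \<kappa> (\<phi> t x)) (at t)"
    "\<And>t x. \<bar>t\<bar> < \<epsilon> \<Longrightarrow> x \<in> ball x0 r \<Longrightarrow> (\<phi> t has_derivative Y t x) (at x)"
    "\<And>t x h. \<bar>t\<bar> < \<epsilon> \<Longrightarrow> x \<in> ball x0 r \<Longrightarrow>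
       ((\<lambda>s. Y s x h) has_vector_derivative frechet_derivative (field_vec \<kappa>) (at (\<phi> t x)) (Y t x h)) (at t)"
    "\<And>x h. x \<in> ball x0 r \<Longrightarrow> Y 0 x h = h"
    by (rule local_flow[OF open_ran[OF \<kappa>] x0 smooth_F[OF \<kappa>]]) (rule that; assumption)
  have "flows t (param \<kappa> x) (param \<kappa> (\<phi> t x))" if t: "\<bar>t\<bar> < \<epsilon>" and x: "x \<in> ball x0 r" for t x
  proof -
    have "curve {-\<epsilon><..<\<epsilon>} (\<lambda>t. param \<kappa> (\<phi> t x))"
      by (rule curve_from_chart[OF \<kappa>]) (auto intro!: box(5,6) x is_interval_oo simp: abs_less_iff)
    then show ?thesis
      unfolding flows_to_def using t box(1,4)
      by (intro exI[of _ "{-\<epsilon><..<\<epsilon>}"] exI[of _ "\<lambda>t. param \<kappa> (\<phi> t x)"]) auto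
  qed
  with box show ?thesis by (rule that)
qed

text \<open>A flow box serves here only to provide an integral curve through
  \<open>p\<close>.\<close>

lemma flows_refl: "flows 0 p p"
proof -
  obtain \<kappa> where \<kappa>: "\<kappa> \<in> \<A>" "p \<in> dom_chart \<kappa>" by (rule chart_at)
  then have "coord \<kappa> p \<in> ran_chart \<kappa>" by simp
  from \<kappa>(1) this show ?thesis
  proof (rule flow_box)
    fix \<epsilon> r :: real and \<phi> :: "real \<Rightarrow> real^2 \<Rightarrow> real^2"
    assume box: "0 < \<epsilon>" "0 < r" "\<And>x. \<phi> 0 x = x"
      "\<And>t x. \<bar>t\<bar> < \<epsilon> \<Longrightarrow> x \<in> ball (coord \<kappa> p) r \<Longrightarrow> flows t (param \<kappa> x) (param \<kappa> (\<phi> t x))"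
    then show ?thesis
      using box(4)[of 0 "coord \<kappa> p"] by (simp add: param_coord[OF \<kappa>])
  qed
qed

end

section \<open>Flows that preserve the symplectic form\<close>

locale field_with_form = vector_field \<A> X
  for \<A> :: "('a::{t2_space,second_countable_topology}) chart set" and X +
  fixes \<Omega> :: "'a chart \<Rightarrow> field2"
  assumes form: "symplectic_form \<A> \<Omega>"
begin

abbreviation "\<omega> \<kappa> x \<equiv> \<Omega> \<kappa> x 1 2"
text \<open>This is the single component of the Lie derivative of \<Omega> along \<open>X\<close>,
  or \<open>\<omega>\<close> times the divergence relative to \<Omega>; the weighted form is what
  Liouville's formula yields.\<close>

abbreviation "divergence \<kappa> x \<equiv> (\<Sum>i\<in>UNIV. pd i (\<lambda>y. \<omega> \<kappa> y * X \<kappa> y i) x)"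

lemma smooth_omega: "\<kappa> \<in> \<A> \<Longrightarrow> smooth_on (\<omega> \<kappa>) (ran_chart \<kappa>)"
  using form by (simp add: symplectic_form_def)

lemma skew: "\<kappa> \<in> \<A> \<Longrightarrow> x \<in> ran_chart \<kappa> \<Longrightarrow> \<Omega> \<kappa> x i j = - \<Omega> \<kappa> x j i"
  using form unfolding symplectic_form_def by blast

lemma omega_transition:
  assumes "\<kappa> \<in> \<A>" "\<mu> \<in> \<A>" "x \<in> overlap \<kappa> \<mu>"
  shows "det2 (frechet_derivative (transition \<kappa> \<mu>) (at x)) * \<omega> \<mu> (transition \<kappa> \<mu> x) = \<omega> \<kappa> x"
proof -
  have d: "transition \<kappa> \<mu> differentiable (at x)"
    using transition_has_derivative[OF assms] by (auto simp: differentiable_def)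
  have J: "frechet_derivative (transition \<kappa> \<mu>) (at x) (axis i 1) $ a = jac (transition \<kappa> \<mu>) x a i" for a i
    using exhaust_2[of i] by (auto simp: frechet_derivative_nth[OF d] axis_def sum_2)
  have x: "x \<in> ran_chart \<kappa>" using assms by (simp add: overlap_iff)
  have "(\<forall>i j. (\<Sum>a\<in>UNIV. \<Sum>b\<in>UNIV. frechet_derivative (transition \<kappa> \<mu>) (at x) (axis i 1) $ a
      * frechet_derivative (transition \<kappa> \<mu>) (at x) (axis j 1) $ b * \<Omega> \<mu> (transition \<kappa> \<mu> x) a b) = \<Omega> \<kappa> x i j)
    \<longleftrightarrow> det2 (frechet_derivative (transition \<kappa> \<mu>) (at x)) * \<omega> \<mu> (transition \<kappa> \<mu> x) = \<omega> \<kappa> x"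
    by (rule pullback_skew_iff[OF skew[OF assms(1) x] skew[OF assms(2) transition_in[OF assms(3,1)]]])
  moreover have "\<Omega> \<kappa> x i j = (\<Sum>a\<in>UNIV. \<Sum>b\<in>UNIV. jac (transition \<kappa> \<mu>) x a i * jac (transition \<kappa> \<mu>) x b j
             * \<Omega> \<mu> (transition \<kappa> \<mu> x) a b)" for i j
    using form assms unfolding symplectic_form_def by blast
  ultimately show ?thesis by (simp add: J)
qed

lemma density_derivative:
  assumes \<kappa>: "\<kappa> \<in> \<A>" and ran: "u t \<in> ran_chart \<kappa>"
    and u: "(u has_vector_derivative field_vec \<kappa> (u t)) (at t)"
    and y: "\<And>h. ((\<lambda>s. Y s h) has_vector_derivative frechet_derivative (field_vec \<kappa>) (at (u t)) (Y t h)) (at t)"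
  shows "((\<lambda>s. det2 (Y s) * \<omega> \<kappa> (u s)) has_real_derivative det2 (Y t) * divergence \<kappa> (u t)) (at t)"
  using liouville_formula[OF u y smooth_on_imp_differentiable[OF smooth_F[OF \<kappa>] ran]
      smooth_on_imp_differentiable[OF smooth_omega[OF \<kappa>] ran]]
  by (simp add: field_vec_def)

text \<open>The condition of \<open>symplectic_vector_field\<close> for one pair of charts, with the
  pull-back reduced to one component by \<open>pullback_skew_iff\<close>.\<close>

definition preserves :: "real \<Rightarrow> 'a \<Rightarrow> 'a chart \<Rightarrow> 'a chart \<Rightarrow> bool" where
  "preserves t p \<kappa> \<mu> \<longleftrightarrow> (\<exists>D. ((\<lambda>x. coord \<mu> (flow \<A> X t (param \<kappa> x))) has_derivative D) (at (coord \<kappa> p))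
     \<and> det2 D * \<omega> \<mu> (coord \<mu> (flow \<A> X t p)) = \<omega> \<kappa> (coord \<kappa> p))"

lemma symplectic_vector_field_iff:
  "symplectic_vector_field \<A> \<Omega> X \<longleftrightarrow> (\<forall>t p q. flows t p q \<longrightarrow>
     (\<forall>\<kappa>\<in>\<A>. \<forall>\<mu>\<in>\<A>. p \<in> dom_chart \<kappa> \<longrightarrow> flow \<A> X t p \<in> dom_chart \<mu> \<longrightarrow> preserves t p \<kappa> \<mu>))"
proof -
  have *: "(\<exists>D. ((\<lambda>x. coord \<mu> (flow \<A> X t (param \<kappa> x))) has_derivative D) (at (coord \<kappa> p))
     \<and> (\<forall>i j. (\<Sum>a\<in>UNIV. \<Sum>b\<in>UNIV. D (axis i 1) $ a * D (axis j 1) $ b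
                        * \<Omega> \<mu> (coord \<mu> (flow \<A> X t p)) a b) = \<Omega> \<kappa> (coord \<kappa> p) i j)) \<longleftrightarrow> preserves t p \<kappa> \<mu>"
    if "\<kappa> \<in> \<A>" "\<mu> \<in> \<A>" "p \<in> dom_chart \<kappa>" "flow \<A> X t p \<in> dom_chart \<mu>" for t p \<kappa> \<mu>
  proof -
    have "(\<forall>i j. (\<Sum>a\<in>UNIV. \<Sum>b\<in>UNIV. D (axis i 1) $ a * D (axis j 1) $ b
        * \<Omega> \<mu> (coord \<mu> (flow \<A> X t p)) a b) = \<Omega> \<kappa> (coord \<kappa> p) i j)
      \<longleftrightarrow> det2 D * \<omega> \<mu> (coord \<mu> (flow \<A> X t p)) = \<omega> \<kappa> (coord \<kappa> p)" for D
      by (rule pullback_skew_iff[OF skew[OF that(1) imageI[OF that(3)]] skew[OF that(2) imageI[OF that(4)]]])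
    then show ?thesis unfolding preserves_def by (simp only:)
  qed
  have "symplectic_vector_field \<A> \<Omega> X \<longleftrightarrow> (\<forall>t p. (\<exists>q. flows t p q) \<longrightarrow>
     (\<forall>\<kappa>\<in>\<A>. \<forall>\<mu>\<in>\<A>. p \<in> dom_chart \<kappa> \<longrightarrow> flow \<A> X t p \<in> dom_chart \<mu> \<longrightarrow> preserves t p \<kappa> \<mu>))"
    unfolding symplectic_vector_field_def flow_domain_def by (simp add: * cong: ball_cong imp_cong)
  then show ?thesis by blast
qed

text \<open>In a flow box around \<open>x0\<close> the hypothesis makes
  \<open>det2 (Y t x0) * \<omega> \<kappa> (\<phi> t x0)\<close> constant. Its derivative at time
  zero is the divergence at \<open>x0\<close>, since \<open>Y\<close> starts as the
  identity.\<close>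

lemma symplectic_imp_divergence_zero:
  assumes "symplectic_vector_field \<A> \<Omega> X" and \<kappa>: "\<kappa> \<in> \<A>" and x0: "x0 \<in> ran_chart \<kappa>"
  shows "divergence \<kappa> x0 = 0"
proof -
  obtain \<epsilon> r \<phi> Y where box: "0 < \<epsilon>" "0 < r" "ball x0 r \<subseteq> ran_chart \<kappa>"
    "\<And>x. \<phi> 0 x = x"
    "\<And>t x. \<bar>t\<bar> < \<epsilon> \<Longrightarrow> x \<in> ball x0 r \<Longrightarrow> \<phi> t x \<in> ran_chart \<kappa>"
    "\<And>t x. \<bar>t\<bar> < \<epsilon> \<Longrightarrow> x \<in> ball x0 r \<Longrightarrow> ((\<lambda>s. \<phi> s x) has_vector_derivative field_vec \<kappa> (\<phi> t x)) (at t)"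
    "\<And>t x. \<bar>t\<bar> < \<epsilon> \<Longrightarrow> x \<in> ball x0 r \<Longrightarrow> (\<phi> t has_derivative Y t x) (at x)"
    "\<And>t x h. \<bar>t\<bar> < \<epsilon> \<Longrightarrow> x \<in> ball x0 r \<Longrightarrow>
       ((\<lambda>s. Y s x h) has_vector_derivative frechet_derivative (field_vec \<kappa>) (at (\<phi> t x)) (Y t x h)) (at t)"
    "\<And>x h. x \<in> ball x0 r \<Longrightarrow> Y 0 x h = h"
    "\<And>t x. \<bar>t\<bar> < \<epsilon> \<Longrightarrow> x \<in> ball x0 r \<Longrightarrow> flows t (param \<kappa> x) (param \<kappa> (\<phi> t x))"
    by (rule flow_box[OF \<kappa> x0]) (rule that; assumption)
  have x0': "x0 \<in> ball x0 r" using box(2) by simp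
  have const: "det2 (Y t x0) * \<omega> \<kappa> (\<phi> t x0) = \<omega> \<kappa> x0" if t: "\<bar>t\<bar> < \<epsilon>" for t
  proof -
    note fl = flow_eq[OF box(10)[OF t]]
    have "preserves t (param \<kappa> x0) \<kappa> \<kappa>"
      using assms(1)[unfolded symplectic_vector_field_iff, rule_format, OF box(10)[OF t x0'] \<kappa> \<kappa>]
        param_in[OF x0] param_in[OF box(5)[OF t x0']] by (simp add: fl[OF x0'])
    then obtain D where D: "((\<lambda>x. coord \<kappa> (flow \<A> X t (param \<kappa> x))) has_derivative D) (at x0)"
      and det: "det2 D * \<omega> \<kappa> (\<phi> t x0) = \<omega> \<kappa> x0"
      by (auto simp: preserves_def fl[OF x0'] coord_param[OF x0] coord_param[OF box(5)[OF t x0']])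
    have "\<forall>\<^sub>F x in nhds x0. x \<in> ball x0 r"
      using x0' by (intro eventually_nhds_in_open) auto
    then have "\<forall>\<^sub>F x in nhds x0. coord \<kappa> (flow \<A> X t (param \<kappa> x)) = \<phi> t x"
      by eventually_elim (simp add: fl coord_param[OF box(5)[OF t]])
    \<comment> \<open>Near \<open>x0\<close> the flow coincides with \<open>\<phi>\<close>, so its
      derivative is \<open>Y\<close>.\<close>
    from has_derivative_unique[OF has_derivative_cong_nhds[OF D this] box(7)[OF t x0']]
    show ?thesis using det by simp
  qed
  have "((\<lambda>t. det2 (Y t x0) * \<omega> \<kappa> (\<phi> t x0)) has_real_derivative det2 (Y 0 x0) * divergence \<kappa> (\<phi> 0 x0)) (at 0)"
    using density_derivative[OF \<kappa> box(5) box(6) box(8), of 0 x0] box(1) x0' by auto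
  moreover have "((\<lambda>t. det2 (Y t x0) * \<omega> \<kappa> (\<phi> t x0)) has_real_derivative 0) (at 0)"
  proof (rule has_field_derivative_transform_within_open[OF DERIV_const])
    show "open {-\<epsilon><..<\<epsilon>}" "0 \<in> {-\<epsilon><..<\<epsilon>}" using box(1) by auto
    show "\<omega> \<kappa> x0 = det2 (Y t x0) * \<omega> \<kappa> (\<phi> t x0)" if "t \<in> {-\<epsilon><..<\<epsilon>}" for t
      using const[of t] that by (simp add: abs_less_iff)
  qed
  moreover have "det2 (Y 0 x0) = 1"
    by (simp add: det2_def box(9)[OF x0'] axis_def)
  ultimately show ?thesis
    using DERIV_unique box(4) by fastforce
qed

text \<open>Continuity of the flow does not follow from the differentiability in \<open>preserves\<close>, which only sees
  the flow through \<open>coord \<mu>\<close>, a map that is unspecified outside \<open>dom_chart \<mu>\<close>.\<close>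

definition locally_symplectic :: "real \<Rightarrow> 'a \<Rightarrow> bool" where
  "locally_symplectic t p \<longleftrightarrow> (\<forall>\<^sub>F q in nhds p. flows t q (flow \<A> X t q)) \<and>
     (flow \<A> X t \<longlongrightarrow> flow \<A> X t p) (nhds p) \<and>
     (\<forall>\<kappa>\<in>\<A>. \<forall>\<mu>\<in>\<A>. p \<in> dom_chart \<kappa> \<longrightarrow> flow \<A> X t p \<in> dom_chart \<mu> \<longrightarrow> preserves t p \<kappa> \<mu>)"

text \<open>At time zero the flow is the identity, but read in two different charts it is the
  transition map; the claim is then the transformation law of the density.\<close>

lemma locally_symplectic_0: "locally_symplectic 0 p"
proof -
  have id: "flow \<A> X 0 q = q" for q
    by (rule flow_eq[OF flows_refl])
  have "preserves 0 p \<kappa> \<mu>" if \<kappa>: "\<kappa> \<in> \<A>" "\<mu> \<in> \<A>" and p: "p \<in> dom_chart \<kappa>" "p \<in> dom_chart \<mu>" for \<kappa> \<mu>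
  proof -
    have "coord \<kappa> p \<in> overlap \<kappa> \<mu>" using p by (simp add: overlap_def)
    from transition_has_derivative[OF \<kappa> this] omega_transition[OF \<kappa> this] show ?thesis
      unfolding preserves_def by (auto simp: id transition_def[abs_def] param_coord[OF \<kappa>(1) p(1)])
  qed
  moreover have "flow \<A> X 0 = (\<lambda>q. q)" using id by (rule ext)
  ultimately show ?thesis
    using flows_refl filterlim_ident[of "nhds p"] by (simp add: locally_symplectic_def)
qed

text \<open>By the group law the flow for time \<open>s + h\<close> is the flow for time
  \<open>s\<close> followed by a flow box step, for either sign of \<open>h\<close>. The choice of
  \<open>\<epsilon>\<close> and \<open>W\<close> precedes \<open>s\<close> and \<open>p\<close>,
  which is what the propagation along a trajectory needs.\<close>

lemma locally_symplectic_step: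
  assumes div: "\<And>\<kappa> x. \<kappa> \<in> \<A> \<Longrightarrow> x \<in> ran_chart \<kappa> \<Longrightarrow> divergence \<kappa> x = 0"
  obtains \<epsilon> W where "0 < \<epsilon>" "open W" "q0 \<in> W"
    "\<And>s h p. \<bar>h\<bar> < \<epsilon> \<Longrightarrow> locally_symplectic s p \<Longrightarrow> flow \<A> X s p \<in> W \<Longrightarrow> locally_symplectic (s + h) p"
proof -
  obtain \<nu> where \<nu>: "\<nu> \<in> \<A>" "q0 \<in> dom_chart \<nu>" by (rule chart_at)
  define x0 where "x0 = coord \<nu> q0"
  have x0: "x0 \<in> ran_chart \<nu>" using \<nu> by (simp add: x0_def)
  obtain \<epsilon> r \<phi> Y where box: "0 < \<epsilon>" "0 < r" "ball x0 r \<subseteq> ran_chart \<nu>"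
    "\<And>x. \<phi> 0 x = x"
    "\<And>t x. \<bar>t\<bar> < \<epsilon> \<Longrightarrow> x \<in> ball x0 r \<Longrightarrow> \<phi> t x \<in> ran_chart \<nu>"
    "\<And>t x. \<bar>t\<bar> < \<epsilon> \<Longrightarrow> x \<in> ball x0 r \<Longrightarrow> ((\<lambda>s. \<phi> s x) has_vector_derivative field_vec \<nu> (\<phi> t x)) (at t)"
    "\<And>t x. \<bar>t\<bar> < \<epsilon> \<Longrightarrow> x \<in> ball x0 r \<Longrightarrow> (\<phi> t has_derivative Y t x) (at x)"
    "\<And>t x h. \<bar>t\<bar> < \<epsilon> \<Longrightarrow> x \<in> ball x0 r \<Longrightarrow>
       ((\<lambda>s. Y s x h) has_vector_derivative frechet_derivative (field_vec \<nu>) (at (\<phi> t x)) (Y t x h)) (at t)"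
    "\<And>x h. x \<in> ball x0 r \<Longrightarrow> Y 0 x h = h"
    "\<And>t x. \<bar>t\<bar> < \<epsilon> \<Longrightarrow> x \<in> ball x0 r \<Longrightarrow> flows t (param \<nu> x) (param \<nu> (\<phi> t x))"
    by (rule flow_box[OF \<nu>(1) x0]) (rule that; assumption)
  define W where "W = dom_chart \<nu> \<inter> coord \<nu> -` ball x0 r"
  have W: "open W" "q0 \<in> W"
  proof -
    have "continuous_on (dom_chart \<nu>) (coord \<nu>)"
      using homeo[OF \<nu>(1)] by (simp add: homeomorphism_def)
    then show "open W" unfolding W_def by (rule continuous_open_preimage[OF _ open_dom[OF \<nu>(1)] open_ball])
    show "q0 \<in> W" using \<nu> box(2) by (simp add: W_def x0_def)
  qed
  \<comment> \<open>Liouville's formula with vanishing divergence, within one chart.\<close>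
  have density: "det2 (Y t x) * \<omega> \<nu> (\<phi> t x) = \<omega> \<nu> x" if t: "\<bar>t\<bar> < \<epsilon>" and x: "x \<in> ball x0 r" for t x
  proof -
    let ?g = "\<lambda>t. det2 (Y t x) * \<omega> \<nu> (\<phi> t x)"
    have "\<exists>c. \<forall>s\<in>{-\<epsilon><..<\<epsilon>}. ?g s = c"
    proof (rule has_field_derivative_zero_constant)
      fix s assume "s \<in> {-\<epsilon><..<\<epsilon>}"
      then have s: "\<bar>s\<bar> < \<epsilon>" by (simp add: abs_less_iff)
      have "(?g has_real_derivative det2 (Y s x) * divergence \<nu> (\<phi> s x)) (at s)"
        by (rule density_derivative[OF \<nu>(1) box(5)[OF s x] box(6)[OF s x] box(8)[OF s x]])
      then show "(?g has_real_derivative 0) (at s within {-\<epsilon><..<\<epsilon>})"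
        using div[OF \<nu>(1) box(5)[OF s x]] by (simp add: has_field_derivative_at_within)
    qed simp
    then have "?g t = ?g 0" using t box(1) by (auto simp: abs_less_iff)
    also have "\<dots> = \<omega> \<nu> x" by (simp add: box(4) det2_def box(9)[OF x] axis_def)
    finally show ?thesis .
  qed
  have "locally_symplectic (s + h) p" if h: "\<bar>h\<bar> < \<epsilon>" and g: "locally_symplectic s p" and pW: "flow \<A> X s p \<in> W" for s h p
  proof -
    let ?f = "flow \<A> X s" and ?\<psi> = "\<lambda>q. param \<nu> (\<phi> h (coord \<nu> q))"
    have ball: "coord \<nu> (?f p) \<in> ball x0 r" and fp: "?f p \<in> dom_chart \<nu>" using pW by (auto simp: W_def)
    have lim: "(?f \<longlongrightarrow> ?f p) (nhds p)" using g by (simp add: locally_symplectic_def)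
    have "\<forall>\<^sub>F q in nhds p. ?f q \<in> W"
      using topological_tendstoD[OF lim W(1) pW] .
    moreover have "\<forall>\<^sub>F q in nhds p. flows s q (?f q)" using g by (simp add: locally_symplectic_def)
    \<comment> \<open>Continuity of the flow for time \<open>s\<close> sends all points near
      \<open>p\<close> into \<open>W\<close>, where the flow box applies.\<close>
    ultimately have ev: "\<forall>\<^sub>F q in nhds p. flows (s + h) q (?\<psi> (?f q)) \<and> ?f q \<in> W"
    proof eventually_elim
      case (elim q)
      then have "coord \<nu> (?f q) \<in> ball x0 r" "?f q \<in> dom_chart \<nu>" by (auto simp: W_def)
      with flows_trans[OF elim(2) box(10)[OF h, of "coord \<nu> (?f q)", unfolded param_coord[OF \<nu>(1) this(2)]]] elim(1)
      show ?case by simp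
    qed
    have ev2: "\<forall>\<^sub>F q in nhds p. flow \<A> X (s + h) q = ?\<psi> (?f q)"
      using ev by eventually_elim (simp add: flow_eq)
    have flow_p: "flow \<A> X (s + h) p = ?\<psi> (?f p)"
      using eventually_nhds_x_imp_x[OF ev2] .
    have ran: "\<phi> h (coord \<nu> (?f p)) \<in> ran_chart \<nu>" by (rule box(5)[OF h ball])
    have lim2: "(flow \<A> X (s + h) \<longlongrightarrow> flow \<A> X (s + h) p) (nhds p)"
    proof -
      have "isCont ?\<psi> (?f p)"
        by (intro isCont_o2[OF isCont_coord[OF \<nu>(1) fp]] isCont_o2[OF has_derivative_continuous[OF box(7)[OF h ball]]]
            isCont_param[OF \<nu>(1) ran])
      then have "((\<lambda>q. ?\<psi> (?f q)) \<longlongrightarrow> ?\<psi> (?f p)) (nhds p)"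
        using lim by (rule isCont_tendsto_compose)
      then show ?thesis
        unfolding flow_p using ev2 by (rule Lim_transform_eventually[OF _ eventually_mono]) simp
    qed
    have "preserves (s + h) p \<kappa> \<mu>"
      if \<kappa>: "\<kappa> \<in> \<A>" "p \<in> dom_chart \<kappa>" and \<mu>: "\<mu> \<in> \<A>" "flow \<A> X (s + h) p \<in> dom_chart \<mu>" for \<kappa> \<mu>
    proof -
      let ?x = "coord \<kappa> p"
      have px: "param \<kappa> ?x = p" by (rule param_coord[OF \<kappa>])
      have x: "?x \<in> ran_chart \<kappa>" using \<kappa> by simp
      \<comment> \<open>\<open>locally_symplectic\<close> speaks of all target charts, so the flow
        for time \<open>s\<close> may be read in the flow box chart \<open>\<nu>\<close>.\<close>
      obtain D where D: "((\<lambda>x. coord \<nu> (?f (param \<kappa> x))) has_derivative D) (at ?x)"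
        and detD: "det2 D * \<omega> \<nu> (coord \<nu> (?f p)) = \<omega> \<kappa> ?x"
        using g \<kappa> \<nu>(1) fp by (auto simp: locally_symplectic_def preserves_def)
      let ?z = "\<phi> h (coord \<nu> (?f p))" and ?\<tau> = "transition \<nu> \<mu>"
      have z: "?z \<in> overlap \<nu> \<mu>" using ran \<mu>(2) overlap_iff[OF \<nu>(1)] by (simp add: flow_p)
      note E = transition_has_derivative[OF \<nu>(1) \<mu>(1) z]
      let ?E = "frechet_derivative ?\<tau> (at ?z)" and ?Y = "Y h (coord \<nu> (?f p))"
      have 1: "((\<lambda>x. \<phi> h (coord \<nu> (?f (param \<kappa> x)))) has_derivative (\<lambda>v. ?Y (D v))) (at ?x)"
        by (rule has_derivative_compose[OF D]) (simp add: px box(7)[OF h ball])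
      have 2: "((\<lambda>x. ?\<tau> (\<phi> h (coord \<nu> (?f (param \<kappa> x))))) has_derivative (\<lambda>v. ?E (?Y (D v)))) (at ?x)"
        by (rule has_derivative_compose[OF 1]) (simp add: px E)
      have "(param \<kappa> \<longlongrightarrow> p) (nhds ?x)"
        using isCont_param[OF \<kappa>(1) x] tendsto_at_iff_tendsto_nhds[of "param \<kappa>" ?x] by (simp add: isCont_def px)
      from eventually_compose_filterlim[OF ev2 this]
      have "\<forall>\<^sub>F x in nhds ?x. ?\<tau> (\<phi> h (coord \<nu> (?f (param \<kappa> x)))) = coord \<mu> (flow \<A> X (s + h) (param \<kappa> x))"
        by eventually_elim (simp add: transition_def)
      note 3 = has_derivative_cong_nhds[OF 2 this]
      have det: "det2 (\<lambda>v. ?E (?Y (D v))) = det2 ?E * det2 ?Y * det2 D"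
        using det2_compose[of D ?Y] det2_compose[of "\<lambda>v. ?Y (D v)" ?E] has_derivative_linear[OF D]
          has_derivative_linear[OF box(7)[OF h ball]] has_derivative_linear[OF 1] has_derivative_linear[OF E]
        by simp
      have detE: "det2 ?E * \<omega> \<mu> (coord \<mu> (flow \<A> X (s + h) p)) = \<omega> \<nu> ?z"
        using omega_transition[OF \<nu>(1) \<mu>(1) z] by (simp add: transition_def flow_p)
      \<comment> \<open>The product telescopes: the transition map, the flow box step and the flow
        for time \<open>s\<close> each carry the density to the next chart or point.\<close>
      have "det2 (\<lambda>v. ?E (?Y (D v))) * \<omega> \<mu> (coord \<mu> (flow \<A> X (s + h) p))
          = det2 D * (det2 ?Y * (det2 ?E * \<omega> \<mu> (coord \<mu> (flow \<A> X (s + h) p))))"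
        unfolding det by (simp only: mult_ac)
      also have "\<dots> = \<omega> \<kappa> ?x"
        unfolding detE density[OF h ball] detD ..
      finally have "det2 (\<lambda>v. ?E (?Y (D v))) * \<omega> \<mu> (coord \<mu> (flow \<A> X (s + h) p)) = \<omega> \<kappa> ?x" .
      then show ?thesis unfolding preserves_def using 3 by blast
    qed
    moreover have "\<forall>\<^sub>F q in nhds p. flows (s + h) q (flow \<A> X (s + h) q)"
      using ev ev2 by eventually_elim simp
    ultimately show ?thesis using lim2 by (simp add: locally_symplectic_def)
  qed
  with box(1) W show ?thesis by (rule that)
qed

text \<open>With \<open>p\<close> fixed, the property is true at time zero and passes between any
  two nearby times of the trajectory, so connectedness of its time interval extends it to all
  times.\<close>

lemma divergence_zero_imp_symplectic:
  assumes div: "\<And>\<kappa> x. \<kappa> \<in> \<A> \<Longrightarrow> x \<in> ran_chart \<kappa> \<Longrightarrow> divergence \<kappa> x = 0"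
  shows "symplectic_vector_field \<A> \<Omega> X"
proof -
  have "locally_symplectic t p" if "flows t p q" for t p q
  proof -
    obtain J c where c: "curve J c" "0 \<in> J" "t \<in> J" "c 0 = p"
      using \<open>flows t p q\<close> by (auto simp: flows_to_def)
    have J: "open J" "connected J"
      using c(1) by (auto simp: integral_curve_def is_interval_connected_1)
    have fl: "flow \<A> X s p = c s" if "s \<in> J" for s
      by (rule flow_eq) (use c that in \<open>auto simp: flows_to_def\<close>)
    show ?thesis
    proof (rule connected_induction_simple[OF J(2) c(2,3), of "\<lambda>s. locally_symplectic s p"])
      show "locally_symplectic 0 p" by (rule locally_symplectic_0)
      fix a assume a: "a \<in> J"
      obtain \<epsilon> W where W: "0 < \<epsilon>" "open W" "c a \<in> W"
        "\<And>s h p. \<bar>h\<bar> < \<epsilon> \<Longrightarrow> locally_symplectic s p \<Longrightarrow> flow \<A> X s p \<in> W \<Longrightarrow> locally_symplectic (s + h) p"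
        using locally_symplectic_step[OF div, of "c a"] by metis
      have "\<forall>\<^sub>F s in nhds a. c s \<in> W"
        by (rule topological_tendstoD[OF curve_tendsto[OF c(1) a] W(2,3)])
      moreover have "\<forall>\<^sub>F s in nhds a. s \<in> J" using J(1) a by (rule eventually_nhds_in_open)
      moreover have "\<forall>\<^sub>F s in nhds a. s \<in> ball a (\<epsilon> / 2)"
        using W(1) by (intro eventually_nhds_in_open) auto
      ultimately have "\<forall>\<^sub>F s in nhds a. c s \<in> W \<and> s \<in> J \<and> s \<in> ball a (\<epsilon> / 2)"
        by eventually_elim simp
      then obtain T where T: "open T" "a \<in> T" "\<And>s. s \<in> T \<Longrightarrow> c s \<in> W \<and> s \<in> J \<and> s \<in> ball a (\<epsilon> / 2)"
        by (auto simp: eventually_nhds)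
      have "locally_symplectic y p" if "x \<in> T" "y \<in> T" "locally_symplectic x p" for x y
      proof -
        \<comment> \<open>Both times lie within half of \<open>\<epsilon>\<close> of
          \<open>a\<close>. The step \<open>h = y - x\<close> may be negative, which is why the set
          of good times is closed and not only open.\<close>
        have "dist x y < \<epsilon>"
          using T(3)[OF \<open>x \<in> T\<close>] T(3)[OF \<open>y \<in> T\<close>] dist_triangle_half_r[of a x \<epsilon> y] by simp
        then show ?thesis
          using W(4)[of "y - x" x p] that T(3)[OF \<open>x \<in> T\<close>] fl by (simp add: dist_real_def abs_minus_commute)
      qed
      moreover have "openin (top_of_set J) T"
        using T by (intro open_subset) auto
      ultimately show "\<exists>T. openin (top_of_set J) T \<and> a \<in> T \<and> (\<forall>x\<in>T. \<forall>y\<in>T. locally_symplectic x p \<longrightarrow> locally_symplectic y p)"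
        using T(2) by blast
    qed
  qed
  then show ?thesis
    unfolding symplectic_vector_field_iff locally_symplectic_def by blast
qed

end

section \<open>From the global hypotheses to charts, and the conclusion\<close>

lemma symplectic_patch_chart:
  assumes "smooth_surface \<A>" "symplectic_form \<A> \<Omega>" "symplectic_connection \<A> \<Omega> \<Gamma>" "\<kappa> \<in> \<A>"
  shows "symplectic_patch (ran_chart \<kappa>) (\<Omega> \<kappa>) (\<Gamma> \<kappa>)"
proof
  show "open (ran_chart \<kappa>)"
    using assms(1,4) unfolding smooth_surface_def by blast
  show "smooth_on (\<lambda>x. \<Omega> \<kappa> x i j) (ran_chart \<kappa>)" for i j
    using assms(2,4) unfolding symplectic_form_def by blast
  show "\<Omega> \<kappa> x i j = - \<Omega> \<kappa> x j i" if "x \<in> ran_chart \<kappa>" for x i j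
    using assms(2,4) that unfolding symplectic_form_def by blast
  show "invertible (\<chi> i j. \<Omega> \<kappa> x i j)" if "x \<in> ran_chart \<kappa>" for x
    using assms(2,4) that unfolding symplectic_form_def by blast
  show "smooth_on (\<lambda>x. \<Gamma> \<kappa> x i j k) (ran_chart \<kappa>)" for i j k
    using assms(3,4) unfolding symplectic_connection_def affine_connection_def by blast
  show "\<Gamma> \<kappa> x i j k = \<Gamma> \<kappa> x j i k" if "x \<in> ran_chart \<kappa>" for x i j k
    using assms(3,4) that unfolding symplectic_connection_def torsion_free_def by blast
  show "nabla2 (\<Gamma> \<kappa>) (\<Omega> \<kappa>) x i j k = 0" if "x \<in> ran_chart \<kappa>" for x i j k
    using assms(3,4) that unfolding symplectic_connection_def by blast
qed

lemma patch_change_transition: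
  assumes "smooth_surface \<A>" "symplectic_form \<A> \<Omega>" "symplectic_connection \<A> \<Omega> \<Gamma>" "\<kappa> \<in> \<A>" "\<mu> \<in> \<A>"
  shows "patch_change (ran_chart \<kappa>) (\<Omega> \<kappa>) (\<Gamma> \<kappa>) (ran_chart \<mu>) (\<Omega> \<mu>) (\<Gamma> \<mu>) (overlap \<kappa> \<mu>) (transition \<kappa> \<mu>)"
proof (intro patch_change.intro patch_change_axioms.intro)
  interpret surface \<A> by unfold_locales (rule assms(1))
  show "symplectic_patch (ran_chart \<kappa>) (\<Omega> \<kappa>) (\<Gamma> \<kappa>)" "symplectic_patch (ran_chart \<mu>) (\<Omega> \<mu>) (\<Gamma> \<mu>)"
    using symplectic_patch_chart[OF assms(1-3)] assms(4,5) by auto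
  show "open (overlap \<kappa> \<mu>)" by (rule open_overlap[OF assms(4,5)])
  show "overlap \<kappa> \<mu> \<subseteq> ran_chart \<kappa>" by (auto simp: overlap_def)
  show "transition \<kappa> \<mu> ` overlap \<kappa> \<mu> \<subseteq> ran_chart \<mu>" using transition_in[OF _ assms(4)] by blast
  show "smooth_on (transition \<kappa> \<mu>) (overlap \<kappa> \<mu>)" by (rule smooth_transition[OF assms(4,5)])
  show "\<Omega> \<kappa> x i j = (\<Sum>a\<in>UNIV. \<Sum>b\<in>UNIV. jac (transition \<kappa> \<mu>) x a i * jac (transition \<kappa> \<mu>) x b j
      * \<Omega> \<mu> (transition \<kappa> \<mu> x) a b)" if "x \<in> overlap \<kappa> \<mu>" for x i j
    using assms(2,4,5) that unfolding symplectic_form_def by blast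
  show "(\<Sum>k\<in>UNIV. \<Gamma> \<kappa> x i j k * jac (transition \<kappa> \<mu>) x c k) = pd i (\<lambda>y. jac (transition \<kappa> \<mu>) y c j) x
      + (\<Sum>a\<in>UNIV. \<Sum>b\<in>UNIV. \<Gamma> \<mu> (transition \<kappa> \<mu> x) a b c
          * jac (transition \<kappa> \<mu>) x a i * jac (transition \<kappa> \<mu>) x b j)"
    if "x \<in> overlap \<kappa> \<mu>" for x i j c
    using assms(3-5) that unfolding symplectic_connection_def affine_connection_def by blast
qed

theorem lemma1p5:
  fixes \<A> :: "('a::{t2_space,second_countable_topology}) chart set"
    and \<Omega> :: "'a chart \<Rightarrow> field2"
    and \<Gamma> :: "'a chart \<Rightarrow> field3"
  assumes "smooth_surface \<A>"
    and "symplectic_form \<A> \<Omega>"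
    and "symplectic_connection \<A> \<Omega> \<Gamma>"
  shows "(moment_flat \<A> \<Omega> \<Gamma> \<longleftrightarrow>
           symplectic_vector_field \<A> \<Omega> (\<lambda>\<kappa>. rho_up (\<Omega> \<kappa>) (\<Gamma> \<kappa>)))
         \<and> (projectively_flat \<A> \<Gamma> \<longrightarrow> moment_flat \<A> \<Omega> \<Gamma>)"
proof -
  note patch = symplectic_patch_chart[OF assms]
  \<comment> \<open>Tensoriality of the curvature one-form enters here, as the law
    \<open>X_law\<close> of the dual field.\<close>
  interpret field_with_form \<A> "\<lambda>\<kappa>. rho_up (\<Omega> \<kappa>) (\<Gamma> \<kappa>)" \<Omega>
    using assms(1,2) symplectic_patch.smooth_rho_up[OF patch]
      patch_change.rho_up_law[OF patch_change_transition[OF assms]]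
    by unfold_locales auto
  have div: "divergence \<kappa> x = - 2 * \<Omega> \<kappa> x 1 2 * moment (\<Omega> \<kappa>) (\<Gamma> \<kappa>) x"
    and nz: "\<Omega> \<kappa> x 1 2 \<noteq> 0" if "\<kappa> \<in> \<A>" "x \<in> ran_chart \<kappa>" for \<kappa> x
    using symplectic_patch.divergence_rho_up[OF patch] symplectic_patch.omega_nonzero[OF patch] that
    by blast+
  \<comment> \<open>Divergence and moment differ by the factor
    \<open>- 2 * \<Omega> \<kappa> x 1 2\<close>, which vanishes nowhere.\<close>
  have "moment_flat \<A> \<Omega> \<Gamma> \<longleftrightarrow> (\<forall>\<kappa>\<in>\<A>. \<forall>x\<in>ran_chart \<kappa>. divergence \<kappa> x = 0)"
    using div nz by (simp add: moment_flat_def)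
  also have "\<dots> \<longleftrightarrow> symplectic_vector_field \<A> \<Omega> (\<lambda>\<kappa>. rho_up (\<Omega> \<kappa>) (\<Gamma> \<kappa>))"
    using divergence_zero_imp_symplectic symplectic_imp_divergence_zero by blast
  finally have "moment_flat \<A> \<Omega> \<Gamma> \<longleftrightarrow> symplectic_vector_field \<A> \<Omega> (\<lambda>\<kappa>. rho_up (\<Omega> \<kappa>) (\<Gamma> \<kappa>))" .
  moreover have "projectively_flat \<A> \<Gamma> \<longrightarrow> moment_flat \<A> \<Omega> \<Gamma>"
    unfolding projectively_flat_def moment_flat_def
    using symplectic_patch.cotton_zero_imp_moment_zero[OF patch] by blast
  ultimately show ?thesis ..
qed

end
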